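(* Let $\mathcal R\subseteq\mathbb P^6$ be the ricochet locus and let $I_{\mathcal R}\subseteq\mathbb C[a_0,\dots,a_6]$ be its homogeneous ideal. Then $I_{\mathcal R}=(\mathbf U_6,\mathbf U_{10})$, i.e. $\mathcal R$ is an ideal-theoretic complete intersection of the two invariant hypersurfaces $\mathbf U_6=0$ and $\mathbf U_{10}=0$, where $$\mathbf U_6=4032\,I_2^3-25025\,I_2I_4+45375\,I_6,$$ $$\mathbf U_{10}=358278336\,I_2^2I_6-2772533775\,I_4I_6+6933745\,I_2I_4^2+1207483200\,I_{10},$$ and $I_2,I_4,I_6,I_{10}$ are the standard fundamental invariants of binary sextics, in degrees $2,4,6,10$, as normalised in the context.
   Context: Work over $\mathbb C$. Identify $\mathbb P^6$ with $\mathbb P S_6$, where $S_6$ is the space of binary sextic forms $\Phi=\sum_{k=0}^6a_k x_1^{6-k}x_2^k$; the homogeneous coordinate ring is $\mathbb C[a_0,\dots,a_6]$. A nonzero sextic $\prod_{i=1}^6(\alpha_i x_1-\beta_i x_2)$ corresponds to the sextuple of points $\beta_i/\alpha_i\in\mathbb P^1=\mathbb C\cup\{\infty\}$. A set of six distinct points of $\mathbb P^1$ is in ricochet configuration ($R$-configuration) if its elements can be labelled $A,B,C,D,E,F$ so that for some complex number $t$ a fractional linear transformation takes them respectively to $0,\ t,\ \infty,\ 1,\ \frac{t-1}{t+1},\ -1$. The ricochet locus $\mathcal R\subseteq\mathbb P^6$ is the Zariski closure of the set of all $R$-configurations; it is irreducible of dimension $4$. Transvectants: for binary forms $P$ of degree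 $m$ and $Q$ of degree $n$ in $x_1,x_2$, $$(P,Q)_r=\frac{(m-r)!\,(n-r)!}{m!\,n!}\sum_{i=0}^r(-1)^i\binom ri\frac{\partial^rP}{\partial x_1^{r-i}\partial x_2^{i}}\,\frac{\partial^rQ}{\partial x_1^{i}\partial x_2^{r-i}}.$$ Invariants: for a binary sextic $\Phi$ put $i=(\Phi,\Phi)_4$ (a quartic form) and $l=(\Phi,i)_4$ (a quadratic form). Then $$I_2=(\Phi,\Phi)_6,\quad I_4=(i,i)_4,\quad I_6=(l,l)_2,\quad I_{10}=(\Phi,l^3)_6,$$ viewed as homogeneous polynomials in $a_0,\dots,a_6$. *)

theory Defs
  imports
    "HOL-Analysis.Analysis"
    "HOL-Library.Poly_Mapping"
    "HOL-Computational_Algebra.Polynomial"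
begin

section \<open>The homogeneous coordinate ring and projective 6-space\<close>

text \<open>
  The coordinate ring is realised as the monoid algebra of the exponent vectors on the
  seven-element index type \<^typ>\<open>7\<close>; its elements are \<^term>\<open>of_nat k :: 7\<close> for
  \<open>k = 0, \<dots>, 6\<close>, and arithmetic on indices (modulo 7) plays no role.
\<close>

type_synonym coord_ring = "(7 \<Rightarrow>\<^sub>0 nat) \<Rightarrow>\<^sub>0 complex"

definition const :: "complex \<Rightarrow> coord_ring" where
  "const c = Poly_Mapping.single 0 c"

definition coord :: "7 \<Rightarrow> coord_ring" where
  "coord k = Poly_Mapping.single (Poly_Mapping.single k 1) 1"

definition eval :: "complex ^ 7 \<Rightarrow> coord_ring \<Rightarrow> complex" where
  "eval v f = (\<Sum>m\<in>Poly_Mapping.keys f.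
     Poly_Mapping.lookup f m * (\<Prod>k\<in>UNIV. (v $ k) ^ Poly_Mapping.lookup m k))"

definition homogeneous :: "coord_ring \<Rightarrow> bool" where
  "homogeneous f \<longleftrightarrow>
     (\<exists>d. \<forall>m\<in>Poly_Mapping.keys f. (\<Sum>k\<in>UNIV. Poly_Mapping.lookup m k) = d)"

definition ideal_generated :: "coord_ring set \<Rightarrow> coord_ring set" where
  "ideal_generated S = module.span (*) S"

text \<open>Points of projective space are the lines through the origin.\<close>

definition proj_point :: "complex ^ 7 \<Rightarrow> (complex ^ 7) set" where
  "proj_point v = vec.span {v}"

definition P6 :: "(complex ^ 7) set set" where
  "P6 = {proj_point v | v. v \<noteq> 0}"

definition vanishes_at :: "coord_ring \<Rightarrow> (complex ^ 7) set \<Rightarrow> bool" where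
  "vanishes_at f p \<longleftrightarrow> (\<forall>v\<in>p. eval v f = 0)"

definition zariski_closed :: "(complex ^ 7) set set \<Rightarrow> bool" where
  "zariski_closed Z \<longleftrightarrow>
     (\<exists>T. (\<forall>f\<in>T. homogeneous f) \<and> Z = {p \<in> P6. \<forall>f\<in>T. vanishes_at f p})"

definition homogeneous_ideal :: "(complex ^ 7) set set \<Rightarrow> coord_ring set" where
  "homogeneous_ideal Z = ideal_generated {f. homogeneous f \<and> (\<forall>p\<in>Z. vanishes_at f p)}"


section \<open>Binary forms\<close>

text \<open>
  A binary form is a bivariate polynomial of type \<^typ>\<open>'a poly poly\<close>, with \<open>x\<^sub>1\<close> the inner and
  \<open>x\<^sub>2\<close> the outer variable.
\<close>

definition x1 :: "'a::comm_ring_1 poly poly" where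
  "x1 = [:[:0, 1:]:]"

definition x2 :: "'a::comm_ring_1 poly poly" where
  "x2 = [:0, 1:]"

definition scalar :: "'a::comm_ring_1 \<Rightarrow> 'a poly poly" where
  "scalar c = [:[:c:]:]"

definition sextic :: "(7 \<Rightarrow> 'a::comm_ring_1) \<Rightarrow> 'a poly poly" where
  "sextic a = (\<Sum>k\<le>6. scalar (a (of_nat k)) * x1 ^ (6 - k) * x2 ^ k)"

definition partial1 :: "'a::idom poly poly \<Rightarrow> 'a poly poly" where
  "partial1 P = map_poly pderiv P"

definition partial2 :: "'a::idom poly poly \<Rightarrow> 'a poly poly" where
  "partial2 P = pderiv P"

definition partials :: "nat \<Rightarrow> nat \<Rightarrow> 'a::idom poly poly \<Rightarrow> 'a poly poly" where
  "partials i j P = (partial1 ^^ i) ((partial2 ^^ j) P)"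


section \<open>The ricochet locus\<close>

text \<open>
  The projective line is \<^typ>\<open>complex option\<close>, with \<^term>\<open>None\<close> as the point at infinity.
  \<open>ratio b a\<close> is the point \<open>b/a\<close>, where \<open>(a, b) \<noteq> (0, 0)\<close>.
\<close>

definition ratio :: "complex \<Rightarrow> complex \<Rightarrow> complex option" where
  "ratio b a = (if a = 0 then None else Some (b / a))"

definition frac_linear ::
    "complex \<Rightarrow> complex \<Rightarrow> complex \<Rightarrow> complex \<Rightarrow> complex option \<Rightarrow> complex option" where
  "frac_linear a b c d z =
     (case z of None \<Rightarrow> ratio a c | Some w \<Rightarrow> ratio (a * w + b) (c * w + d))"

definition R_configuration :: "complex option set \<Rightarrow> bool" where
  "R_configuration S \<longleftrightarrow>
     (\<exists>A B C D E F. S = {A, B, C, D, E, F} \<and> distinct [A, B, C, D, E, F] \<and>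
        (\<exists>t a b c d. a * d - b * c \<noteq> 0 \<and>
           frac_linear a b c d A = Some 0 \<and>
           frac_linear a b c d B = Some t \<and>
           frac_linear a b c d C = None \<and>
           frac_linear a b c d D = Some 1 \<and>
           frac_linear a b c d E = ratio (t - 1) (t + 1) \<and>
           frac_linear a b c d F = Some (- 1)))"

text \<open>
  In the following definition the six points \<open>\<beta> i / \<alpha> i\<close> are automatically distinct, since
  an \<open>R\<close>-configuration has six elements.
\<close>

definition R_configuration_points :: "(complex ^ 7) set set" where
  "R_configuration_points =
     {proj_point v | v. v \<noteq> 0 \<and>
        (\<exists>\<alpha> \<beta> :: nat \<Rightarrow> complex.
           sextic (\<lambda>k. v $ k) = (\<Prod>i<6. scalar (\<alpha> i) * x1 - scalar (\<beta> i) * x2) \<and>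
           R_configuration ((\<lambda>i. ratio (\<beta> i) (\<alpha> i)) ` {..<6}))}"

definition ricochet_locus :: "(complex ^ 7) set set" where
  "ricochet_locus = zariski_closed hull R_configuration_points"


section \<open>Transvectants and invariants of the generic sextic\<close>

text \<open>\<open>transvectant m n r P Q\<close> is \<open>(P, Q)\<^sub>r\<close> for forms \<open>P\<close> and \<open>Q\<close> of orders \<open>m\<close> and \<open>n\<close>.\<close>

definition transvectant ::
    "nat \<Rightarrow> nat \<Rightarrow> nat \<Rightarrow> coord_ring poly poly \<Rightarrow> coord_ring poly poly \<Rightarrow> coord_ring poly poly"
  where
  "transvectant m n r P Q =
     scalar (const (fact (m - r) * fact (n - r) / (fact m * fact n))) *
     (\<Sum>i\<le>r. (- 1) ^ i * of_nat (r choose i) * partials (r - i) i P * partials i (r - i) Q)"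

text \<open>A form of order \<open>0\<close>, viewed as an element of the coordinate ring.\<close>

definition order0 :: "coord_ring poly poly \<Rightarrow> coord_ring" where
  "order0 P = coeff (coeff P 0) 0"

definition \<Phi> :: "coord_ring poly poly" where
  "\<Phi> = sextic coord"

definition i_cov :: "coord_ring poly poly" where
  "i_cov = transvectant 6 6 4 \<Phi> \<Phi>"

definition l_cov :: "coord_ring poly poly" where
  "l_cov = transvectant 6 4 4 \<Phi> i_cov"

definition I2 :: coord_ring where
  "I2 = order0 (transvectant 6 6 6 \<Phi> \<Phi>)"

definition I4 :: coord_ring where
  "I4 = order0 (transvectant 4 4 4 i_cov i_cov)"

definition I6 :: coord_ring where
  "I6 = order0 (transvectant 2 2 2 l_cov l_cov)"

definition I10 :: coord_ring where
  "I10 = order0 (transvectant 6 6 6 \<Phi> (l_cov ^ 3))"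

definition U6 :: coord_ring where
  "U6 = 4032 * I2 ^ 3 - 25025 * I2 * I4 + 45375 * I6"

definition U10 :: coord_ring where
  "U10 = 358278336 * I2 ^ 2 * I6 - 2772533775 * I4 * I6
           + 6933745 * I2 * I4 ^ 2 + 1207483200 * I10"

end

theory Submission
  imports Defs "HOL-Computational_Algebra.Fundamental_Theorem_Algebra"
begin

text \<open>
  That the two invariants vanish on the ricochet locus is a computation with the normal form, so let \<open>f\<close> vanish
  on the locus. Once \<open>a\<^sub>0\<close> is inverted, the sextic can be translated so that its second coefficient vanishes;
  in the remaining coordinates \<open>c\<^sub>2, \<dots>, c\<^sub>6\<close> the invariants are led by \<open>c\<^sub>6\<^sup>3\<close> and \<open>c\<^sub>5\<^sup>6\<close>
  for a suitable weight, so division leaves a remainder of degree less than \<open>3\<close> in \<open>c\<^sub>6\<close> and less than \<open>6\<close> in \<open>c\<^sub>5\<close>. Restricting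
  the lowest terms of the remainder successively to \<open>c\<^sub>2 = 0\<close> and \<open>c\<^sub>4 = 0\<close>, and using torus weights, one is left with
  a polynomial of degree at most five in one variable with six zeros, coming from the points of the locus with
  \<open>c\<^sub>2 = c\<^sub>4 = 0\<close>; hence the remainder vanishes and \<open>a\<^sub>0\<^sup>N f\<close> is in the ideal. Finally \<open>a\<^sub>0\<close> is cancelled, because
  the restrictions of the two invariants to a suitable plane in \<open>a\<^sub>0 = 0\<close> are coprime.
\<close>

section \<open>Polynomials in the coefficients\<close>

text \<open>The Moebius map x -> (x-1)/(x+1) has order four and fixed points i and -i; it runs
  cyclically through 0, -1, infinity, 1 and sends t to (t-1)/(t+1). So an R-configuration is a
  four-cycle of such a map together with one further point and its image. With the fixed points at 0
  and infinity the map is multiplication by i, and the sextic becomes a multiple of (L^4 -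
  \<kappa>^4 M^4)(L - z M)(L - i z M). This is the source of the explicit family. Vanishing at
  points controls only the radical of an ideal, whereas the theorem concerns the ideal itself; the
  gap is closed by a sharp count. There are 18 monomials c5^i c6^j with i < 6 and j < 3, and the
  weight modulo 3 sorts them into three classes of six. The number of points used, six, is the
  weighted Bezout number 18 * 30 / (3 * 5 * 6), just enough to separate the monomials of one
  class.\<close>

lemma UNIV_index: "(UNIV :: 7 set) = {0, 1, 2, 3, 4, 5, 6}"
proof (rule sym, rule card_subset_eq)
  show "card {0, 1, 2, 3, 4, 5, 6 :: 7} = card (UNIV :: 7 set)" by simp
qed auto

lemma sum_index: "(\<Sum>k\<in>(UNIV :: 7 set). g k) = g 0 + g 1 + g 2 + g 3 + g 4 + g 5 + (g 6 :: 'a::comm_monoid_add)"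
  unfolding UNIV_index by (simp add: add.assoc)

lemma prod_index: "(\<Prod>k\<in>(UNIV :: 7 set). g k) = g 0 * g 1 * g 2 * g 3 * g 4 * g 5 * (g 6 :: 'a::comm_monoid_mult)"
  unfolding UNIV_index by (simp add: mult.assoc)

lemma all_index: "(\<forall>k :: 7. P k) \<longleftrightarrow> P 0 \<and> P 1 \<and> P 2 \<and> P 3 \<and> P 4 \<and> P 5 \<and> P 6"
  by (rule trans[OF ball_UNIV[symmetric]]) (simp add: UNIV_index)

section \<open>Substitution homomorphisms on the coordinate ring\<close>

definition monom_at :: "(7 \<Rightarrow> 'b::comm_monoid_mult) \<Rightarrow> (7 \<Rightarrow>\<^sub>0 nat) \<Rightarrow> 'b" where
  "monom_at \<sigma> m = (\<Prod>k\<in>UNIV. \<sigma> k ^ Poly_Mapping.lookup m k)"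

lemma monom_at_0 [simp]: "monom_at \<sigma> 0 = 1"
  by (simp add: monom_at_def)

lemma monom_at_add: "monom_at \<sigma> (m + n) = monom_at \<sigma> m * monom_at \<sigma> n"
  by (simp add: monom_at_def lookup_add power_add prod.distrib)

lemma monom_at_single: "monom_at \<sigma> (Poly_Mapping.single k 1) = \<sigma> k"
proof -
  have "monom_at \<sigma> (Poly_Mapping.single k 1) = (\<Prod>j\<in>UNIV. if j = k then \<sigma> j else 1)"
    unfolding monom_at_def by (rule prod.cong) (auto simp: lookup_single when_def)
  then show ?thesis by simp
qed

text \<open>The coefficient map \<open>h\<close> is a parameter, so that evaluation at a point,
  substitution of ring elements and restriction to a path with polynomial entries are instances of
  one homomorphism.\<close>

definition substitute :: "(complex \<Rightarrow> 'b::comm_ring_1) \<Rightarrow> (7 \<Rightarrow> 'b) \<Rightarrow> coord_ring \<Rightarrow> 'b" where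
  "substitute h \<sigma> f = (\<Sum>m\<in>Poly_Mapping.keys f. h (Poly_Mapping.lookup f m) * monom_at \<sigma> m)"

locale coefficient_hom =
  fixes h :: "complex \<Rightarrow> 'b::comm_ring_1"
  assumes h_0: "h 0 = 0" and h_1: "h 1 = 1"
    and h_add: "h (a + b) = h a + h b" and h_mult: "h (a * b) = h a * h b"
begin

lemma substitute_superset:
  assumes "finite K" "Poly_Mapping.keys f \<subseteq> K"
  shows "substitute h \<sigma> f = (\<Sum>m\<in>K. h (Poly_Mapping.lookup f m) * monom_at \<sigma> m)"
  unfolding substitute_def
  by (rule sum.mono_neutral_left) (use assms in \<open>auto simp: in_keys_iff h_0\<close>)

lemma substitute_0 [simp]: "substitute h \<sigma> 0 = 0"
  by (simp add: substitute_def)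

lemma substitute_single: "substitute h \<sigma> (Poly_Mapping.single m c) = h c * monom_at \<sigma> m"
  by (simp add: substitute_def h_0)

lemma substitute_add: "substitute h \<sigma> (f + g) = substitute h \<sigma> f + substitute h \<sigma> g"
proof -
  let ?K = "Poly_Mapping.keys f \<union> Poly_Mapping.keys g"
  have "substitute h \<sigma> (f + g) = (\<Sum>m\<in>?K. h (Poly_Mapping.lookup (f + g) m) * monom_at \<sigma> m)"
    by (rule substitute_superset) (auto simp: keys_add)
  also have "\<dots> = (\<Sum>m\<in>?K. h (Poly_Mapping.lookup f m) * monom_at \<sigma> m)
      + (\<Sum>m\<in>?K. h (Poly_Mapping.lookup g m) * monom_at \<sigma> m)"
    by (simp add: lookup_add h_add distrib_right sum.distrib)
  also have "\<dots> = substitute h \<sigma> f + substitute h \<sigma> g"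
    by (simp add: substitute_superset[of ?K])
  finally show ?thesis .
qed

lemma substitute_sum: "substitute h \<sigma> (sum f X) = (\<Sum>x\<in>X. substitute h \<sigma> (f x))"
  by (induction X rule: infinite_finite_induct) (simp_all add: substitute_add)

end

lemma sum_of_monomials: "(\<Sum>m\<in>Poly_Mapping.keys f. Poly_Mapping.single m (Poly_Mapping.lookup f m)) = f"
proof (rule poly_mapping_eqI)
  fix k
  have "Poly_Mapping.lookup (\<Sum>m\<in>Poly_Mapping.keys f. Poly_Mapping.single m (Poly_Mapping.lookup f m)) k
      = (\<Sum>m\<in>Poly_Mapping.keys f. if k = m then Poly_Mapping.lookup f m else 0)"
    by (simp add: lookup_sum lookup_single when_def eq_commute)
  also have "\<dots> = Poly_Mapping.lookup f k"
    by (simp add: sum.delta in_keys_iff)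
  finally show "Poly_Mapping.lookup (\<Sum>m\<in>Poly_Mapping.keys f. Poly_Mapping.single m (Poly_Mapping.lookup f m)) k
      = Poly_Mapping.lookup f k" .
qed

context coefficient_hom
begin

lemma substitute_mult: "substitute h \<sigma> (f * g) = substitute h \<sigma> f * substitute h \<sigma> g"
proof -
  let ?F = "\<lambda>f m. Poly_Mapping.single m (Poly_Mapping.lookup f m) :: coord_ring"
  have "f * g = sum (?F f) (Poly_Mapping.keys f) * sum (?F g) (Poly_Mapping.keys g)"
    by (simp only: sum_of_monomials)
  also have "\<dots> = (\<Sum>m\<in>Poly_Mapping.keys f. \<Sum>n\<in>Poly_Mapping.keys g. ?F f m * ?F g n)"
    by (simp add: sum_product)
  finally have "substitute h \<sigma> (f * g) = (\<Sum>m\<in>Poly_Mapping.keys f. \<Sum>n\<in>Poly_Mapping.keys g.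
      (h (Poly_Mapping.lookup f m) * monom_at \<sigma> m) * (h (Poly_Mapping.lookup g n) * monom_at \<sigma> n))"
    by (simp add: substitute_sum mult_single substitute_single h_mult monom_at_add mult_ac)
  then show ?thesis
    by (simp add: substitute_def sum_product)
qed

lemma substitute_const [simp]: "substitute h \<sigma> (const c) = h c"
  by (simp add: const_def substitute_single)

lemma substitute_1 [simp]: "substitute h \<sigma> 1 = 1"
  using substitute_const[of \<sigma> 1] by (simp add: const_def h_1)

lemma substitute_coord [simp]: "substitute h \<sigma> (coord k) = \<sigma> k"
  by (simp add: coord_def substitute_single monom_at_single[simplified] h_1)

lemma substitute_uminus: "substitute h \<sigma> (- f) = - substitute h \<sigma> f"
  using substitute_add[of \<sigma> f "- f"] by (simp add: eq_neg_iff_add_eq_0 add.commute)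

lemma substitute_diff: "substitute h \<sigma> (f - g) = substitute h \<sigma> f - substitute h \<sigma> g"
  using substitute_add[of \<sigma> f "- g"] by (simp add: substitute_uminus)

lemma substitute_power: "substitute h \<sigma> (f ^ n) = substitute h \<sigma> f ^ n"
  by (induction n) (simp_all add: substitute_mult)

lemma substitute_numeral [simp]: "substitute h \<sigma> (numeral n) = numeral n"
  by (induction n) (simp_all only: numeral.simps substitute_add substitute_1)

lemma substitute_prod: "substitute h \<sigma> (prod f X) = (\<Prod>x\<in>X. substitute h \<sigma> (f x))"
  by (induction X rule: infinite_finite_induct) (simp_all add: substitute_mult)

lemmas substitute_simps = substitute_add substitute_diff substitute_mult substitute_uminus
  substitute_power substitute_sum substitute_prod

end

interpretation id_hom: coefficient_hom "\<lambda>c. c"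
  by unfold_locales auto

lemma const_0 [simp]: "const 0 = 0" and const_1 [simp]: "const 1 = 1"
  by (simp_all add: const_def)

lemma const_add: "const (a + b) = const a + const b"
  by (simp add: const_def single_add)

lemma const_mult: "const (a * b) = const a * const b"
  unfolding const_def mult_single by simp

lemma const_numeral [simp]: "const (numeral n) = numeral n"
  by (simp add: const_def)

interpretation const_hom: coefficient_hom const
  by unfold_locales (simp_all add: const_add const_mult)

lemma eval_eq_substitute: "eval v f = substitute (\<lambda>c. c) (($) v) f"
  by (simp add: eval_def substitute_def monom_at_def)

lemma eval_0 [simp]: "eval v 0 = 0" and eval_1 [simp]: "eval v 1 = 1"
  and eval_const [simp]: "eval v (const c) = c"
  and eval_coord [simp]: "eval v (coord k) = v $ k"
  and eval_numeral [simp]: "eval v (numeral n) = numeral n"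
  by (simp_all add: eval_eq_substitute)

lemma eval_add: "eval v (f + g) = eval v f + eval v g"
  and eval_diff: "eval v (f - g) = eval v f - eval v g"
  and eval_mult: "eval v (f * g) = eval v f * eval v g"
  and eval_uminus: "eval v (- f) = - eval v f"
  and eval_power: "eval v (f ^ n) = eval v f ^ n"
  and eval_sum: "eval v (sum F X) = (\<Sum>x\<in>X. eval v (F x))"
  and eval_prod: "eval v (prod F X) = (\<Prod>x\<in>X. eval v (F x))"
  by (simp_all add: eval_eq_substitute id_hom.substitute_simps)

lemmas eval_simps = eval_add eval_diff eval_mult eval_uminus eval_power eval_sum eval_prod

lemma single_eq_const_monom: "Poly_Mapping.single m c = const c * monom_at coord m"
proof -
  have mono: "monom_at coord m = Poly_Mapping.single m 1" for m :: "7 \<Rightarrow>\<^sub>0 nat"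
  proof -
    have pow: "coord k ^ n = Poly_Mapping.single (Poly_Mapping.single k n) 1" for k n
      by (induction n) (simp_all add: coord_def mult_single single_add[symmetric])
    have prd: "(\<Prod>k\<in>K. Poly_Mapping.single (Poly_Mapping.single k (Poly_Mapping.lookup m k)) 1)
        = (Poly_Mapping.single (\<Sum>k\<in>K. Poly_Mapping.single k (Poly_Mapping.lookup m k)) 1 :: coord_ring)"
      if "finite K" for K
      using that by (induction K) (simp_all add: mult_single)
    have "(\<Sum>k\<in>UNIV. Poly_Mapping.single k (Poly_Mapping.lookup m k)) = m"
      by (rule poly_mapping_eqI) (simp add: lookup_sum lookup_single when_def)
    then show ?thesis
      by (simp add: monom_at_def pow prd)
  qed
  show ?thesis by (simp add: mono const_def mult_single)
qed

lemma coord_ring_induct [case_names const coord add mult]: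
  assumes "\<And>c. P (const c)" "\<And>k. P (coord k)"
    and "\<And>f g. P f \<Longrightarrow> P g \<Longrightarrow> P (f + g)" and "\<And>f g. P f \<Longrightarrow> P g \<Longrightarrow> P (f * g)"
  shows "P f"
proof -
  have pow: "P (coord k ^ n)" for k n
    by (induction n) (use assms(1)[of 1] assms in auto)
  have "P (\<Prod>k\<in>K. coord k ^ Poly_Mapping.lookup m k)" if "finite K" for K m
    using that by (induction K) (use assms(1)[of 1] assms pow in auto)
  then have "P (Poly_Mapping.single m c)" for m c
    unfolding single_eq_const_monom monom_at_def using assms by simp
  moreover have "P (sum F X)" if "finite X" "\<And>x. P (F x)" for F and X :: "(7 \<Rightarrow>\<^sub>0 nat) set"
    using that by (induction X) (use assms(1)[of 0] assms in auto)
  ultimately have "P (\<Sum>m\<in>Poly_Mapping.keys f. Poly_Mapping.single m (Poly_Mapping.lookup f m))"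
    by simp
  then show ?thesis by (simp only: sum_of_monomials)
qed

lemma eval_substitute: "eval v (substitute const \<sigma> f) = eval (\<chi> k. eval v (\<sigma> k)) f"
  by (induction f rule: coord_ring_induct) (simp_all add: const_hom.substitute_simps eval_simps)

text \<open>The sum is a polynomial in t with infinitely many zeros, and its coefficient of t^n
  collects the fibre of \<open>d\<close> over n. With injective \<open>d\<close> this isolates one
  monomial, otherwise a graded piece.\<close>

lemma power_sum_coeffs_vanish:
  fixes g :: "'i \<Rightarrow> complex" and d :: "'i \<Rightarrow> nat"
  assumes "finite M" "infinite T" and vanish: "\<And>t. t \<in> T \<Longrightarrow> (\<Sum>m\<in>M. g m * t ^ d m) = 0"
  shows "(\<Sum>m\<in>{m \<in> M. d m = n}. g m) = 0"
proof -
  define p where "p = (\<Sum>m\<in>M. monom (g m) (d m))"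
  have "poly p t = (\<Sum>m\<in>M. g m * t ^ d m)" for t
    by (simp add: p_def poly_sum poly_monom)
  then have "T \<subseteq> {t. poly p t = 0}"
    using vanish by auto
  then have "p = 0"
    using \<open>infinite T\<close> infinite_super poly_roots_finite by blast
  have "coeff p n = (\<Sum>m\<in>M. if d m = n then g m else 0)"
    by (simp add: p_def coeff_sum)
  also have "\<dots> = (\<Sum>m\<in>{m \<in> M. d m = n}. g m)"
    using \<open>finite M\<close> by (simp add: sum.inter_filter)
  finally show ?thesis using \<open>p = 0\<close> by simp
qed

lemma eval_as_sum: "eval v f = (\<Sum>m\<in>Poly_Mapping.keys f. Poly_Mapping.lookup f m * monom_at (($) v) m)"
  by (simp add: eval_def monom_at_def)

text \<open>Kronecker substitution: exponents below \<open>N\<close> are the digits of the exponent of \<open>t\<close>.\<close>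

lemma eval_zero_imp_zero:
  assumes "\<And>v. eval v f = 0"
  shows "f = 0"
proof (rule ccontr)
  assume "f \<noteq> 0"
  then obtain m0 where m0: "m0 \<in> Poly_Mapping.keys f" by (metis keys_eq_empty ex_in_conv)
  let ?K = "Poly_Mapping.keys f"
  define B where "B = (\<Union>m\<in>?K. range (Poly_Mapping.lookup m))"
  have "finite B" by (simp add: B_def)
  define N where "N = Suc (Max B)"
  have dig: "Poly_Mapping.lookup m k < N" if "m \<in> ?K" for m k
    using that \<open>finite B\<close> Max_ge[of B "Poly_Mapping.lookup m k"] unfolding N_def B_def by fastforce
  define e where "e m = Poly_Mapping.lookup m 0 + N * (Poly_Mapping.lookup m 1 + N * (Poly_Mapping.lookup m 2
    + N * (Poly_Mapping.lookup m 3 + N * (Poly_Mapping.lookup m 4 + N * (Poly_Mapping.lookup m 5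
    + N * Poly_Mapping.lookup m 6)))))" for m :: "7 \<Rightarrow>\<^sub>0 nat"
  have step: "a = a' \<and> b = b'" if "a + N * b = a' + N * b'" "a < N" "a' < N" for a a' b b' :: nat
  proof -
    have "(a + N * b) mod N = (a' + N * b') mod N" "(a + N * b) div N = (a' + N * b') div N"
      using that(1) by simp_all
    then show ?thesis using that(2,3) by simp
  qed
  have inj: "m = m'" if "m \<in> ?K" "m' \<in> ?K" and e: "e m = e m'" for m m'
  proof (rule poly_mapping_eqI)
    note d = dig[OF that(1)] dig[OF that(2)]
    note s0 = step[OF e[unfolded e_def] d]
    note s1 = step[OF conjunct2[OF s0] d]
    note s2 = step[OF conjunct2[OF s1] d]
    note s3 = step[OF conjunct2[OF s2] d]
    note s4 = step[OF conjunct2[OF s3] d]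
    note s5 = step[OF conjunct2[OF s4] d]
    have "\<forall>k. Poly_Mapping.lookup m k = Poly_Mapping.lookup m' k"
      unfolding all_index using s0 s1 s2 s3 s4 s5 by blast
    then show "Poly_Mapping.lookup m k = Poly_Mapping.lookup m' k" for k by blast
  qed
  define y where "y = (\<lambda>t::complex. \<chi> k. t ^ (if k = 0 then 1 else if k = 1 then N else if k = 2 then N ^ 2
    else if k = 3 then N ^ 3 else if k = 4 then N ^ 4 else if k = 5 then N ^ 5 else N ^ (6::nat)) :: complex ^ 7)"
  have "monom_at (($) (y t)) m = t ^ e m" for t m
  proof -
    have "monom_at (($) (y t)) m = t ^ (Poly_Mapping.lookup m 0 + N * Poly_Mapping.lookup m 1
        + N ^ 2 * Poly_Mapping.lookup m 2 + N ^ 3 * Poly_Mapping.lookup m 3 + N ^ 4 * Poly_Mapping.lookup m 4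
        + N ^ 5 * Poly_Mapping.lookup m 5 + N ^ 6 * Poly_Mapping.lookup m 6)"
      by (simp add: monom_at_def prod_index y_def power_mult power_add)
    also have "\<dots> = t ^ e m"
      by (rule arg_cong[of _ _ "(^) t"]) (simp add: e_def algebra_simps eval_nat_numeral)
    finally show ?thesis .
  qed
  then have "(\<Sum>m\<in>?K. Poly_Mapping.lookup f m * t ^ e m) = 0" for t
    using assms[of "y t"] by (simp add: eval_as_sum)
  from power_sum_coeffs_vanish[OF _ infinite_UNIV_char_0, of ?K "Poly_Mapping.lookup f" e "e m0"] this
  have "(\<Sum>m\<in>{m \<in> ?K. e m = e m0}. Poly_Mapping.lookup f m) = 0" by simp
  moreover have "{m \<in> ?K. e m = e m0} = {m0}" using inj m0 by auto
  ultimately show False using m0 by (simp add: in_keys_iff)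
qed

lemma eval_eq_imp_eq: "(\<And>v. eval v f = eval v g) \<Longrightarrow> f = g"
  using eval_zero_imp_zero[of "f - g"] by (simp add: eval_diff)

section \<open>Weighted homogeneity\<close>

definition isobaric :: "(7 \<Rightarrow> nat) \<Rightarrow> nat \<Rightarrow> coord_ring \<Rightarrow> bool" where
  "isobaric w d f \<longleftrightarrow> (\<forall>m\<in>Poly_Mapping.keys f. (\<Sum>k\<in>UNIV. w k * Poly_Mapping.lookup m k) = d)"

lemma isobaric_0: "isobaric w d 0"
  by (simp add: isobaric_def)

lemma isobaric_const: "isobaric w 0 (const c)"
  by (simp add: isobaric_def const_def)

lemma isobaric_numeral: "isobaric w 0 (numeral n)"
  using isobaric_const[of w "numeral n"] by simp

lemma isobaric_coord: "isobaric w (w k) (coord k)"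
  by (simp add: isobaric_def coord_def lookup_single when_def if_distrib[of "(*) _"] cong: if_cong)

lemma isobaric_add: "isobaric w d f \<Longrightarrow> isobaric w d g \<Longrightarrow> isobaric w d (f + g)"
  using keys_add[of f g] by (fastforce simp: isobaric_def)

lemma isobaric_uminus: "isobaric w d f \<Longrightarrow> isobaric w d (- f)"
  by (simp add: isobaric_def)

lemma isobaric_diff: "isobaric w d f \<Longrightarrow> isobaric w d g \<Longrightarrow> isobaric w d (f - g)"
  using isobaric_add[of w d f "- g"] by (simp add: isobaric_uminus)

lemma isobaric_mult: "isobaric w d f \<Longrightarrow> isobaric w e g \<Longrightarrow> n = d + e \<Longrightarrow> isobaric w n (f * g)"
  using keys_mult[of f g] by (fastforce simp: isobaric_def lookup_add distrib_left sum.distrib)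

lemma isobaric_power: "isobaric w d f \<Longrightarrow> n = d * e \<Longrightarrow> isobaric w n (f ^ e)"
proof (induction e arbitrary: n)
  case 0
  then show ?case using isobaric_const[of w 1] by simp
next
  case (Suc e)
  then show ?case by (auto intro!: isobaric_mult[of w d])
qed

section \<open>The invariants in coordinates\<close>

lemma partials_pCons:
  "partial2 P = pderiv P"
  "partial1 (0 :: 'a::idom poly poly) = 0"
  "partial1 (pCons c P) = pCons (pderiv c) (partial1 P)"
  by (simp_all add: partial1_def partial2_def map_poly_pCons)

text \<open>The coefficient \<open>c k\<close> stands at x1^(2-k) x2^k without a binomial factor,
  and likewise in orders 4 and 6; the fractions in the transvectant formulas below make up for
  this.\<close>

definition form2 :: "(nat \<Rightarrow> 'a::comm_ring_1) \<Rightarrow> 'a poly poly" where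
  "form2 c = [:[:0, 0, c 0:], [:0, c 1:], [:c 2:]:]"

definition form4 :: "(nat \<Rightarrow> 'a::comm_ring_1) \<Rightarrow> 'a poly poly" where
  "form4 c = [:[:0, 0, 0, 0, c 0:], [:0, 0, 0, c 1:], [:0, 0, c 2:], [:0, c 3:], [:c 4:]:]"

definition form6 :: "(nat \<Rightarrow> 'a::comm_ring_1) \<Rightarrow> 'a poly poly" where
  "form6 c = [:[:0, 0, 0, 0, 0, 0, c 0:], [:0, 0, 0, 0, 0, c 1:], [:0, 0, 0, 0, c 2:],
     [:0, 0, 0, c 3:], [:0, 0, c 4:], [:0, c 5:], [:c 6:]:]"

lemma sextic_eq_form6: "sextic a = form6 (\<lambda>k. a (of_nat k))"
proof -
  have one: "smult [:1:] p = p" for p :: "'a poly poly" by (simp add: one_pCons[symmetric])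
  have x1: "x1 ^ n = ([:monom 1 n:] :: 'a poly poly)" for n
    by (induction n) (simp_all add: x1_def monom_Suc one_pCons monom_0)
  have x2: "x2 ^ n = (monom 1 n :: 'a poly poly)" for n
    by (induction n) (simp_all add: x2_def monom_Suc one_pCons monom_0 one)
  show ?thesis
    unfolding sextic_def x1 x2
    by (simp add: form6_def scalar_def atMost_nat_numeral smult_monom monom_0)
      (simp add: eval_nat_numeral monom_Suc monom_0)
qed

text \<open>The list follows the order of \<open>form4\<close>. Ring and scalar embedding
  \<open>h\<close> stay arbitrary so that one formula serves generic, numerical and polynomial
  coefficients.\<close>

definition i_coeff :: "(complex \<Rightarrow> 'a::comm_ring_1) \<Rightarrow> (7 \<Rightarrow> 'a) \<Rightarrow> nat \<Rightarrow> 'a" where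
  "i_coeff h a k = [
     h (2/15) * a 0 * a 4 - h (1/15) * a 1 * a 3 + h (2/75) * a 2 ^ 2,
     h (2/3) * a 0 * a 5 - h (2/15) * a 1 * a 4 + h (2/75) * a 2 * a 3,
     2 * a 0 * a 6 - h (2/25) * a 2 * a 4 + h (1/25) * a 3 ^ 2,
     h (2/3) * a 1 * a 6 - h (2/15) * a 2 * a 5 + h (2/75) * a 3 * a 4,
     h (2/15) * a 2 * a 6 - h (1/15) * a 3 * a 5 + h (2/75) * a 4 ^ 2] ! k"

definition l_coeff :: "(complex \<Rightarrow> 'a::comm_ring_1) \<Rightarrow> (7 \<Rightarrow> 'a) \<Rightarrow> nat \<Rightarrow> 'a" where
  "l_coeff h a k = (let i = i_coeff h a in [
     a 0 * i 4 - h (1/6) * a 1 * i 3 + h (1/15) * a 2 * i 2 - h (1/20) * a 3 * i 1 + h (1/15) * a 4 * i 0,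
     h (1/3) * a 1 * i 4 - h (2/15) * a 2 * i 3 + h (1/10) * a 3 * i 2 - h (2/15) * a 4 * i 1 + h (1/3) * a 5 * i 0,
     h (1/15) * a 2 * i 4 - h (1/20) * a 3 * i 3 + h (1/15) * a 4 * i 2 - h (1/6) * a 5 * i 1 + a 6 * i 0] ! k)"

definition cube_coeff :: "(nat \<Rightarrow> 'a::comm_ring_1) \<Rightarrow> nat \<Rightarrow> 'a" where
  "cube_coeff l k = [l 0 ^ 3, 3 * l 0 ^ 2 * l 1, 3 * l 0 ^ 2 * l 2 + 3 * l 0 * l 1 ^ 2,
     6 * l 0 * l 1 * l 2 + l 1 ^ 3, 3 * l 0 * l 2 ^ 2 + 3 * l 1 ^ 2 * l 2, 3 * l 1 * l 2 ^ 2, l 2 ^ 3] ! k"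

lemma form2_cube: "form2 l ^ 3 = form6 (cube_coeff l)"
  by (simp add: form2_def form6_def cube_coeff_def power3_eq_cube power2_eq_square algebra_simps)

lemma i_cov_eq: "i_cov = form4 (i_coeff const coord)"
  unfolding i_cov_def \<Phi>_def sextic_eq_form6 transvectant_def form6_def form4_def
  by (simp add: partials_def partials_pCons pderiv_pCons eval_nat_numeral scalar_def i_coeff_def numeral_poly;
    intro conjI; rule eval_eq_imp_eq; simp add: eval_simps field_simps)

text \<open>The quartic stays symbolic: the identities are then linear in \<open>i\<close>, and the
  quadratic expressions for its coefficients never have to be multiplied out.\<close>

lemma transvectant_form6_form4: "transvectant 6 4 4 (form6 (\<lambda>k. a (of_nat k))) (form4 i) = form2 (\<lambda>k. [
     a 0 * i 4 - const (1/6) * a 1 * i 3 + const (1/15) * a 2 * i 2 - const (1/20) * a 3 * i 1 + const (1/15) * a 4 * i 0,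
     const (1/3) * a 1 * i 4 - const (2/15) * a 2 * i 3 + const (1/10) * a 3 * i 2 - const (2/15) * a 4 * i 1 + const (1/3) * a 5 * i 0,
     const (1/15) * a 2 * i 4 - const (1/20) * a 3 * i 3 + const (1/15) * a 4 * i 2 - const (1/6) * a 5 * i 1 + a 6 * i 0] ! k)"
  unfolding transvectant_def form6_def form4_def form2_def
  by (simp add: partials_def partials_pCons pderiv_pCons eval_nat_numeral scalar_def numeral_poly;
    intro conjI; rule eval_eq_imp_eq; simp add: eval_simps field_simps)

lemma l_cov_eq: "l_cov = form2 (l_coeff const coord)"
  unfolding l_cov_def i_cov_eq \<Phi>_def sextic_eq_form6 transvectant_form6_form4 l_coeff_def Let_def ..

lemma transvectant_form6_form6: "order0 (transvectant 6 6 6 (form6 a) (form6 b)) =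
  a 0 * b 6 - const (1/6) * a 1 * b 5 + const (1/15) * a 2 * b 4 - const (1/20) * a 3 * b 3
    + const (1/15) * a 4 * b 2 - const (1/6) * a 5 * b 1 + a 6 * b 0"
  unfolding transvectant_def form6_def
  by (simp add: partials_def partials_pCons pderiv_pCons eval_nat_numeral scalar_def numeral_poly order0_def;
    rule eval_eq_imp_eq; simp add: eval_simps field_simps)

lemma transvectant_form4_form4: "order0 (transvectant 4 4 4 (form4 a) (form4 b)) =
  a 0 * b 4 - const (1/4) * a 1 * b 3 + const (1/6) * a 2 * b 2 - const (1/4) * a 3 * b 1 + a 4 * b 0"
  unfolding transvectant_def form4_def
  by (simp add: partials_def partials_pCons pderiv_pCons eval_nat_numeral scalar_def numeral_poly order0_def;
    rule eval_eq_imp_eq; simp add: eval_simps field_simps)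

lemma transvectant_form2_form2: "order0 (transvectant 2 2 2 (form2 a) (form2 b)) =
  a 0 * b 2 - const (1/2) * a 1 * b 1 + a 2 * b 0"
  unfolding transvectant_def form2_def
  by (simp add: partials_def partials_pCons pderiv_pCons eval_nat_numeral scalar_def numeral_poly order0_def;
    rule eval_eq_imp_eq; simp add: eval_simps field_simps)

definition J2 :: "(complex \<Rightarrow> 'a::comm_ring_1) \<Rightarrow> (7 \<Rightarrow> 'a) \<Rightarrow> 'a" where
  "J2 h a = 2 * a 0 * a 6 - h (1/3) * a 1 * a 5 + h (2/15) * a 2 * a 4 - h (1/20) * a 3 ^ 2"

definition J4 :: "(complex \<Rightarrow> 'a::comm_ring_1) \<Rightarrow> (7 \<Rightarrow> 'a) \<Rightarrow> 'a" where
  "J4 h a = (let i = i_coeff h a in 2 * i 0 * i 4 - h (1/2) * i 1 * i 3 + h (1/6) * i 2 ^ 2)"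

definition J6 :: "(complex \<Rightarrow> 'a::comm_ring_1) \<Rightarrow> (7 \<Rightarrow> 'a) \<Rightarrow> 'a" where
  "J6 h a = (let l = l_coeff h a in 2 * l 0 * l 2 - h (1/2) * l 1 ^ 2)"

definition J10 :: "(complex \<Rightarrow> 'a::comm_ring_1) \<Rightarrow> (7 \<Rightarrow> 'a) \<Rightarrow> 'a" where
  "J10 h a = (let b = cube_coeff (l_coeff h a) in
     a 0 * b 6 - h (1/6) * a 1 * b 5 + h (1/15) * a 2 * b 4 - h (1/20) * a 3 * b 3
       + h (1/15) * a 4 * b 2 - h (1/6) * a 5 * b 1 + a 6 * b 0)"

lemma I_eq: "I2 = J2 const coord" "I4 = J4 const coord" "I6 = J6 const coord" "I10 = J10 const coord"
  unfolding I2_def I4_def I6_def I10_def i_cov_eq l_cov_eq \<Phi>_def sextic_eq_form6 form2_cube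
    transvectant_form6_form6 transvectant_form4_form4 transvectant_form2_form2
  by (rule eval_eq_imp_eq; simp add: eval_simps J2_def J4_def J6_def J10_def Let_def power2_eq_square)+

definition W6 :: "(complex \<Rightarrow> 'a::comm_ring_1) \<Rightarrow> (7 \<Rightarrow> 'a) \<Rightarrow> 'a" where
  "W6 h a = 4032 * J2 h a ^ 3 - 25025 * J2 h a * J4 h a + 45375 * J6 h a"

definition W10 :: "(complex \<Rightarrow> 'a::comm_ring_1) \<Rightarrow> (7 \<Rightarrow> 'a) \<Rightarrow> 'a" where
  "W10 h a = 358278336 * J2 h a ^ 2 * J6 h a - 2772533775 * J4 h a * J6 h a
    + 6933745 * J2 h a * J4 h a ^ 2 + 1207483200 * J10 h a"

lemma U6_eq: "U6 = W6 const coord" and U10_eq: "U10 = W10 const coord"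
  by (simp_all only: U6_def U10_def W6_def W10_def I_eq)

lemma (in coefficient_hom) substitute_i_coeff:
  "k < 5 \<Longrightarrow> substitute h \<sigma> (i_coeff const coord k) = i_coeff h \<sigma> k"
  by (auto simp: i_coeff_def substitute_simps numeral_eq_Suc less_Suc_eq)

lemma (in coefficient_hom) substitute_l_coeff:
  "k < 3 \<Longrightarrow> substitute h \<sigma> (l_coeff const coord k) = l_coeff h \<sigma> k"
  by (auto simp: l_coeff_def Let_def substitute_simps substitute_i_coeff numeral_eq_Suc less_Suc_eq)

lemma (in coefficient_hom) substitute_U:
  "substitute h \<sigma> U6 = W6 h \<sigma>" "substitute h \<sigma> U10 = W10 h \<sigma>"
proof -
  have "k < 7 \<Longrightarrow> substitute h \<sigma> (cube_coeff (l_coeff const coord) k) = cube_coeff (l_coeff h \<sigma>) k" for k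
    by (auto simp: cube_coeff_def substitute_simps substitute_l_coeff eval_nat_numeral less_Suc_eq)
  then have "substitute h \<sigma> (J2 const coord) = J2 h \<sigma>" "substitute h \<sigma> (J4 const coord) = J4 h \<sigma>"
    "substitute h \<sigma> (J6 const coord) = J6 h \<sigma>" "substitute h \<sigma> (J10 const coord) = J10 h \<sigma>"
    by (simp_all add: J2_def J4_def J6_def J10_def Let_def substitute_simps substitute_i_coeff substitute_l_coeff)
  then show "substitute h \<sigma> U6 = W6 h \<sigma>" "substitute h \<sigma> U10 = W10 h \<sigma>"
    by (simp_all add: U6_eq U10_eq W6_def W10_def substitute_simps)
qed

lemma nth_literal:
  "(x # xs) ! 0 = x" "(x # xs) ! 1 = xs ! 0" "(x # xs) ! 2 = xs ! 1" "(x # xs) ! 3 = xs ! 2"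
  "(x # xs) ! 4 = xs ! 3" "(x # xs) ! 5 = xs ! 4" "(x # xs) ! 6 = xs ! 5"
  by simp_all

definition vec7 :: "complex \<Rightarrow> complex \<Rightarrow> complex \<Rightarrow> complex \<Rightarrow> complex \<Rightarrow> complex \<Rightarrow> complex \<Rightarrow> complex ^ 7" where
  "vec7 c0 c1 c2 c3 c4 c5 c6 = (\<chi> k. if k = 0 then c0 else if k = 1 then c1 else if k = 2 then c2
     else if k = 3 then c3 else if k = 4 then c4 else if k = 5 then c5 else c6)"

lemma vec7_nth [simp]:
  "vec7 c0 c1 c2 c3 c4 c5 c6 $ 0 = c0" "vec7 c0 c1 c2 c3 c4 c5 c6 $ 1 = c1"
  "vec7 c0 c1 c2 c3 c4 c5 c6 $ 2 = c2" "vec7 c0 c1 c2 c3 c4 c5 c6 $ 3 = c3"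
  "vec7 c0 c1 c2 c3 c4 c5 c6 $ 4 = c4" "vec7 c0 c1 c2 c3 c4 c5 c6 $ 5 = c5"
  "vec7 c0 c1 c2 c3 c4 c5 c6 $ 6 = c6"
  by (simp_all add: vec7_def)

lemma vec7_eqI: "x $ 0 = y $ 0 \<Longrightarrow> x $ 1 = y $ 1 \<Longrightarrow> x $ 2 = y $ 2 \<Longrightarrow> x $ 3 = y $ 3 \<Longrightarrow> x $ 4 = y $ 4
  \<Longrightarrow> x $ 5 = y $ 5 \<Longrightarrow> x $ 6 = y $ 6 \<Longrightarrow> x = (y :: complex ^ 7)"
  by (simp add: vec_eq_iff all_index)

section \<open>Invariance\<close>

text \<open>The coefficients after x1 is replaced by x1 + s x2.\<close>

definition shift :: "complex \<Rightarrow> complex ^ 7 \<Rightarrow> complex ^ 7" where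
  "shift s v = vec7 (v $ 0)
    (6 * s * v $ 0 + v $ 1)
    (15 * s ^ 2 * v $ 0 + 5 * s * v $ 1 + v $ 2)
    (20 * s ^ 3 * v $ 0 + 10 * s ^ 2 * v $ 1 + 4 * s * v $ 2 + v $ 3)
    (15 * s ^ 4 * v $ 0 + 10 * s ^ 3 * v $ 1 + 6 * s ^ 2 * v $ 2 + 3 * s * v $ 3 + v $ 4)
    (6 * s ^ 5 * v $ 0 + 5 * s ^ 4 * v $ 1 + 4 * s ^ 3 * v $ 2 + 3 * s ^ 2 * v $ 3 + 2 * s * v $ 4 + v $ 5)
    (s ^ 6 * v $ 0 + s ^ 5 * v $ 1 + s ^ 4 * v $ 2 + s ^ 3 * v $ 3 + s ^ 2 * v $ 4 + s * v $ 5 + v $ 6)"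

definition reverse :: "complex ^ 7 \<Rightarrow> complex ^ 7" where
  "reverse v = vec7 (v $ 6) (v $ 5) (v $ 4) (v $ 3) (v $ 2) (v $ 1) (v $ 0)"

lemma W_eq_eval: "W6 (\<lambda>c. c) (($) v) = eval v U6" "W10 (\<lambda>c. c) (($) v) = eval v U10"
  by (simp_all add: eval_eq_substitute id_hom.substitute_U)

text \<open>Covariance in layers: i, l and l^3 transform under the shift like forms of order 4, 2
  and 6. Each layer uses only the laws of the one before, so the invariant of degree 10 is never
  expanded in the original coefficients.\<close>

lemma invariants_shift:
  "J2 (\<lambda>c. c) (($) (shift s v)) = J2 (\<lambda>c. c) (($) v)" (is ?J2)
  "J4 (\<lambda>c. c) (($) (shift s v)) = J4 (\<lambda>c. c) (($) v)" (is ?J4)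
  "J6 (\<lambda>c. c) (($) (shift s v)) = J6 (\<lambda>c. c) (($) v)" (is ?J6)
  "J10 (\<lambda>c. c) (($) (shift s v)) = J10 (\<lambda>c. c) (($) v)" (is ?J10)
proof -
  let ?i = "i_coeff (\<lambda>c. c) (($) v)" and ?i' = "i_coeff (\<lambda>c. c) (($) (shift s v))"
  let ?l = "l_coeff (\<lambda>c. c) (($) v)" and ?l' = "l_coeff (\<lambda>c. c) (($) (shift s v))"
  let ?b = "cube_coeff ?l" and ?b' = "cube_coeff ?l'"
  have i:
    "?i' 0 = ?i 0"
    "?i' 1 = 4 * s * ?i 0 + ?i 1"
    "?i' 2 = 6 * s ^ 2 * ?i 0 + 3 * s * ?i 1 + ?i 2"
    "?i' 3 = 4 * s ^ 3 * ?i 0 + 3 * s ^ 2 * ?i 1 + 2 * s * ?i 2 + ?i 3"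
    "?i' 4 = s ^ 4 * ?i 0 + s ^ 3 * ?i 1 + s ^ 2 * ?i 2 + s * ?i 3 + ?i 4"
    unfolding i_coeff_def shift_def vec7_nth nth_literal by algebra+
  have l:
    "?l' 0 = ?l 0"
    "?l' 1 = 2 * s * ?l 0 + ?l 1"
    "?l' 2 = s ^ 2 * ?l 0 + s * ?l 1 + ?l 2"
    unfolding l_coeff_def Let_def nth_literal i unfolding shift_def vec7_nth by algebra+
  have b:
    "?b' 0 = ?b 0"
    "?b' 1 = 6 * s * ?b 0 + ?b 1"
    "?b' 2 = 15 * s ^ 2 * ?b 0 + 5 * s * ?b 1 + ?b 2"
    "?b' 3 = 20 * s ^ 3 * ?b 0 + 10 * s ^ 2 * ?b 1 + 4 * s * ?b 2 + ?b 3"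
    "?b' 4 = 15 * s ^ 4 * ?b 0 + 10 * s ^ 3 * ?b 1 + 6 * s ^ 2 * ?b 2 + 3 * s * ?b 3 + ?b 4"
    "?b' 5 = 6 * s ^ 5 * ?b 0 + 5 * s ^ 4 * ?b 1 + 4 * s ^ 3 * ?b 2 + 3 * s ^ 2 * ?b 3 + 2 * s * ?b 4 + ?b 5"
    "?b' 6 = s ^ 6 * ?b 0 + s ^ 5 * ?b 1 + s ^ 4 * ?b 2 + s ^ 3 * ?b 3 + s ^ 2 * ?b 4 + s * ?b 5 + ?b 6"
    unfolding cube_coeff_def nth_literal l by algebra+
  show ?J2
    unfolding J2_def shift_def vec7_nth by algebra
  show ?J4
    unfolding J4_def Let_def i by algebra
  show ?J6
    unfolding J6_def Let_def l by algebra
  show ?J10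
    unfolding J10_def Let_def b unfolding shift_def vec7_nth by algebra
qed

lemma eval_U_shift: "eval (shift s v) U6 = eval v U6" "eval (shift s v) U10 = eval v U10"
  unfolding W_eq_eval[symmetric] W6_def W10_def invariants_shift by simp_all

text \<open>Exchanging the variables has determinant -1 and multiplies an invariant by -1 to the
  power of its weight; the weights 18 and 30 are even.\<close>

lemma eval_U_reverse: "eval (reverse v) U6 = eval v U6" "eval (reverse v) U10 = eval v U10"
proof -
  let ?i = "i_coeff (\<lambda>c. c) (($) v)" and ?i' = "i_coeff (\<lambda>c. c) (($) (reverse v))"
  let ?l = "l_coeff (\<lambda>c. c) (($) v)" and ?l' = "l_coeff (\<lambda>c. c) (($) (reverse v))"
  let ?b = "cube_coeff ?l" and ?b' = "cube_coeff ?l'"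
  have i: "?i' 0 = ?i 4" "?i' (Suc 0) = ?i 3" "?i' 1 = ?i 3" "?i' 2 = ?i 2" "?i' 3 = ?i 1" "?i' 4 = ?i 0"
    by (simp_all add: i_coeff_def reverse_def algebra_simps)
  have l: "?l' 0 = ?l 2" "?l' (Suc 0) = ?l 1" "?l' 1 = ?l 1" "?l' 2 = ?l 0"
    unfolding l_coeff_def Let_def i by (simp_all add: reverse_def)
  have b: "?b' 0 = ?b 6" "?b' (Suc 0) = ?b 5" "?b' 1 = ?b 5" "?b' 2 = ?b 4" "?b' 3 = ?b 3" "?b' 4 = ?b 2"
    "?b' 5 = ?b 1" "?b' 6 = ?b 0"
    unfolding cube_coeff_def l by (simp_all add: algebra_simps)
  have J: "J2 (\<lambda>c. c) (($) (reverse v)) = J2 (\<lambda>c. c) (($) v)" "J4 (\<lambda>c. c) (($) (reverse v)) = J4 (\<lambda>c. c) (($) v)"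
    "J6 (\<lambda>c. c) (($) (reverse v)) = J6 (\<lambda>c. c) (($) v)" "J10 (\<lambda>c. c) (($) (reverse v)) = J10 (\<lambda>c. c) (($) v)"
    unfolding J2_def J4_def J6_def J10_def Let_def i l b by (simp_all add: reverse_def algebra_simps)
  show "eval (reverse v) U6 = eval v U6" "eval (reverse v) U10 = eval v U10"
    unfolding W_eq_eval[symmetric] W6_def W10_def J by simp_all
qed

lemma isobaric_cong: "isobaric w d f \<Longrightarrow> d = n \<Longrightarrow> isobaric w n f"
  by simp

definition index :: "7 \<Rightarrow> nat" where
  "index k = (if k = 0 then 0 else if k = 1 then 1 else if k = 2 then 2 else if k = 3 then 3
     else if k = 4 then 4 else if k = 5 then 5 else 6)"

lemma index_simps [simp]: "index 0 = 0" "index 1 = 1" "index 2 = 2" "index 3 = 3" "index 4 = 4" "index 5 = 5" "index 6 = 6"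
  by (simp_all add: index_def)

lemmas isobaric_rules = isobaric_mult[OF _ _ refl] isobaric_power[OF _ refl] isobaric_const isobaric_numeral

text \<open>One computation serves three gradings: the degree (\<open>p = 1\<close>,
  \<open>q = 0\<close>), the index weight (\<open>p = 0\<close>, \<open>q = 1\<close>) and the zero
  weight (\<open>p = q = 0\<close>), which later shows that certain coordinates are absent. An
  invariant of degree d has index weight 3 d.\<close>

lemma isobaric_W:
  assumes \<sigma>: "\<And>k. isobaric w (p + q * index k) (\<sigma> k)"
  shows "isobaric w (6 * p + 18 * q) (W6 const \<sigma>)" "isobaric w (10 * p + 30 * q) (W10 const \<sigma>)"
proof -
  let ?i = "i_coeff const \<sigma>" and ?l = "l_coeff const \<sigma>"
  let ?b = "cube_coeff ?l"
  have i: "isobaric w (2 * p + 4 * q) (?i 0)" "isobaric w (2 * p + 5 * q) (?i 1)" "isobaric w (2 * p + 6 * q) (?i 2)"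
    "isobaric w (2 * p + 7 * q) (?i 3)" "isobaric w (2 * p + 8 * q) (?i 4)"
    unfolding i_coeff_def nth_literal by - ((intro isobaric_add isobaric_diff)?, (rule isobaric_cong, (rule isobaric_rules \<sigma>)+, simp add: algebra_simps)+)+
  have l: "isobaric w (3 * p + 8 * q) (?l 0)" "isobaric w (3 * p + 9 * q) (?l 1)" "isobaric w (3 * p + 10 * q) (?l 2)"
    unfolding l_coeff_def Let_def nth_literal by - ((intro isobaric_add isobaric_diff)?, (rule isobaric_cong, (rule isobaric_rules \<sigma> i)+, simp add: algebra_simps)+)+
  have b: "isobaric w (9 * p + 24 * q) (?b 0)" "isobaric w (9 * p + 25 * q) (?b 1)" "isobaric w (9 * p + 26 * q) (?b 2)"
    "isobaric w (9 * p + 27 * q) (?b 3)" "isobaric w (9 * p + 28 * q) (?b 4)" "isobaric w (9 * p + 29 * q) (?b 5)"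
    "isobaric w (9 * p + 30 * q) (?b 6)"
    unfolding cube_coeff_def nth_literal by - ((intro isobaric_add isobaric_diff)?, (rule isobaric_cong, (rule isobaric_rules \<sigma> l)+, simp add: algebra_simps)+)+
  have J2: "isobaric w (2 * p + 6 * q) (J2 const \<sigma>)"
    unfolding J2_def by - ((intro isobaric_add isobaric_diff)?, (rule isobaric_cong, (rule isobaric_rules \<sigma>)+, simp add: algebra_simps)+)+
  have J4: "isobaric w (4 * p + 12 * q) (J4 const \<sigma>)"
    unfolding J4_def Let_def by - ((intro isobaric_add isobaric_diff)?, (rule isobaric_cong, (rule isobaric_rules \<sigma> i)+, simp add: algebra_simps)+)+
  have J6: "isobaric w (6 * p + 18 * q) (J6 const \<sigma>)"
    unfolding J6_def Let_def by - ((intro isobaric_add isobaric_diff)?, (rule isobaric_cong, (rule isobaric_rules \<sigma> l)+, simp add: algebra_simps)+)+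
  have J10: "isobaric w (10 * p + 30 * q) (J10 const \<sigma>)"
    unfolding J10_def Let_def by - ((intro isobaric_add isobaric_diff)?, (rule isobaric_cong, (rule isobaric_rules \<sigma> b)+, simp add: algebra_simps)+)+
  show "isobaric w (6 * p + 18 * q) (W6 const \<sigma>)" "isobaric w (10 * p + 30 * q) (W10 const \<sigma>)"
    unfolding W6_def W10_def by - ((intro isobaric_add isobaric_diff)?, (rule isobaric_cong, (rule isobaric_rules \<sigma> J2 J4 J6 J10)+, simp add: algebra_simps)+)+
qed

lemma eval_isobaric_scale:
  assumes "isobaric w d f"
  shows "eval (\<chi> k. t ^ w k * v $ k) f = t ^ d * eval v f"
proof -
  have "monom_at (($) (\<chi> k. t ^ w k * v $ k)) m = t ^ (\<Sum>k\<in>UNIV. w k * Poly_Mapping.lookup m k) * monom_at (($) v) m" for m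
    by (simp add: monom_at_def power_mult_distrib prod.distrib power_sum power_mult)
  then show ?thesis
    using assms by (simp add: eval_as_sum isobaric_def sum_distrib_left mult_ac)
qed

lemma isobaric_U_degree: "isobaric (\<lambda>_. 1) 6 U6" "isobaric (\<lambda>_. 1) 10 U10"
  using isobaric_W[of "\<lambda>_. 1" 1 0 coord] isobaric_coord[of "\<lambda>_. 1"] by (simp_all add: U6_eq U10_eq)

lemma isobaric_U_weight: "isobaric index 18 U6" "isobaric index 30 U10"
  using isobaric_W[of index 0 1 coord] isobaric_coord[of index] by (simp_all add: U6_eq U10_eq)

lemma eval_U_degree:
  "eval (\<chi> k. t * v $ k) U6 = t ^ 6 * eval v U6" "eval (\<chi> k. t * v $ k) U10 = t ^ 10 * eval v U10"
  using eval_isobaric_scale[OF isobaric_U_degree(1), of t v] eval_isobaric_scale[OF isobaric_U_degree(2), of t v]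
  by simp_all

lemma eval_U_weight:
  "eval (\<chi> k. t ^ index k * v $ k) U6 = t ^ 18 * eval v U6"
  "eval (\<chi> k. t ^ index k * v $ k) U10 = t ^ 30 * eval v U10"
  using eval_isobaric_scale[OF isobaric_U_weight(1), of t v] eval_isobaric_scale[OF isobaric_U_weight(2), of t v]
  by simp_all

section \<open>Sextics as functions of two variables\<close>

definition form_at :: "complex ^ 7 \<Rightarrow> complex \<Rightarrow> complex \<Rightarrow> complex" where
  "form_at v x y = v $ 0 * x ^ 6 + v $ 1 * x ^ 5 * y + v $ 2 * x ^ 4 * y ^ 2 + v $ 3 * x ^ 3 * y ^ 3
     + v $ 4 * x ^ 2 * y ^ 4 + v $ 5 * x * y ^ 5 + v $ 6 * y ^ 6"

lemma form_at_shift: "form_at (shift s v) x y = form_at v (x + s * y) y"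
  unfolding form_at_def shift_def vec7_nth by algebra

lemma form_at_reverse: "form_at (reverse v) x y = form_at v y x"
  unfolding form_at_def reverse_def vec7_nth by algebra

lemma form_at_inject:
  assumes "\<And>x y. form_at v x y = form_at w x y"
  shows "v = w"
proof -
  have "poly [:v $ 6, v $ 5, v $ 4, v $ 3, v $ 2, v $ 1, v $ 0:] = poly [:w $ 6, w $ 5, w $ 4, w $ 3, w $ 2, w $ 1, w $ 0:]"
  proof
    fix x
    show "poly [:v $ 6, v $ 5, v $ 4, v $ 3, v $ 2, v $ 1, v $ 0:] x
        = poly [:w $ 6, w $ 5, w $ 4, w $ 3, w $ 2, w $ 1, w $ 0:] x"
      using assms[of x 1] by (simp add: form_at_def algebra_simps power_numeral_reduce)
  qed
  then show ?thesis by (intro vec7_eqI) (simp_all add: poly_eq_poly_eq_iff)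
qed

lemma poly_sextic: "poly (poly (sextic (\<lambda>k. v $ k)) [:y:]) x = form_at v x y"
  unfolding sextic_eq_form6 form6_def form_at_def
  by (simp add: algebra_simps power_numeral_reduce)

lemma form_at_eq_iff: "sextic (\<lambda>k. v $ k) = P \<Longrightarrow> form_at v x y = poly (poly P [:y:]) x"
  using poly_sextic[of v y x] by simp

section \<open>Vanishing on the ricochet locus\<close>

text \<open>The roots X/Y are 0, infinity, 1, -1, t and (t-1)/(t+1).\<close>

definition ricochet_form :: "complex \<Rightarrow> complex \<Rightarrow> complex \<Rightarrow> complex" where
  "ricochet_form t X Y = X * Y * (X^2 - Y^2) * (X - t * Y) * ((t + 1) * X - (t - 1) * Y)"

text \<open>The tables expand i, l, l^3 and then the four invariants as polynomials in t, so that
  the final cancellation only involves polynomials of degree at most 20 in t.\<close>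

lemma eval_U_ricochet_normal_form:
  assumes "\<And>x y. form_at v x y = ricochet_form t x y"
  shows "eval v U6 = 0" "eval v U10 = 0"
proof -
  have v: "v = vec7 0 (t + 1) (1 - 2 * t - t ^ 2) (t ^ 2 - 2 * t - 1) (t ^ 2 + 2 * t - 1) (t - t ^ 2) 0"
    by (rule form_at_inject, unfold assms, unfold form_at_def vec7_nth ricochet_form_def) algebra
  let ?i = "i_coeff (\<lambda>c. c) (($) v)" and ?l = "l_coeff (\<lambda>c. c) (($) v)"
  let ?b = "cube_coeff ?l"
  have i:
    "?i 0 = (2/75) * t ^ 4 + (1/25) * t ^ 3 + (3/25) * t ^ 2 + (7/75) * t + (7/75)"
    "?i 1 = (-2/75) * t ^ 4 + (-2/15) * t ^ 3 + (-6/25) * t ^ 2 + (-2/15) * t + (8/75)"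
    "?i 2 = (3/25) * t ^ 4 + (4/25) * t ^ 3 + (6/25) * t ^ 2 + (-4/25) * t + (3/25)"
    "?i 3 = (-8/75) * t ^ 4 + (-2/15) * t ^ 3 + (6/25) * t ^ 2 + (-2/15) * t + (2/75)"
    "?i 4 = (7/75) * t ^ 4 + (-7/75) * t ^ 3 + (3/25) * t ^ 2 + (-1/25) * t + (2/75)"
    unfolding i_coeff_def nth_literal v vec7_nth by algebra+
  have l:
    "?l 0 = (-11/2250) * t ^ 6 + (1/750) * t ^ 5 + (22/1125) * t ^ 4 + (-37/1125) * t ^ 3 + (-19/2250) * t ^ 2 + (1/750) * t + (1/375)"
    "?l 1 = (-17/2250) * t ^ 6 + (-1/375) * t ^ 5 + (7/250) * t ^ 4 + (74/1125) * t ^ 3 + (-7/250) * t ^ 2 + (-1/375) * t + (17/2250)"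
    "?l 2 = (1/375) * t ^ 6 + (-1/750) * t ^ 5 + (-19/2250) * t ^ 4 + (37/1125) * t ^ 3 + (22/1125) * t ^ 2 + (-1/750) * t + (-11/2250)"
    unfolding l_coeff_def Let_def nth_literal i unfolding v vec7_nth by algebra+
  have b:
    "?b 0 = (-1331/11390625000) * t ^ 18 + (121/1265625000) * t ^ 17 + (209/151875000) * t ^ 16 + (-11849/3796875000) * t ^ 15 + (-407/84375000) * t ^ 14 + (78391/3796875000) * t ^ 13 + (-19577/2278125000) * t ^ 12 + (-166057/3796875000) * t ^ 11 + (208547/3796875000) * t ^ 10 + (4091/2278125000) * t ^ 9 + (-96677/3796875000) * t ^ 8 + (-55427/3796875000) * t ^ 7 + (17449/2278125000) * t ^ 6 + (703/140625000) * t ^ 5 + (61/253125000) * t ^ 4 + (-371/421875000) * t ^ 3 + (-7/42187500) * t ^ 2 + (1/35156250) * t + (1/52734375)"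
    "?b 1 = (-2057/3796875000) * t ^ 18 + (11/105468750) * t ^ 17 + (12161/1898437500) * t ^ 16 + (-211/63281250) * t ^ 15 + (-12163/379687500) * t ^ 14 + (83/3796875) * t ^ 13 + (220319/1898437500) * t ^ 12 + (-27377/316406250) * t ^ 11 + (-116521/474609375) * t ^ 10 + (29971/94921875) * t ^ 9 + (169249/1898437500) * t ^ 8 + (-27377/316406250) * t ^ 7 + (-8161/210937500) * t ^ 6 + (83/3796875) * t ^ 5 + (3497/379687500) * t ^ 4 + (-211/63281250) * t ^ 3 + (-2069/1265625000) * t ^ 2 + (11/105468750) * t + (17/105468750)"
    "?b 2 = (-2453/3796875000) * t ^ 18 + (-89/158203125) * t ^ 17 + (28639/3796875000) * t ^ 16 + (69377/3796875000) * t ^ 15 + (-3419/84375000) * t ^ 14 + (-460583/3796875000) * t ^ 13 + (224927/1265625000) * t ^ 12 + (1265849/3796875000) * t ^ 11 + (-1560697/3796875000) * t ^ 10 + (-161209/253125000) * t ^ 9 + (1896307/3796875000) * t ^ 8 + (712699/3796875000) * t ^ 7 + (-685421/3796875000) * t ^ 6 + (-54511/1265625000) * t ^ 5 + (251/9375000) * t ^ 4 + (26827/3796875000) * t ^ 3 + (-7427/1898437500) * t ^ 2 + (-287/1265625000) * t + (223/632812500)"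
    "?b 3 = (1819/11390625000) * t ^ 18 + (-223/316406250) * t ^ 17 + (-7109/3796875000) * t ^ 16 + (10759/474609375) * t ^ 15 + (664/31640625) * t ^ 14 + (-69436/474609375) * t ^ 13 + (-104297/474609375) * t ^ 12 + (64291/158203125) * t ^ 11 + (1245781/1898437500) * t ^ 10 + (-183917/284765625) * t ^ 9 + (-1245781/1898437500) * t ^ 8 + (64291/158203125) * t ^ 7 + (104297/474609375) * t ^ 6 + (-69436/474609375) * t ^ 5 + (-664/31640625) * t ^ 4 + (10759/474609375) * t ^ 3 + (7109/3796875000) * t ^ 2 + (-223/316406250) * t + (-1819/11390625000)"
    "?b 4 = (223/632812500) * t ^ 18 + (287/1265625000) * t ^ 17 + (-7427/1898437500) * t ^ 16 + (-26827/3796875000) * t ^ 15 + (251/9375000) * t ^ 14 + (54511/1265625000) * t ^ 13 + (-685421/3796875000) * t ^ 12 + (-712699/3796875000) * t ^ 11 + (1896307/3796875000) * t ^ 10 + (161209/253125000) * t ^ 9 + (-1560697/3796875000) * t ^ 8 + (-1265849/3796875000) * t ^ 7 + (224927/1265625000) * t ^ 6 + (460583/3796875000) * t ^ 5 + (-3419/84375000) * t ^ 4 + (-69377/3796875000) * t ^ 3 + (28639/3796875000) * t ^ 2 + (89/158203125) * t + (-2453/3796875000)"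
    "?b 5 = (-17/105468750) * t ^ 18 + (11/105468750) * t ^ 17 + (2069/1265625000) * t ^ 16 + (-211/63281250) * t ^ 15 + (-3497/379687500) * t ^ 14 + (83/3796875) * t ^ 13 + (8161/210937500) * t ^ 12 + (-27377/316406250) * t ^ 11 + (-169249/1898437500) * t ^ 10 + (29971/94921875) * t ^ 9 + (116521/474609375) * t ^ 8 + (-27377/316406250) * t ^ 7 + (-220319/1898437500) * t ^ 6 + (83/3796875) * t ^ 5 + (12163/379687500) * t ^ 4 + (-211/63281250) * t ^ 3 + (-12161/1898437500) * t ^ 2 + (11/105468750) * t + (2057/3796875000)"
    "?b 6 = (1/52734375) * t ^ 18 + (-1/35156250) * t ^ 17 + (-7/42187500) * t ^ 16 + (371/421875000) * t ^ 15 + (61/253125000) * t ^ 14 + (-703/140625000) * t ^ 13 + (17449/2278125000) * t ^ 12 + (55427/3796875000) * t ^ 11 + (-96677/3796875000) * t ^ 10 + (-4091/2278125000) * t ^ 9 + (208547/3796875000) * t ^ 8 + (166057/3796875000) * t ^ 7 + (-19577/2278125000) * t ^ 6 + (-78391/3796875000) * t ^ 5 + (-407/84375000) * t ^ 4 + (11849/3796875000) * t ^ 3 + (209/151875000) * t ^ 2 + (-121/1265625000) * t + (-1331/11390625000)"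
    unfolding cube_coeff_def nth_literal l by algebra+
  have J2: "J2 (\<lambda>c. c) (($) v) = (-11/60) * t ^ 4 + (-11/30) * t ^ 2 + (-11/60)"
    unfolding J2_def v vec7_nth by algebra
  have J4: "J4 (\<lambda>c. c) (($) v) = (67/11250) * t ^ 8 + (94/5625) * t ^ 6 + (281/5625) * t ^ 4 + (94/5625) * t ^ 2 + (67/11250)"
    unfolding J4_def Let_def i by algebra
  have J6: "J6 (\<lambda>c. c) (($) v) = (-553/10125000) * t ^ 12 + (1981/5062500) * t ^ 10 + (-553/675000) * t ^ 8 + (-427/168750) * t ^ 6 + (-553/675000) * t ^ 4 + (1981/5062500) * t ^ 2 + (-553/10125000)"
    unfolding J6_def Let_def l by algebra
  have J10: "J10 (\<lambda>c. c) (($) v) = (-37553/227812500000) * t ^ 20 + (13789/7593750000) * t ^ 18 + (-79699/15187500000) * t ^ 16 + (33127/1898437500) * t ^ 14 + (-31039/843750000) * t ^ 12 + (-7001239/56953125000) * t ^ 10 + (-31039/843750000) * t ^ 8 + (33127/1898437500) * t ^ 6 + (-79699/15187500000) * t ^ 4 + (13789/7593750000) * t ^ 2 + (-37553/227812500000)"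
    unfolding J10_def Let_def b unfolding v vec7_nth by algebra
  show "eval v U6 = 0" "eval v U10 = 0"
    unfolding W_eq_eval[symmetric] W6_def W10_def J2 J4 J6 J10 by algebra+
qed

text \<open>A linear change of coordinates is brought to a diagonal or antidiagonal one by shifts and reversal.\<close>

lemma eval_U_ricochet:
  assumes v: "\<And>x y. form_at v x y = \<gamma> * ricochet_form t (a * x + b * y) (c * x + d * y)"
    and det: "a * d - b * c \<noteq> 0"
  shows "eval v U6 = 0" "eval v U10 = 0"
proof -
  \<comment> \<open>Without mixed terms the factor p can be pulled out: the form is \<gamma> p^6
    times the normal form acted on by the torus element q/p, and the invariants only gain powers of
    these scalars.\<close>
  have diag: "eval w U6 = 0 \<and> eval w U10 = 0"
    if w: "\<And>x y. form_at w x y = \<gamma> * ricochet_form t (p * x) (q * y)" and "p \<noteq> 0" for w p q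
  proof -
    define u where "u = vec7 0 (t + 1) (1 - 2 * t - t ^ 2) (t ^ 2 - 2 * t - 1) (t ^ 2 + 2 * t - 1) (t - t ^ 2) 0"
    have u: "form_at u x y = ricochet_form t x y" for x y
      unfolding u_def form_at_def vec7_nth ricochet_form_def by algebra
    define u' where "u' = (\<chi> k. (q / p) ^ index k * u $ k)"
    have u': "form_at u' x y = form_at u x (q / p * y)" for x y
      by (simp add: u'_def form_at_def power_mult_distrib power_divide mult_ac)
    have "w = (\<chi> k. (\<gamma> * p ^ 6) * u' $ k)"
    proof (rule form_at_inject)
      fix x y
      have "form_at (\<chi> k. (\<gamma> * p ^ 6) * u' $ k) x y = \<gamma> * p ^ 6 * form_at u' x y"
        by (simp add: form_at_def algebra_simps)
      also have "\<dots> = \<gamma> * p ^ 6 * ricochet_form t x (q / p * y)"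
        by (simp add: u' u)
      also have "\<dots> = \<gamma> * ricochet_form t (p * x) (p * (q / p * y))"
        unfolding ricochet_form_def by algebra
      finally show "form_at w x y = form_at (\<chi> k. (\<gamma> * p ^ 6) * u' $ k) x y"
        using \<open>p \<noteq> 0\<close> by (simp add: w)
    qed
    moreover have "eval u' U6 = 0" "eval u' U10 = 0"
      unfolding u'_def eval_U_weight eval_U_ricochet_normal_form[OF u] by simp_all
    ultimately show ?thesis
      by (simp only: eval_U_degree mult_zero_right simp_thms)
  qed
  have swap: "eval w U6 = 0 \<and> eval w U10 = 0"
    if "\<And>x y. form_at w x y = \<gamma> * ricochet_form t (p * y) (q * x)" "p \<noteq> 0" for w p q
    using diag[of "reverse w" p q] that by (simp add: form_at_reverse eval_U_reverse)
  have "eval v U6 = 0 \<and> eval v U10 = 0"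
  proof (cases "a = 0")
    case True
    then have "b \<noteq> 0" "c \<noteq> 0" using det by auto
    have "form_at (shift (- d / c) v) x y = \<gamma> * ricochet_form t (b * y) (c * x)" for x y
      using True \<open>c \<noteq> 0\<close> by (simp add: form_at_shift v algebra_simps)
    then show ?thesis using swap[of "shift (- d / c) v" b c] \<open>b \<noteq> 0\<close> by (simp add: eval_U_shift)
  next
    case False
    define e where "e = d - b * c / a"
    have "e \<noteq> 0" using det False by (simp add: e_def field_simps)
    define w where "w = reverse (shift (- b / a) v)"
    have "form_at w x y = \<gamma> * ricochet_form t (a * y) (c * y + e * x)" for x y
      using False by (simp add: w_def form_at_reverse form_at_shift v e_def algebra_simps)
    then have "form_at (shift (- c / e) w) x y = \<gamma> * ricochet_form t (a * y) (e * x)" for x y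
      using \<open>e \<noteq> 0\<close> by (simp add: form_at_shift algebra_simps)
    then show ?thesis
      using swap[of "shift (- c / e) w" a e] False by (simp add: w_def eval_U_shift eval_U_reverse)
  qed
  then show "eval v U6 = 0" "eval v U10 = 0" by auto
qed

text \<open>The constant polynomials \<open>[:y:]\<close> already give the outer polynomial
  infinitely many zeros.\<close>

lemma poly_poly_eqI:
  fixes P Q :: "complex poly poly"
  assumes "\<And>x y. poly (poly P [:y:]) x = poly (poly Q [:y:]) x"
  shows "P = Q"
proof (rule ccontr)
  assume "P \<noteq> Q"
  then have "finite {z. poly (P - Q) z = 0}" by (intro poly_roots_finite) simp
  moreover have "poly (P - Q) [:y:] = 0" for y
  proof -
    have "poly (poly P [:y:]) = poly (poly Q [:y:])" using assms by auto
    then show ?thesis by (simp add: poly_eq_poly_eq_iff)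
  qed
  then have "range (\<lambda>y :: complex. [:y:]) \<subseteq> {z. poly (P - Q) z = 0}" by auto
  moreover have "infinite (range (\<lambda>y :: complex. [:y:]))"
  proof
    assume "finite (range (\<lambda>y :: complex. [:y:]))"
    then have "finite (UNIV :: complex set)" by (rule finite_imageD) (simp add: inj_on_def)
    then show False using infinite_UNIV_char_0 by blast
  qed
  ultimately show False using finite_subset by blast
qed

lemma poly_linear_factor: "poly (poly (scalar \<alpha> * x1 - scalar \<beta> * x2) [:y:]) x = \<alpha> * x - \<beta> * (y :: complex)"
  by (simp add: scalar_def x1_def x2_def algebra_simps)

lemma form_at_product:
  fixes \<alpha> \<beta> :: "nat \<Rightarrow> complex"
  assumes "sextic (\<lambda>k. v $ k) = (\<Prod>i<n. scalar (\<alpha> i) * x1 - scalar (\<beta> i) * x2)"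
  shows "form_at v x y = (\<Prod>i<n. \<alpha> i * x - \<beta> i * y)"
  unfolding form_at_eq_iff[OF assms] poly_prod poly_linear_factor ..

lemma ratio_eq_imp:
  assumes "ratio b a = ratio n m" "(a, b) \<noteq> (0, 0) \<or> m \<noteq> 0 \<or> n \<noteq> 0"
  shows "a * n = b * m"
  using assms by (auto simp: ratio_def field_simps split: if_splits)

text \<open>Up to the determinant, the linear form with root \<beta>/\<alpha> is the pullback of the
  form whose root is the image vector (\<beta>', \<alpha>'). The image point n/m determines this
  vector up to a factor, also when one of the points is infinite.\<close>

lemma linear_factor_of_image:
  assumes det: "a * d - b * c \<noteq> 0"
    and img: "frac_linear a b c d (ratio \<beta> \<alpha>) = ratio n m" and mn: "(m, n) \<noteq> (0, 0)"
  shows "\<exists>k. \<forall>x y. \<alpha> * x - \<beta> * y = k * (m * (a * x + b * y) - n * (c * x + d * y))"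
proof -
  define \<alpha>' \<beta>' where "\<alpha>' = c * \<beta> + d * \<alpha>" and "\<beta>' = a * \<beta> + b * \<alpha>"
  have "\<alpha>' * n = \<beta>' * m"
  proof (cases "\<alpha> = 0")
    case True
    then have "ratio a c = ratio n m" using img by (simp add: ratio_def frac_linear_def)
    then have "c * n = a * m" using mn by (intro ratio_eq_imp) auto
    then show ?thesis by (simp add: \<alpha>'_def \<beta>'_def True)
  next
    case False
    then have "ratio (a * (\<beta> / \<alpha>) + b) (c * (\<beta> / \<alpha>) + d) = ratio n m"
      using img by (simp add: ratio_def frac_linear_def)
    then have "(c * (\<beta> / \<alpha>) + d) * n = (a * (\<beta> / \<alpha>) + b) * m"
      using mn by (intro ratio_eq_imp) auto
    then show ?thesis using False by (simp add: \<alpha>'_def \<beta>'_def field_simps)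
  qed
  then obtain k where k: "\<alpha>' = k * m" "\<beta>' = k * n"
  proof (cases "m = 0")
    case True
    then show ?thesis using that[of "\<beta>' / n"] \<open>\<alpha>' * n = \<beta>' * m\<close> mn by auto
  next
    case False
    then show ?thesis using that[of "\<alpha>' / m"] \<open>\<alpha>' * n = \<beta>' * m\<close> by (auto simp: field_simps)
  qed
  have "\<alpha> * x - \<beta> * y = k / (a * d - b * c) * (m * (a * x + b * y) - n * (c * x + d * y))" for x y
  proof -
    have "(a * d - b * c) * (\<alpha> * x - \<beta> * y) = \<alpha>' * (a * x + b * y) - \<beta>' * (c * x + d * y)"
      unfolding \<alpha>'_def \<beta>'_def by algebra
    then show ?thesis using det unfolding k by (simp add: field_simps)
  qed
  then show ?thesis by blast
qed

lemma prod_lessThan_six: "(\<Prod>i<6. g i) = g 0 * g 1 * g 2 * g 3 * g 4 * (g (5::nat) :: 'a::comm_monoid_mult)"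
  by (simp add: lessThan_nat_numeral mult_ac)

lemma R_configuration_form:
  fixes \<alpha> \<beta> :: "nat \<Rightarrow> complex"
  assumes v: "sextic (\<lambda>k. v $ k) = (\<Prod>i<6. scalar (\<alpha> i) * x1 - scalar (\<beta> i) * x2)"
    and R: "R_configuration ((\<lambda>i. ratio (\<beta> i) (\<alpha> i)) ` {..<6})"
  shows "\<exists>\<gamma> t a b c d. a * d - b * c \<noteq> 0 \<and>
    (\<forall>x y. form_at v x y = \<gamma> * ricochet_form t (a * x + b * y) (c * x + d * y))"
proof -
  let ?r = "\<lambda>i. ratio (\<beta> i) (\<alpha> i)"
  obtain A B C D E F t a b c d where S: "?r ` {..<6} = {A, B, C, D, E, F}"
    and dist: "distinct [A, B, C, D, E, F]" and det: "a * d - b * c \<noteq> 0"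
    and img: "frac_linear a b c d A = ratio 0 1" "frac_linear a b c d B = ratio t 1"
      "frac_linear a b c d C = ratio 1 0" "frac_linear a b c d D = ratio 1 1"
      "frac_linear a b c d E = ratio (t - 1) (t + 1)" "frac_linear a b c d F = ratio (- 1) 1"
    using R unfolding R_configuration_def by (auto simp: ratio_def)
  have card: "card (?r ` {..<6}) = card {..<6::nat}" unfolding S using dist by simp
  then have inj: "inj_on ?r {..<6}" by (simp add: eq_card_imp_inj_on)
  \<comment> \<open>The labels A to F come in arbitrary order; as the six ratios are distinct, each
    label belongs to exactly one index.\<close>
  define idx where "idx = the_inv_into {..<6} ?r"
  have r_idx: "?r (idx P) = P" if "P \<in> {A, B, C, D, E, F}" for P
    using that f_the_inv_into_f[OF inj] unfolding idx_def S[symmetric] by blast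
  have "form_at v x y = (\<Prod>P\<in>?r ` {..<6}. \<alpha> (idx P) * x - \<beta> (idx P) * y)" for x y
    unfolding form_at_product[OF v] idx_def
    by (subst prod.reindex[OF inj]) (auto simp: the_inv_into_f_f[OF inj] intro!: prod.cong)
  then have form: "form_at v x y = (\<alpha> (idx A) * x - \<beta> (idx A) * y) * (\<alpha> (idx B) * x - \<beta> (idx B) * y)
      * (\<alpha> (idx C) * x - \<beta> (idx C) * y) * (\<alpha> (idx D) * x - \<beta> (idx D) * y)
      * (\<alpha> (idx E) * x - \<beta> (idx E) * y) * (\<alpha> (idx F) * x - \<beta> (idx F) * y)" for x y
    unfolding S using dist by (simp add: mult_ac)
  have factor: "\<exists>k. \<forall>x y. \<alpha> (idx P) * x - \<beta> (idx P) * y = k * (m * (a * x + b * y) - n * (c * x + d * y))"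
    if "P \<in> {A, B, C, D, E, F}" "frac_linear a b c d P = ratio n m" "(m, n) \<noteq> (0, 0)" for P m n
    using linear_factor_of_image[OF det _ that(3), of "\<beta> (idx P)" "\<alpha> (idx P)"] that(2) r_idx[OF that(1)] by simp
  have "(t + 1, t - 1) \<noteq> (0, 0)"
    by (metis Pair_inject add.inverse_unique add_eq_0_iff2 diff_eq_diff_eq eq_iff_diff_eq_0 one_neq_neg_one)
  then obtain kA kB kC kD kE kF where k:
    "\<And>x y. \<alpha> (idx A) * x - \<beta> (idx A) * y = kA * (1 * (a * x + b * y) - 0 * (c * x + d * y))"
    "\<And>x y. \<alpha> (idx B) * x - \<beta> (idx B) * y = kB * (1 * (a * x + b * y) - t * (c * x + d * y))"
    "\<And>x y. \<alpha> (idx C) * x - \<beta> (idx C) * y = kC * (0 * (a * x + b * y) - 1 * (c * x + d * y))"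
    "\<And>x y. \<alpha> (idx D) * x - \<beta> (idx D) * y = kD * (1 * (a * x + b * y) - 1 * (c * x + d * y))"
    "\<And>x y. \<alpha> (idx E) * x - \<beta> (idx E) * y = kE * ((t + 1) * (a * x + b * y) - (t - 1) * (c * x + d * y))"
    "\<And>x y. \<alpha> (idx F) * x - \<beta> (idx F) * y = kF * (1 * (a * x + b * y) - (- 1) * (c * x + d * y))"
    using factor[OF _ img(1)] factor[OF _ img(2)] factor[OF _ img(3)] factor[OF _ img(4)] factor[OF _ img(5)]
      factor[OF _ img(6)] by (metis insert_iff one_neq_zero Pair_inject)
  \<comment> \<open>The sign stems from the point at infinity, whose linear form is -Y.\<close>
  have "form_at v x y = - (kA * kB * kC * kD * kE * kF) * ricochet_form t (a * x + b * y) (c * x + d * y)" for x y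
    unfolding form k ricochet_form_def by algebra
  then show ?thesis using det by blast
qed

text \<open>The excluded t are those for which points of the normal form collide: t meets 0, 1 or
  -1, or (t-1)/(t+1) meets t, which happens for t^2 = -1.\<close>

definition ricochet_vector :: "complex ^ 7 \<Rightarrow> bool" where
  "ricochet_vector v \<longleftrightarrow> (\<exists>\<gamma> t a b c d. \<gamma> \<noteq> 0 \<and> a * d - b * c \<noteq> 0 \<and> t \<noteq> 0 \<and> t \<noteq> 1 \<and> t \<noteq> - 1 \<and> t ^ 2 \<noteq> - 1 \<and>
     (\<forall>x y. form_at v x y = \<gamma> * ricochet_form t (a * x + b * y) (c * x + d * y)))"

lemma frac_linear_linear_factor:
  assumes det: "a * d - b * c \<noteq> 0" and k: "k \<noteq> 0" and mn: "(m, n) \<noteq> (0, 0)"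
  shows "frac_linear a b c d (ratio (- (k * (m * b - n * d))) (k * (m * a - n * c))) = ratio n m"
proof (cases "m * a - n * c = 0")
  case True
  have "m \<noteq> 0 \<longleftrightarrow> c \<noteq> 0"
    using True det mn by auto
  moreover have "c \<noteq> 0 \<Longrightarrow> a / c = n / m"
    using True calculation by (simp add: field_simps)
  ultimately show ?thesis using True k by (auto simp: ratio_def frac_linear_def)
next
  case False
  define w where "w = - (k * (m * b - n * d)) / (k * (m * a - n * c))"
  have w: "a * w + b = n * (a * d - b * c) / (m * a - n * c)" "c * w + d = m * (a * d - b * c) / (m * a - n * c)"
    using False k by (simp_all add: w_def divide_simps) (simp_all add: algebra_simps)
  have "frac_linear a b c d (ratio (- (k * (m * b - n * d))) (k * (m * a - n * c))) = ratio (a * w + b) (c * w + d)"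
    using False k by (simp add: ratio_def[of _ "k * _"] frac_linear_def w_def)
  also have "\<dots> = ratio n m"
    unfolding w using False det by (simp add: ratio_def)
  finally show ?thesis .
qed

lemma ricochet_vector_in_locus:
  assumes "ricochet_vector v"
  shows "proj_point v \<in> ricochet_locus"
proof -
  obtain \<gamma> t a b c d where "\<gamma> \<noteq> 0" and det: "a * d - b * c \<noteq> 0"
    and t: "t \<noteq> 0" "t \<noteq> 1" "t \<noteq> - 1" "t ^ 2 \<noteq> - 1"
    and v: "\<And>x y. form_at v x y = \<gamma> * ricochet_form t (a * x + b * y) (c * x + d * y)"
    using assms unfolding ricochet_vector_def by blast
  \<comment> \<open>The target points are \<open>n i\<close> / \<open>m i\<close>. Factor 0 absorbs
    both the scalar \<gamma> and the sign of the factor -Y at index 2.\<close>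
  define m n k where "m i = [1, 1, 0, 1, t + 1, 1] ! i" and "n i = [0, t, 1, 1, t - 1, - 1] ! i"
    and "k i = [- \<gamma>, 1, 1, 1, 1, 1] ! i" for i :: nat
  define \<alpha> \<beta> where "\<alpha> i = k i * (m i * a - n i * c)" and "\<beta> i = - (k i * (m i * b - n i * d))" for i :: nat
  have six: "i < 6 \<longleftrightarrow> i = 0 \<or> i = 1 \<or> i = 2 \<or> i = 3 \<or> i = 4 \<or> i = (5::nat)" for i by auto
  have t2: "t + 1 \<noteq> 0" "t - 1 \<noteq> 0" using t by (auto simp: add_eq_0_iff2)
  have mn: "(m i, n i) \<noteq> (0, 0)" "k i \<noteq> 0" if "i < 6" for i
    using that t2 \<open>\<gamma> \<noteq> 0\<close> unfolding six by (auto simp: m_def n_def k_def)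
  have img: "frac_linear a b c d (ratio (\<beta> i) (\<alpha> i)) = ratio (n i) (m i)" if "i < 6" for i
    unfolding \<alpha>_def \<beta>_def by (rule frac_linear_linear_factor[OF det mn(2)[OF that] mn(1)[OF that]])
  have "form_at v x y = (\<Prod>i<6. \<alpha> i * x - \<beta> i * y)" for x y
    unfolding v prod_lessThan_six \<alpha>_def \<beta>_def m_def n_def k_def nth_literal ricochet_form_def by algebra
  then have prod: "sextic (\<lambda>k. v $ k) = (\<Prod>i<6. scalar (\<alpha> i) * x1 - scalar (\<beta> i) * x2)"
    by (intro poly_poly_eqI) (simp only: poly_sextic poly_prod poly_linear_factor)
  define e where "e = (t - 1) / (t + 1)"
  have e: "t - 1 = e * (t + 1)" using t2(1) by (simp add: e_def)
  have "e \<noteq> 0" using e t2 by auto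
  moreover have "e \<noteq> 1"
  proof
    assume "e = 1"
    then have "(2 :: complex) = 0" using e by algebra
    then show False by simp
  qed
  moreover have "e \<noteq> - 1"
  proof
    assume "e = - 1"
    then have "2 * t = 0" using e by algebra
    then show False using t(1) by simp
  qed
  moreover have "e \<noteq> t"
  proof
    assume "e = t"
    have "t - 1 = t * (t + 1)" using e unfolding \<open>e = t\<close> .
    moreover have "t ^ 2 + 1 = t * (t + 1) - (t - 1)" by algebra
    ultimately have "t ^ 2 + 1 = 0" by (simp only: diff_self)
    then show False using t(4) eq_neg_iff_add_eq_0[of "t ^ 2" 1] by blast
  qed
  moreover have "map (\<lambda>i. ratio (n i) (m i)) [0, 1, 2, 3, 4, 5] = [Some 0, Some t, None, Some 1, Some e, Some (- 1)]"
    using t2 by (simp add: ratio_def m_def n_def e_def)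
  ultimately have distinct_img: "distinct (map (\<lambda>i. ratio (n i) (m i)) [0, 1, 2, 3, 4, 5])"
    using t(1-3) by (auto simp del: list.map)
  \<comment> \<open>Distinctness is pulled back: points with distinct images are distinct.\<close>
  have eq: "map (\<lambda>i. ratio (n i) (m i)) [0, 1, 2, 3, 4, 5]
      = map (frac_linear a b c d) (map (\<lambda>i. ratio (\<beta> i) (\<alpha> i)) [0, 1, 2, 3, 4, 5])"
    by (simp add: img)
  have "distinct (map (\<lambda>i. ratio (\<beta> i) (\<alpha> i)) [0, 1, 2, 3, 4, 5])"
    using distinct_img unfolding eq distinct_map[of "frac_linear a b c d"] by (rule conjunct1)
  then have dist: "distinct [ratio (\<beta> 0) (\<alpha> 0), ratio (\<beta> 1) (\<alpha> 1), ratio (\<beta> 2) (\<alpha> 2),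
      ratio (\<beta> 3) (\<alpha> 3), ratio (\<beta> 4) (\<alpha> 4), ratio (\<beta> 5) (\<alpha> 5)]"
    by (simp only: list.map)
  have "{..<6::nat} = {0, 1, 2, 3, 4, 5}" by auto
  then have S: "(\<lambda>i. ratio (\<beta> i) (\<alpha> i)) ` {..<6} = {ratio (\<beta> 0) (\<alpha> 0), ratio (\<beta> 1) (\<alpha> 1), ratio (\<beta> 2) (\<alpha> 2),
      ratio (\<beta> 3) (\<alpha> 3), ratio (\<beta> 4) (\<alpha> 4), ratio (\<beta> 5) (\<alpha> 5)}"
    by (simp only: image_insert image_empty)
  have fr: "frac_linear a b c d (ratio (\<beta> 0) (\<alpha> 0)) = Some 0"
    "frac_linear a b c d (ratio (\<beta> 1) (\<alpha> 1)) = Some t"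
    "frac_linear a b c d (ratio (\<beta> 2) (\<alpha> 2)) = None"
    "frac_linear a b c d (ratio (\<beta> 3) (\<alpha> 3)) = Some 1"
    "frac_linear a b c d (ratio (\<beta> 4) (\<alpha> 4)) = ratio (t - 1) (t + 1)"
    "frac_linear a b c d (ratio (\<beta> 5) (\<alpha> 5)) = Some (- 1)"
    using img[of 0] img[of 1] img[of 2] img[of 3] img[of 4] img[of 5] by (simp_all add: m_def n_def ratio_def[of _ 1] ratio_def[of _ 0])
  have "R_configuration ((\<lambda>i. ratio (\<beta> i) (\<alpha> i)) ` {..<6})"
    unfolding R_configuration_def by (intro exI conjI, rule S, rule dist, rule det) (rule fr)+
  moreover have "v \<noteq> 0"
  proof
    assume "v = 0"
    then have "sextic (\<lambda>k. v $ k) = 0"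
      by (intro poly_poly_eqI) (simp only: poly_sextic, simp add: form_at_def)
    then obtain i where i: "i < 6" "scalar (\<alpha> i) * x1 - scalar (\<beta> i) * x2 = (0 :: complex poly poly)"
      unfolding prod by auto
    then have "\<alpha> i * x - \<beta> i * y = 0" for x y
      using poly_linear_factor[of "\<alpha> i" "\<beta> i" y x] by simp
    from this[of 1 0] this[of 0 1] have "m i * a - n i * c = 0" "m i * b - n i * d = 0"
      using mn(2)[OF i(1)] by (auto simp: \<alpha>_def \<beta>_def)
    then have "m i * (a * d - b * c) = 0" "n i * (a * d - b * c) = 0" by algebra+
    then show False using det mn(1)[OF i(1)] by simp
  qed
  ultimately have "proj_point v \<in> R_configuration_points"
    unfolding R_configuration_points_def using prod by blast
  then show ?thesis unfolding ricochet_locus_def by (rule hull_inc)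
qed

lemma eval_zero_on_ricochet_vectors:
  assumes "\<And>p. p \<in> ricochet_locus \<Longrightarrow> vanishes_at f p" "ricochet_vector v"
  shows "eval v f = 0"
  using assms(1)[OF ricochet_vector_in_locus[OF assms(2)]] vec.span_base[of v "{v}"]
  by (simp add: vanishes_at_def proj_point_def)

lemma homogeneous_U: "homogeneous U6" "homogeneous U10"
  using isobaric_U_degree unfolding homogeneous_def isobaric_def by auto

text \<open>The zero set of U is Zariski closed and contains all R-configurations, hence it contains
  their hull.\<close>

lemma U_vanishes_on_locus:
  assumes "U = U6 \<or> U = U10" "p \<in> ricochet_locus"
  shows "vanishes_at U p"
proof -
  have hom: "homogeneous U" using assms(1) homogeneous_U by auto
  let ?Z = "{p \<in> P6. \<forall>f\<in>{U}. vanishes_at f p}"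
  have "zariski_closed ?Z"
    unfolding zariski_closed_def using hom by blast
  moreover have "R_configuration_points \<subseteq> ?Z"
  proof
    fix p assume "p \<in> R_configuration_points"
    then obtain v and \<alpha> \<beta> :: "nat \<Rightarrow> complex" where p: "p = proj_point v" "v \<noteq> 0"
      and v: "sextic (\<lambda>k. v $ k) = (\<Prod>i<6. scalar (\<alpha> i) * x1 - scalar (\<beta> i) * x2)"
      and R: "R_configuration ((\<lambda>i. ratio (\<beta> i) (\<alpha> i)) ` {..<6})"
      unfolding R_configuration_points_def by blast
    have "eval v U6 = 0" "eval v U10 = 0"
      using R_configuration_form[OF v R] eval_U_ricochet by blast+
    then have "eval (c *s v) U = 0" for c
      using assms(1) eval_U_degree[of c v] by (auto simp: vector_scalar_mult_def)
    then have "vanishes_at U p"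
      unfolding vanishes_at_def p proj_point_def vec.span_singleton by auto
    then show "p \<in> ?Z" using p by (auto simp: P6_def)
  qed
  ultimately have "ricochet_locus \<subseteq> ?Z"
    unfolding ricochet_locus_def by (intro hull_minimal)
  then show ?thesis using assms(2) by auto
qed

section \<open>Division by forms with pure leading powers\<close>

abbreviation (input) weight :: "(7 \<Rightarrow> nat) \<Rightarrow> (7 \<Rightarrow>\<^sub>0 nat) \<Rightarrow> nat" where
  "weight w m \<equiv> (\<Sum>k\<in>UNIV. w k * Poly_Mapping.lookup m k)"

lemma weight_add: "weight w (m + n) = weight w m + weight w n"
  by (simp add: lookup_add distrib_left sum.distrib)

lemma weight_single: "weight w (Poly_Mapping.single k e) = w k * e"
  by (simp add: lookup_single when_def if_distrib[of "(*) _"] cong: if_cong)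

lemma single_dvd_monomial:
  assumes "e \<le> Poly_Mapping.lookup m k"
  shows "\<exists>n. m = n + Poly_Mapping.single k (e :: nat)"
proof (intro exI poly_mapping_eqI)
  fix j
  show "Poly_Mapping.lookup m j = Poly_Mapping.lookup (m - Poly_Mapping.single k e + Poly_Mapping.single k e) j"
    using assms by (cases "j = k") (simp_all add: lookup_add lookup_minus lookup_single)
qed

text \<open>A monomial divisible by some x_k^e is rewritten, through the element of \<open>I\<close>
  led by x_k^e, into monomials of smaller weight, so induction on a bound for the weight terminates.
  \<open>w\<close> is a mere weight, not a monomial order: strict domination by the pure powers is
  what counts.\<close>

lemma multivariate_division:
  fixes I :: "coord_ring set" and D :: "(7 \<times> nat) set"
  assumes I0: "0 \<in> I" and Iadd: "\<And>f g. f \<in> I \<Longrightarrow> g \<in> I \<Longrightarrow> f + g \<in> I"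
    and Imult: "\<And>f g. g \<in> I \<Longrightarrow> f * g \<in> I"
    and lead: "\<And>k e. (k, e) \<in> D \<Longrightarrow> \<exists>L. Poly_Mapping.single (Poly_Mapping.single k e) 1 + L \<in> I
      \<and> (\<forall>m\<in>Poly_Mapping.keys L. weight w m < w k * e)"
  shows "\<exists>r. f - r \<in> I \<and> (\<forall>m\<in>Poly_Mapping.keys r. \<forall>(k, e)\<in>D. Poly_Mapping.lookup m k < e)"
proof -
  let ?nf = "\<lambda>f. \<exists>r. f - r \<in> I \<and> (\<forall>m\<in>Poly_Mapping.keys r. \<forall>(k, e)\<in>D. Poly_Mapping.lookup m k < e)"
  have nf_add: "?nf (f + g)" if nf: "?nf f" "?nf g" for f g
  proof -
    obtain r s where "f - r \<in> I" "g - s \<in> I"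
      and rs: "\<forall>m\<in>Poly_Mapping.keys r. \<forall>(k, e)\<in>D. Poly_Mapping.lookup m k < e"
      "\<forall>m\<in>Poly_Mapping.keys s. \<forall>(k, e)\<in>D. Poly_Mapping.lookup m k < e"
      using nf by blast
    then have "f + g - (r + s) \<in> I"
      using Iadd[of "f - r" "g - s"] by (simp only: add_diff_add)
    moreover have "\<forall>m\<in>Poly_Mapping.keys (r + s). \<forall>(k, e)\<in>D. Poly_Mapping.lookup m k < e"
      using rs keys_add[of r s] by blast
    ultimately show ?thesis by blast
  qed
  have nf_sum: "?nf (sum F X)" if "finite X" "\<And>x. x \<in> X \<Longrightarrow> ?nf (F x)" for F and X :: "(7 \<Rightarrow>\<^sub>0 nat) set"
    using that
  proof (induction X)
    case empty
    then show ?case using I0 by (intro exI[of _ 0]) simp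
  next
    case (insert x X)
    then show ?case using nf_add[of "F x" "sum F X"] by simp
  qed
  have bounded: "?nf f" if "\<forall>m\<in>Poly_Mapping.keys f. weight w m < N" for N f
    using that
  proof (induction N arbitrary: f)
    case 0
    then have "f = 0" by auto
    then show ?case using I0 by (intro exI[of _ 0]) simp
  next
    case (Suc N)
    have mono: "?nf (Poly_Mapping.single m (Poly_Mapping.lookup f m))" if m: "m \<in> Poly_Mapping.keys f" for m
    proof (cases "\<forall>(k, e)\<in>D. Poly_Mapping.lookup m k < e")
      case True
      then show ?thesis
        using I0 by (intro exI[of _ "Poly_Mapping.single m (Poly_Mapping.lookup f m)"]) simp
    next
      case False
      then obtain k e where D: "(k, e) \<in> D" and "e \<le> Poly_Mapping.lookup m k" by (auto simp: not_less)
      then obtain n where n: "m = n + Poly_Mapping.single k e"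
        using single_dvd_monomial by metis
      obtain L where g: "Poly_Mapping.single (Poly_Mapping.single k e) 1 + L \<in> I"
        and L: "\<forall>m\<in>Poly_Mapping.keys L. weight w m < w k * e"
        using lead[OF D] by blast
      let ?s = "Poly_Mapping.single n (Poly_Mapping.lookup f m)"
      have "\<forall>m'\<in>Poly_Mapping.keys (- (?s * L)). weight w m' < N"
      proof
        fix m' assume "m' \<in> Poly_Mapping.keys (- (?s * L))"
        then have "m' \<in> Poly_Mapping.keys (?s * L)" by simp
        then obtain j l where "m' = j + l" "j \<in> Poly_Mapping.keys ?s" and l: "l \<in> Poly_Mapping.keys L"
          using keys_mult[of ?s L] by blast
        then have m': "m' = n + l" by (simp split: if_splits)
        have "weight w m < Suc N" using Suc.prems m by blast
        then have "weight w n + w k * e < Suc N" unfolding n weight_add weight_single .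
        moreover have "weight w l < w k * e" using L l by blast
        ultimately show "weight w m' < N" unfolding m' weight_add by linarith
      qed
      then obtain r where r: "- (?s * L) - r \<in> I"
        "\<forall>m\<in>Poly_Mapping.keys r. \<forall>(k, e)\<in>D. Poly_Mapping.lookup m k < e"
        using Suc.IH by blast
      have "Poly_Mapping.single m (Poly_Mapping.lookup f m)
          = ?s * (Poly_Mapping.single (Poly_Mapping.single k e) 1 + L) - ?s * L"
        by (subst n) (simp add: distrib_left mult_single)
      then have "Poly_Mapping.single m (Poly_Mapping.lookup f m) - r
          = ?s * (Poly_Mapping.single (Poly_Mapping.single k e) 1 + L) + (- (?s * L) - r)"
        by simp
      then have "Poly_Mapping.single m (Poly_Mapping.lookup f m) - r \<in> I"
        using Iadd[OF Imult[OF g, of ?s] r(1)] by (simp only:)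
      then show ?thesis using r(2) by blast
    qed
    have "?nf (\<Sum>m\<in>Poly_Mapping.keys f. Poly_Mapping.single m (Poly_Mapping.lookup f m))"
      by (rule nf_sum[OF finite_keys mono])
    then show ?case by (simp only: sum_of_monomials)
  qed
  have "weight w m < Suc (Max (weight w ` Poly_Mapping.keys f))" if "m \<in> Poly_Mapping.keys f" for m
    unfolding less_Suc_eq_le by (rule Max_ge) (use that in auto)
  then show ?thesis by (intro bounded) blast
qed

section \<open>Leading pure powers and divisibility by a coordinate\<close>

lemma eval_axis:
  "eval (\<chi> j. if j = k then 1 else 0) f = (\<Sum>m\<in>{m \<in> Poly_Mapping.keys f. \<forall>j. j \<noteq> k \<longrightarrow> Poly_Mapping.lookup m j = 0}.
     Poly_Mapping.lookup f m)"
proof -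
  have "monom_at (($) (\<chi> j. if j = k then 1 else 0)) m = (if \<forall>j. j \<noteq> k \<longrightarrow> Poly_Mapping.lookup m j = 0 then 1 else (0::complex))" for m
  proof (cases "\<forall>j. j \<noteq> k \<longrightarrow> Poly_Mapping.lookup m j = 0")
    case True
    then show ?thesis by (auto simp: monom_at_def intro!: prod.neutral)
  next
    case False
    then obtain j where "j \<noteq> k" "Poly_Mapping.lookup m j \<noteq> 0" by blast
    then show ?thesis using False unfolding monom_at_def
      by (auto intro!: prod_zero bexI[of _ j] simp: power_0_left)
  qed
  then show ?thesis
    by (simp add: eval_as_sum sum.inter_filter if_distrib[of "(*) _"] cong: if_cong)
qed

lemma monomial_eq_single:
  assumes "\<forall>j. j \<noteq> k \<longrightarrow> Poly_Mapping.lookup m j = 0" "Poly_Mapping.lookup m k = e"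
  shows "m = Poly_Mapping.single k (e :: nat)"
  by (rule poly_mapping_eqI) (use assms in \<open>auto simp: lookup_single when_def\<close>)

text \<open>Isobaricity for \<open>w\<close> leaves x_k^e as the only possible pure power of x_k in
  \<open>f\<close>, so its coefficient is the value of \<open>f\<close> at a unit vector and no
  expansion of \<open>f\<close> is required. The second weight \<open>w'\<close> is the one that
  governs division.\<close>

lemma pure_power_leads:
  assumes iso: "isobaric w d f" and d: "d = w k * e" "w k \<noteq> 0"
    and c: "eval (\<chi> j. if j = k then 1 else 0) f = c" "c \<noteq> 0"
    and less: "\<And>m. m \<in> Poly_Mapping.keys f \<Longrightarrow> m \<noteq> Poly_Mapping.single k e \<Longrightarrow> weight w' m < w' k * e"
  shows "\<exists>L. Poly_Mapping.single (Poly_Mapping.single k e) 1 + L = const (inverse c) * f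
    \<and> (\<forall>m\<in>Poly_Mapping.keys L. weight w' m < w' k * e)"
proof (intro exI conjI)
  let ?s = "Poly_Mapping.single k e"
  let ?L = "const (inverse c) * f - Poly_Mapping.single ?s 1"
  show "Poly_Mapping.single ?s 1 + ?L = const (inverse c) * f" by simp
  have look: "Poly_Mapping.lookup (const b * g) m = b * Poly_Mapping.lookup g m" for b and g :: coord_ring and m
    unfolding const_def mult_map_scale_conv_mult[symmetric] by (simp add: map.rep_eq when_def)
  have "m = ?s" if "m \<in> Poly_Mapping.keys f" "\<forall>j. j \<noteq> k \<longrightarrow> Poly_Mapping.lookup m j = 0" for m
  proof (rule monomial_eq_single[OF that(2)])
    obtain e' where e': "e' = Poly_Mapping.lookup m k" by blast
    then have "m = Poly_Mapping.single k e'" using monomial_eq_single[OF that(2)] by simp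
    then have "weight w m = w k * e'" by (simp only: weight_single)
    moreover have "weight w m = w k * e" using iso that(1) unfolding isobaric_def d(1) by blast
    ultimately show "Poly_Mapping.lookup m k = e" using d(2) e' by simp
  qed
  then have sub: "{m \<in> Poly_Mapping.keys f. \<forall>j. j \<noteq> k \<longrightarrow> Poly_Mapping.lookup m j = 0} \<subseteq> {?s}" (is "?A \<subseteq> _")
    by (intro subsetI) simp
  have "?A \<noteq> {}"
  proof
    assume A: "?A = {}"
    have "eval (\<chi> j. if j = k then 1 else 0) f = 0" unfolding eval_axis A by (rule sum.empty)
    then have "c = 0" unfolding c(1) .
    then show False using c(2) by contradiction
  qed
  then have A: "?A = {?s}" using subset_singletonD[OF sub] by meson
  have "eval (\<chi> j. if j = k then 1 else 0) f = Poly_Mapping.lookup f ?s"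
    unfolding eval_axis A by simp
  then have look_s: "Poly_Mapping.lookup f ?s = c" using c(1) by (simp only:)
  show "\<forall>m\<in>Poly_Mapping.keys ?L. weight w' m < w' k * e"
  proof
    fix m assume "m \<in> Poly_Mapping.keys ?L"
    then have nz: "inverse c * Poly_Mapping.lookup f m - Poly_Mapping.lookup (Poly_Mapping.single ?s 1) m \<noteq> 0"
      by (simp only: in_keys_iff lookup_minus look simp_thms)
    have ms: "m \<noteq> ?s"
    proof
      assume "m = ?s"
      then show False using nz c(2) by (simp add: look_s)
    qed
    then have "Poly_Mapping.lookup (Poly_Mapping.single ?s 1) m = (0 :: complex)"
      by (simp add: lookup_single when_def)
    then have "m \<in> Poly_Mapping.keys f"
      using nz unfolding in_keys_iff by auto
    then show "weight w' m < w' k * e" using ms by (rule less)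
  qed
qed

lemma split_coord:
  "\<exists>g r. f = coord k * g + r \<and> (\<forall>m\<in>Poly_Mapping.keys r. Poly_Mapping.lookup m k = 0)"
proof -
  have "\<exists>r. f - r \<in> range ((*) (coord k)) \<and> (\<forall>m\<in>Poly_Mapping.keys r. \<forall>(j, e)\<in>{(k, 1)}. Poly_Mapping.lookup m j < e)"
  proof (rule multivariate_division[where w = "\<lambda>_. 1"])
    show "\<exists>L. Poly_Mapping.single (Poly_Mapping.single j e) 1 + L \<in> range ((*) (coord k))
        \<and> (\<forall>m\<in>Poly_Mapping.keys L. weight (\<lambda>_. 1) m < 1 * e)" if "(j, e) \<in> {(k, 1)}" for j and e :: nat
      using that by (intro exI[of _ 0]) (auto simp: coord_def intro!: range_eqI[of _ _ 1])
  qed (auto intro: range_eqI[of _ _ 0] simp: distrib_left[symmetric] mult.left_commute)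
  then obtain r g where "f - r = coord k * g" "\<forall>m\<in>Poly_Mapping.keys r. Poly_Mapping.lookup m k = 0"
    by auto
  then show ?thesis by (intro exI[of _ g] exI[of _ r]) (auto simp: algebra_simps)
qed

lemma eval_independent:
  assumes "\<forall>m\<in>Poly_Mapping.keys r. Poly_Mapping.lookup m k = 0"
  shows "eval v r = eval (\<chi> j. if j = k then x else v $ j) r"
proof -
  have "monom_at (($) v) m = monom_at (($) (\<chi> j. if j = k then x else v $ j)) m" if "m \<in> Poly_Mapping.keys r" for m
    unfolding monom_at_def by (rule prod.cong) (use assms that in auto)
  then show ?thesis unfolding eval_as_sum by simp
qed

text \<open>Division by x_k leaves a remainder free of x_k, all of whose values are already taken on
  x_k = 0.\<close>

lemma coord_dvd_iff: "coord k dvd f \<longleftrightarrow> (\<forall>v. v $ k = 0 \<longrightarrow> eval v f = 0)"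
proof
  assume "coord k dvd f"
  then show "\<forall>v. v $ k = 0 \<longrightarrow> eval v f = 0" by (auto simp: eval_mult)
next
  assume van: "\<forall>v. v $ k = 0 \<longrightarrow> eval v f = 0"
  obtain g r where f: "f = coord k * g + r" and r: "\<forall>m\<in>Poly_Mapping.keys r. Poly_Mapping.lookup m k = 0"
    using split_coord by blast
  have "eval v r = 0" for v
  proof -
    let ?v = "\<chi> j. if j = k then 0 else v $ j"
    have "eval ?v f = 0" using van by simp
    then show ?thesis using eval_independent[OF r, of v 0] by (simp add: f eval_simps)
  qed
  then show "coord k dvd f" using eval_zero_imp_zero[of r] by (simp add: f)
qed

lemma coord_prime:
  assumes "coord k dvd f * g"
  shows "coord k dvd f \<or> coord k dvd g"
proof -
  obtain f' r where f: "f = coord k * f' + r" and r: "\<forall>m\<in>Poly_Mapping.keys r. Poly_Mapping.lookup m k = 0"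
    using split_coord by blast
  obtain g' s where g: "g = coord k * g' + s" and s: "\<forall>m\<in>Poly_Mapping.keys s. Poly_Mapping.lookup m k = 0"
    using split_coord by blast
  have "eval v (r * s) = 0" for v
  proof -
    let ?v = "\<chi> j. if j = k then 0 else v $ j"
    have "eval ?v (f * g) = 0" using assms unfolding coord_dvd_iff by simp
    then show ?thesis
      using eval_independent[OF r, of v 0] eval_independent[OF s, of v 0] by (simp add: f g eval_simps)
  qed
  then have "r * s = 0" by (rule eval_zero_imp_zero)
  then show ?thesis by (auto simp: f g)
qed

lemma substitute_zero_poly:
  assumes "coefficient_hom h"
  shows "poly (substitute (\<lambda>c. [:h c:]) \<sigma> f) x = substitute h (\<lambda>k. poly (\<sigma> k) x) f"
proof -
  interpret coefficient_hom h by fact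
  interpret p: coefficient_hom "\<lambda>c. [:h c:]"
    by unfold_locales (simp_all add: h_0 h_1 h_add h_mult one_pCons)
  show ?thesis
    by (induction f rule: coord_ring_induct) (simp_all add: substitute_simps p.substitute_simps)
qed

text \<open>The outer variable is a path parameter. At its value 0, coprimality makes
  \<open>poly G6 0\<close> divide the constant coefficient of \<open>q\<close>, which is too small
  in degree and hence zero. Then the constant coefficient of \<open>p\<close> vanishes too, the
  relation can be divided by the parameter, and the argument repeats.\<close>

lemma no_small_syzygy:
  fixes p q G6 G10 :: "complex poly poly"
  assumes "p * G6 + q * G10 = 0" "\<And>n. degree (coeff q n) < degree (poly G6 0)" and bezout: "u * poly G6 0 + v * poly G10 0 = 1"
  shows "q = 0"
  using assms(1,2)
proof (induction q arbitrary: p)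
  case (pCons a q)
  have "poly (p * G6 + pCons a q * G10) 0 = 0" using pCons.prems(1) by simp
  then have "poly p 0 * poly G6 0 + a * poly G10 0 = 0" by simp
  then have a10: "a * poly G10 0 = - (poly p 0 * poly G6 0)"
    by (simp add: add_eq_0_iff)
  have "a = a * (u * poly G6 0 + v * poly G10 0)" using bezout by simp
  also have "\<dots> = a * u * poly G6 0 + v * (a * poly G10 0)" by (simp only: distrib_left mult_ac)
  also have "\<dots> = poly G6 0 * (a * u - v * poly p 0)" unfolding a10 by (simp add: algebra_simps)
  finally have "a = poly G6 0 * (a * u - v * poly p 0)" .
  then have "poly G6 0 dvd a" by (metis dvd_triv_left)
  moreover have "degree a < degree (poly G6 0)" using pCons.prems(2)[of 0] by simp
  ultimately have a: "a = 0" using dvd_imp_degree_le by fastforce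
  obtain b p' where p: "p = pCons b p'" by (cases p)
  have "poly G6 0 \<noteq> 0" using pCons.prems(2)[of 0] by auto
  then have b: "b = 0" using \<open>poly p 0 * poly G6 0 + a * poly G10 0 = 0\<close> by (simp add: a p)
  have "pCons 0 (p' * G6 + q * G10) = 0"
    using pCons.prems(1) by (simp add: a b p)
  then have "p' * G6 + q * G10 = 0" by simp
  moreover have "degree (coeff q n) < degree (poly G6 0)" for n
    using pCons.prems(2)[of "Suc n"] by simp
  ultimately show ?case using pCons.IH a by simp
qed simp

section \<open>Cancelling the first coordinate\<close>

text \<open>A bound on the degree in the inner variable; \<open>degree\<close> of a nested
  polynomial would measure the outer one.\<close>

definition coeff_degree_le :: "nat \<Rightarrow> complex poly poly \<Rightarrow> bool" where
  "coeff_degree_le d P \<longleftrightarrow> (\<forall>n. degree (coeff P n) \<le> d)"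

lemma coeff_degree_le_mult:
  assumes "coeff_degree_le d P" "coeff_degree_le e Q"
  shows "coeff_degree_le (d + e) (P * Q)"
  unfolding coeff_degree_le_def coeff_mult
proof (intro allI degree_sum_le)
  fix n i
  have "degree (coeff P i * coeff Q (n - i)) \<le> degree (coeff P i) + degree (coeff Q (n - i))" by (rule degree_mult_le)
  also have "\<dots> \<le> d + e" using assms unfolding coeff_degree_le_def by (intro add_mono) auto
  finally show "degree (coeff P i * coeff Q (n - i)) \<le> d + e" .
qed simp

lemma coeff_degree_le_const: "coeff_degree_le 0 [:[:c:]:]" "coeff_degree_le 0 [:[:c:], [:d:]:]" "coeff_degree_le 0 1"
  and coeff_degree_le_var: "coeff_degree_le 1 [:[:0, 1:]:]"
  by (auto simp: coeff_degree_le_def coeff_pCons split: nat.splits)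

lemma coeff_degree_le_power: "coeff_degree_le d P \<Longrightarrow> coeff_degree_le (d * n) (P ^ n)"
  by (induction n) (auto simp: coeff_degree_le_const dest: coeff_degree_le_mult)

lemma coeff_degree_le_prod:
  "finite K \<Longrightarrow> (\<And>k. k \<in> K \<Longrightarrow> coeff_degree_le (d k) (P k)) \<Longrightarrow> coeff_degree_le (sum d K) (prod P K)"
  by (induction K rule: finite_induct) (auto simp: coeff_degree_le_const coeff_degree_le_mult)

lemma coeff_degree_le_sum:
  "finite K \<Longrightarrow> (\<And>k. k \<in> K \<Longrightarrow> coeff_degree_le d (P k)) \<Longrightarrow> coeff_degree_le d (sum P K)"
  by (auto simp: coeff_degree_le_def coeff_sum intro!: degree_sum_le)

text \<open>On the plane spanned by \<open>x\<^sub>1\<^sup>5 x\<^sub>2 + x\<^sub>2\<^sup>6\<close> and \<open>x\<^sub>1\<^sup>3 x\<^sub>2\<^sup>3\<close>, the two invariants have no common zero.\<close>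

definition plane :: "7 \<Rightarrow> complex poly" where
  "plane k = (if k = 1 \<or> k = 6 then 1 else if k = 3 then [:0, 1:] else 0)"

interpretation poly_hom: coefficient_hom "\<lambda>c. [:c:]"
  by unfold_locales (simp_all add: one_pCons)

lemma U_on_plane:
  "substitute (\<lambda>c. [:c:]) plane U6 = [:0, 3025/3, 0, 0, 0, 0, -8/15:]"
  "substitute (\<lambda>c. [:c:]) plane U10 = [:-14907200/9, 0, 0, 0, 0, -16548713/450, 0, 0, 0, 0, -722732/140625:]"
proof -
  let ?h = "\<lambda>c :: complex. [:c:]"
  let ?i = "i_coeff ?h plane" and ?l = "l_coeff ?h plane"
  have plane: "plane 0 = 0" "plane 1 = 1" "plane 2 = 0" "plane 3 = [:0, 1:]" "plane 4 = 0" "plane 5 = 0" "plane 6 = 1"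
    by (simp_all add: plane_def)
  note arith = power2_eq_square power3_eq_cube numeral_poly one_pCons
  have i: "?i 0 = [:0, -1/15:]" "?i 1 = 0" "?i 2 = [:0, 0, 1/25:]" "?i 3 = [:2/3:]" "?i 4 = 0"
    unfolding i_coeff_def nth_literal plane by (simp_all add: arith)
  have l: "?l 0 = [:-1/9:]" "?l 1 = [:0, 0, 0, 1/250:]" "?l 2 = [:0, -1/10:]"
    unfolding l_coeff_def Let_def nth_literal i plane by (simp_all add: arith)
  have J: "J2 ?h plane = [:0, 0, -1/20:]" "J4 ?h plane = [:0, 0, 0, 0, 1/3750:]" "J6 ?h plane = [:0, 1/45, 0, 0, 0, 0, -1/125000:]" "J10 ?h plane = [:-1/729, 0, 0, 0, 0, -1/30000, 0, 0, 0, 0, -1/312500000:]"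
    unfolding J2_def J4_def J6_def J10_def Let_def cube_coeff_def nth_literal i l plane by (simp_all add: arith)
  show "substitute (\<lambda>c. [:c:]) plane U6 = [:0, 3025/3, 0, 0, 0, 0, -8/15:]"
    "substitute (\<lambda>c. [:c:]) plane U10 = [:-14907200/9, 0, 0, 0, 0, -16548713/450, 0, 0, 0, 0, -722732/140625:]"
    unfolding poly_hom.substitute_U W6_def W10_def J by (simp_all add: arith)
qed

lemma bezout_U_on_plane:
  "\<exists>u v. u * substitute (\<lambda>c. [:c:]) plane U6 + v * substitute (\<lambda>c. [:c:]) plane U10 = 1"
proof (intro exI)
  \<comment> \<open>The Euclidean algorithm in x^5: on the plane U6 is x times a linear polynomial
    in x^5 and U10 is a quadratic one, and the factor x^4 of the first cofactor completes x to
    x^5.\<close>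
  show "[:0, 0, 0, 0, -1441807186803/67048430218000000, 0, 0, 0, 0, -15820784163/5238158610781250000:] * substitute (\<lambda>c. [:c:]) plane U6 + [:-9/14907200, 0, 0, 0, 0, 262683/838105377725000:] * substitute (\<lambda>c. [:c:]) plane U10 = 1"
    unfolding U_on_plane by (simp add: one_pCons)
qed

lemma eval_U6_axis3: "eval (\<chi> j. if j = 3 then 1 else 0) U6 = - 8 / 15"
  unfolding W_eq_eval[symmetric] W6_def J2_def J4_def J6_def l_coeff_def i_coeff_def Let_def nth_literal
  by (simp add: power2_eq_square power3_eq_cube)

text \<open>U6 contains a3^6, so up to a unit it is monic of degree 6 in a3; the division weight is
  the degree in a3.\<close>

lemma U6_leads:
  "\<exists>L. Poly_Mapping.single (Poly_Mapping.single 3 6) 1 + L = const (inverse (- 8 / 15)) * U6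
    \<and> (\<forall>m\<in>Poly_Mapping.keys L. weight (\<lambda>k. if k = 3 then 1 else 0) m < (if (3::7) = 3 then 1 else 0) * 6)"
proof (rule pure_power_leads[OF isobaric_U_degree(1) _ _ eval_U6_axis3])
  fix m assume m: "m \<in> Poly_Mapping.keys U6" "m \<noteq> Poly_Mapping.single 3 6"
  have deg: "Poly_Mapping.lookup m 0 + Poly_Mapping.lookup m 1 + Poly_Mapping.lookup m 2 + Poly_Mapping.lookup m 3
      + Poly_Mapping.lookup m 4 + Poly_Mapping.lookup m 5 + Poly_Mapping.lookup m 6 = 6"
    using bspec[OF isobaric_U_degree(1)[unfolded isobaric_def] m(1)] unfolding sum_index by simp
  have "Poly_Mapping.lookup m 3 < 6"
  proof (rule ccontr)
    assume "\<not> Poly_Mapping.lookup m 3 < 6"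
    then have "Poly_Mapping.lookup m 3 = 6" "\<forall>j. j \<noteq> 3 \<longrightarrow> Poly_Mapping.lookup m j = 0"
      using deg unfolding all_index by auto
    then have "m = Poly_Mapping.single 3 6" by (intro monomial_eq_single)
    then show False using m(2) by contradiction
  qed
  then show "weight (\<lambda>k. if k = 3 then 1 else 0) m < (if (3::7) = 3 then 1 else 0) * 6"
    unfolding sum_index by simp
qed auto

text \<open>Reduce the cofactor of \<open>U10\<close> modulo \<open>U6\<close>. If it did not vanish on the hyperplane \<open>a\<^sub>0 = 0\<close>, then its
  lowest term along a line in this hyperplane ending in the plane above would give a syzygy that is too small.\<close>

lemma coord_0_cancel:
  assumes syz: "coord 0 * f = A * U6 + B * U10"
  shows "\<exists>A' B'. f = A' * U6 + B' * U10"
proof -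
  let ?w = "\<lambda>k :: 7. if k = 3 then 1 else 0 :: nat"
  have "\<exists>R. B - R \<in> range (\<lambda>Q. Q * U6) \<and> (\<forall>m\<in>Poly_Mapping.keys R. \<forall>(k, e)\<in>{(3, 6)}. Poly_Mapping.lookup m k < e)"
  proof (rule multivariate_division[where w = ?w])
    show "0 \<in> range (\<lambda>Q. Q * U6)" by (rule range_eqI[of _ _ 0]) simp
  next
    fix f g assume "f \<in> range (\<lambda>Q. Q * U6)" "g \<in> range (\<lambda>Q. Q * U6)"
    then obtain P Q where "f = P * U6" "g = Q * U6" by blast
    then show "f + g \<in> range (\<lambda>Q. Q * U6)" by (intro range_eqI[of _ _ "P + Q"]) (simp add: distrib_right)
  next
    fix f g assume "g \<in> range (\<lambda>Q. Q * U6)"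
    then obtain Q where "g = Q * U6" by blast
    then show "f * g \<in> range (\<lambda>Q. Q * U6)" by (intro range_eqI[of _ _ "f * Q"]) (simp add: mult.assoc)
  next
    fix k :: 7 and e :: nat assume ke: "(k, e) \<in> {(3, 6)}"
    obtain L where L: "Poly_Mapping.single (Poly_Mapping.single 3 6) 1 + L = const (inverse (- 8 / 15)) * U6"
      "\<forall>m\<in>Poly_Mapping.keys L. weight ?w m < ?w 3 * 6"
      using U6_leads by blast
    have "k = 3" "e = 6" using ke by auto
    show "\<exists>L. Poly_Mapping.single (Poly_Mapping.single k e) 1 + L \<in> range (\<lambda>Q. Q * U6)
        \<and> (\<forall>m\<in>Poly_Mapping.keys L. weight ?w m < ?w k * e)"
    proof (intro exI conjI)
      show "Poly_Mapping.single (Poly_Mapping.single k e) 1 + L \<in> range (\<lambda>Q. Q * U6)"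
        unfolding \<open>k = 3\<close> \<open>e = 6\<close> L(1) by (rule rangeI)
      show "\<forall>m\<in>Poly_Mapping.keys L. weight ?w m < ?w k * e"
        unfolding \<open>k = 3\<close> \<open>e = 6\<close> by (rule L(2))
    qed
  qed
  then obtain R Q where Q: "B - R = Q * U6" and R: "\<forall>m\<in>Poly_Mapping.keys R. Poly_Mapping.lookup m 3 < 6"
    by auto
  have B: "B = R + Q * U6" using Q by (simp add: algebra_simps)
  define A' where "A' = A + Q * U10"
  have syz': "coord 0 * f = A' * U6 + R * U10"
    unfolding syz A'_def B by (simp add: algebra_simps)
  have "eval v R = 0" if v: "v $ 0 = 0" for v
  proof -
    let ?h = "\<lambda>c :: complex. [:[:c:]:]"
    \<comment> \<open>\<open>\<theta>\<close> is a path whose parameter is the outer variable: at 0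
      it gives \<open>plane\<close>, at 1 it gives \<open>v\<close>. Coordinate 3 does not move; it
      is the free inner variable and is set to \<open>v $ 3\<close> only at the end.\<close>
    define p where "p k = (if k = 1 \<or> k = 6 then 1 else 0 :: complex)" for k :: 7
    define \<theta> where "\<theta> k = (if k = 3 then [:[:0, 1:]:] else [:[:p k:], [:v $ k - p k:]:])" for k :: 7
    interpret hom: coefficient_hom ?h
      by unfold_locales (simp_all add: one_pCons)
    have at0: "poly (substitute ?h \<theta> g) 0 = substitute (\<lambda>c. [:c:]) plane g" for g
    proof -
      have "(\<lambda>k. poly (\<theta> k) 0) = plane"
        by (rule ext) (simp add: \<theta>_def plane_def p_def one_pCons)
      then show ?thesis by (simp only: substitute_zero_poly[OF poly_hom.coefficient_hom_axioms])
    qed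
    have at1: "poly (poly (substitute ?h \<theta> g) 1) (v $ 3) = eval v g" for g
    proof -
      have "(\<lambda>k. poly (poly (\<theta> k) 1) (v $ 3)) = ($) v"
        by (rule ext) (simp add: \<theta>_def)
      then show ?thesis
        by (simp only: substitute_zero_poly[OF poly_hom.coefficient_hom_axioms]
          substitute_zero_poly[OF id_hom.coefficient_hom_axioms] eval_eq_substitute)
    qed
    \<comment> \<open>Both ends of the path have coordinate 0 equal to 0, so the left side of the
      relation vanishes along all of it.\<close>
    have "\<theta> 0 = 0" using v by (simp add: \<theta>_def p_def)
    then have "substitute ?h \<theta> A' * substitute ?h \<theta> U6 + substitute ?h \<theta> R * substitute ?h \<theta> U10 = 0"
      using arg_cong[OF syz', of "substitute ?h \<theta>"] by (simp add: hom.substitute_simps)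
    moreover have deg6: "degree (poly (substitute ?h \<theta> U6) 0) = 6"
      unfolding at0 U_on_plane by simp
    \<comment> \<open>The inner variable enters only through coordinate 3, whose exponent in R is at
      most 5, one less than the degree of U6 on the plane.\<close>
    moreover have le5: "coeff_degree_le 5 (substitute ?h \<theta> R)"
      unfolding substitute_def
    proof (rule coeff_degree_le_sum[OF finite_keys])
      fix m assume m: "m \<in> Poly_Mapping.keys R"
      let ?d = "\<lambda>k :: 7. if k = 3 then Poly_Mapping.lookup m k else 0"
      have "coeff_degree_le (?d k) (\<theta> k ^ Poly_Mapping.lookup m k)" for k
      proof (cases "k = 3")
        case True
        then show ?thesis
          using coeff_degree_le_power[OF coeff_degree_le_var, of "Poly_Mapping.lookup m k"] by (simp add: \<theta>_def)
      next
        case False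
        then show ?thesis
          using coeff_degree_le_power[OF coeff_degree_le_const(2)[of "p k" "v $ k - p k"], of "Poly_Mapping.lookup m k"]
          by (simp add: \<theta>_def)
      qed
      then have "coeff_degree_le (0 + sum ?d UNIV) (?h (Poly_Mapping.lookup R m) * monom_at \<theta> m)"
        unfolding monom_at_def by (intro coeff_degree_le_mult coeff_degree_le_const coeff_degree_le_prod) auto
      moreover have "0 + sum ?d UNIV \<le> 5" using R m by fastforce
      ultimately show "coeff_degree_le 5 (?h (Poly_Mapping.lookup R m) * monom_at \<theta> m)"
        unfolding coeff_degree_le_def using order_trans by blast
    qed
    moreover have "degree (coeff (substitute ?h \<theta> R) n) < degree (poly (substitute ?h \<theta> U6) 0)" for n
      using le5[unfolded coeff_degree_le_def, rule_format, of n] unfolding deg6 by simp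
    ultimately have "substitute ?h \<theta> R = 0"
      using bezout_U_on_plane no_small_syzygy unfolding at0[symmetric] by blast
    then show ?thesis using at1[of R] by simp
  qed
  then have "coord 0 dvd R" unfolding coord_dvd_iff by blast
  then obtain R' where R': "R = coord 0 * R'" by (rule dvdE)
  then have "coord 0 * (f - R' * U10) = A' * U6" using syz' by (simp add: algebra_simps)
  then have "coord 0 dvd A' * U6" by (metis dvd_triv_left)
  moreover have "\<not> coord 0 dvd U6"
  proof
    assume "coord 0 dvd U6"
    then have "eval (\<chi> j. if j = 3 then 1 else 0) U6 = 0" unfolding coord_dvd_iff by simp
    then show False unfolding eval_U6_axis3 by simp
  qed
  ultimately have "coord 0 dvd A'" using coord_prime by blast
  then obtain A'' where "A' = coord 0 * A''" by (rule dvdE)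
  then have "coord 0 * f = coord 0 * (A'' * U6 + R' * U10)"
    unfolding syz' R' by (simp add: distrib_left mult.assoc)
  moreover have "coord 0 \<noteq> 0"
    using eval_coord[of "\<chi> _. 1" 0] by (metis eval_0 vec_lambda_beta zero_neq_one)
  ultimately have "f = A'' * U6 + R' * U10" by simp
  then show ?thesis by blast
qed

lemma coord_0_power_cancel:
  assumes "coord 0 ^ N * f = A * U6 + B * U10"
  shows "\<exists>A B. f = A * U6 + B * U10"
  using assms
proof (induction N arbitrary: A B)
  case (Suc N)
  then have "coord 0 * (coord 0 ^ N * f) = A * U6 + B * U10" by (simp add: mult.assoc)
  then show ?case using coord_0_cancel Suc.IH by blast
qed auto

section \<open>Centred coordinates\<close>

text \<open>Up to powers of \<open>a\<^sub>0\<close>, these are the coefficients of the translated sextic without \<open>x\<^sub>1\<^sup>5 x\<^sub>2\<close>-term.\<close>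

definition centred :: "7 \<Rightarrow> coord_ring" where
  "centred k = (if k = 0 then coord 0 else if k = 1 then coord 1
     else if k = 2 then const (-5/12) * coord 1 ^ 2 + const (1) * coord 0 ^ 1 * coord 2
     else if k = 3 then const (5/27) * coord 1 ^ 3 + const (-2/3) * coord 1 ^ 1 * coord 0 ^ 1 * coord 2 + const (1) * coord 0 ^ 2 * coord 3
     else if k = 4 then const (-5/144) * coord 1 ^ 4 + const (1/6) * coord 1 ^ 2 * coord 0 ^ 1 * coord 2 + const (-1/2) * coord 1 ^ 1 * coord 0 ^ 2 * coord 3 + const (1) * coord 0 ^ 3 * coord 4
     else if k = 5 then const (1/324) * coord 1 ^ 5 + const (-1/54) * coord 1 ^ 3 * coord 0 ^ 1 * coord 2 + const (1/12) * coord 1 ^ 2 * coord 0 ^ 2 * coord 3 + const (-1/3) * coord 1 ^ 1 * coord 0 ^ 3 * coord 4 + const (1) * coord 0 ^ 4 * coord 5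
     else const (-5/46656) * coord 1 ^ 6 + const (1/1296) * coord 1 ^ 4 * coord 0 ^ 1 * coord 2 + const (-1/216) * coord 1 ^ 3 * coord 0 ^ 2 * coord 3 + const (1/36) * coord 1 ^ 2 * coord 0 ^ 3 * coord 4 + const (-1/6) * coord 1 ^ 1 * coord 0 ^ 4 * coord 5 + const (1) * coord 0 ^ 5 * coord 6)"

lemma centred:
  "centred 0 = coord 0" "centred 1 = coord 1"
  "centred 2 = const (-5/12) * coord 1 ^ 2 + const (1) * coord 0 ^ 1 * coord 2"
  "centred 3 = const (5/27) * coord 1 ^ 3 + const (-2/3) * coord 1 ^ 1 * coord 0 ^ 1 * coord 2 + const (1) * coord 0 ^ 2 * coord 3"
  "centred 4 = const (-5/144) * coord 1 ^ 4 + const (1/6) * coord 1 ^ 2 * coord 0 ^ 1 * coord 2 + const (-1/2) * coord 1 ^ 1 * coord 0 ^ 2 * coord 3 + const (1) * coord 0 ^ 3 * coord 4"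
  "centred 5 = const (1/324) * coord 1 ^ 5 + const (-1/54) * coord 1 ^ 3 * coord 0 ^ 1 * coord 2 + const (1/12) * coord 1 ^ 2 * coord 0 ^ 2 * coord 3 + const (-1/3) * coord 1 ^ 1 * coord 0 ^ 3 * coord 4 + const (1) * coord 0 ^ 4 * coord 5"
  "centred 6 = const (-5/46656) * coord 1 ^ 6 + const (1/1296) * coord 1 ^ 4 * coord 0 ^ 1 * coord 2 + const (-1/216) * coord 1 ^ 3 * coord 0 ^ 2 * coord 3 + const (1/36) * coord 1 ^ 2 * coord 0 ^ 3 * coord 4 + const (-1/6) * coord 1 ^ 1 * coord 0 ^ 4 * coord 5 + const (1) * coord 0 ^ 5 * coord 6"
  by (simp_all add: centred_def)

text \<open>Translating back by a1/(6 a0) expresses every a_k through the centred coordinates up to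
  a power of a0, and this property is inherited by sums and products.\<close>

lemma clear_denominator: "\<exists>N F. coord 0 ^ N * f = substitute const centred F"
proof (induction f rule: coord_ring_induct)
  case (const c)
  show ?case by (intro exI[of _ 0] exI[of _ "const c"]) simp
next
  case (coord k)
  have c0: "coord 0 ^ 0 * coord 0 = substitute const centred (coord 0)"
    and c1: "coord 0 ^ 0 * coord 1 = substitute const centred (coord 1)"
    by (simp_all add: centred)
  have "coord 0 ^ 1 * coord 2 = substitute const centred (const (5/12) * coord 1 ^ 2 + const (1) * coord 2)"
    by (rule eval_eq_imp_eq, simp only: const_hom.substitute_simps const_hom.substitute_coord const_hom.substitute_const centred eval_simps eval_coord eval_const, algebra)
  note c2 = this
  have "coord 0 ^ 2 * coord 3 = substitute const centred (const (5/54) * coord 1 ^ 3 + const (2/3) * coord 1 ^ 1 * coord 2 + const (1) * coord 3)"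
    by (rule eval_eq_imp_eq, simp only: const_hom.substitute_simps const_hom.substitute_coord const_hom.substitute_const centred eval_simps eval_coord eval_const, algebra)
  note c3 = this
  have "coord 0 ^ 3 * coord 4 = substitute const centred (const (5/432) * coord 1 ^ 4 + const (1/6) * coord 1 ^ 2 * coord 2 + const (1/2) * coord 1 ^ 1 * coord 3 + const (1) * coord 4)"
    by (rule eval_eq_imp_eq, simp only: const_hom.substitute_simps const_hom.substitute_coord const_hom.substitute_const centred eval_simps eval_coord eval_const, algebra)
  note c4 = this
  have "coord 0 ^ 4 * coord 5 = substitute const centred (const (1/1296) * coord 1 ^ 5 + const (1/54) * coord 1 ^ 3 * coord 2 + const (1/12) * coord 1 ^ 2 * coord 3 + const (1/3) * coord 1 ^ 1 * coord 4 + const (1) * coord 5)"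
    by (rule eval_eq_imp_eq, simp only: const_hom.substitute_simps const_hom.substitute_coord const_hom.substitute_const centred eval_simps eval_coord eval_const, algebra)
  note c5 = this
  have "coord 0 ^ 5 * coord 6 = substitute const centred (const (1/46656) * coord 1 ^ 6 + const (1/1296) * coord 1 ^ 4 * coord 2 + const (1/216) * coord 1 ^ 3 * coord 3 + const (1/36) * coord 1 ^ 2 * coord 4 + const (1/6) * coord 1 ^ 1 * coord 5 + const (1) * coord 6)"
    by (rule eval_eq_imp_eq, simp only: const_hom.substitute_simps const_hom.substitute_coord const_hom.substitute_const centred eval_simps eval_coord eval_const, algebra)
  note c6 = this
  have "\<forall>k. \<exists>N F. coord 0 ^ N * coord k = substitute const centred F"
    unfolding all_index using c0 c1 c2 c3 c4 c5 c6 by blast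
  then show ?case by blast
next
  case (add f g)
  then obtain M N F G where FG: "coord 0 ^ M * f = substitute const centred F" "coord 0 ^ N * g = substitute const centred G"
    by blast
  have "coord 0 ^ (M + N) * (f + g) = coord 0 ^ N * (coord 0 ^ M * f) + coord 0 ^ M * (coord 0 ^ N * g)"
    by (simp add: power_add algebra_simps)
  also have "\<dots> = substitute const centred (coord 0 ^ N * F + coord 0 ^ M * G)"
    unfolding FG by (simp add: const_hom.substitute_simps centred)
  finally show ?case by blast
next
  case (mult f g)
  then obtain M N F G where FG: "coord 0 ^ M * f = substitute const centred F" "coord 0 ^ N * g = substitute const centred G"
    by blast
  have "coord 0 ^ (M + N) * (f * g) = (coord 0 ^ M * f) * (coord 0 ^ N * g)"
    by (simp add: power_add algebra_simps)
  also have "\<dots> = substitute const centred (F * G)"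
    unfolding FG by (simp add: const_hom.substitute_simps)
  finally show ?case by blast
qed

section \<open>The invariants on the slice a0 = 1, a1 = 0\<close>

definition slice :: "7 \<Rightarrow> coord_ring" where
  "slice k = (if k = 0 then 1 else if k = 1 then 0 else coord k)"

definition u6 :: coord_ring where "u6 = W6 const slice"
definition u10 :: coord_ring where "u10 = W10 const slice"

lemma eval_u: "eval v u6 = eval (vec7 1 0 (v $ 2) (v $ 3) (v $ 4) (v $ 5) (v $ 6)) U6"
  "eval v u10 = eval (vec7 1 0 (v $ 2) (v $ 3) (v $ 4) (v $ 5) (v $ 6)) U10"
proof -
  have "(\<chi> k. eval v (slice k)) = vec7 1 0 (v $ 2) (v $ 3) (v $ 4) (v $ 5) (v $ 6)"
    by (rule vec7_eqI) (simp_all add: slice_def)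
  then show "eval v u6 = eval (vec7 1 0 (v $ 2) (v $ 3) (v $ 4) (v $ 5) (v $ 6)) U6"
    "eval v u10 = eval (vec7 1 0 (v $ 2) (v $ 3) (v $ 4) (v $ 5) (v $ 6)) U10"
    by (simp_all only: u6_def u10_def const_hom.substitute_U[symmetric] eval_substitute)
qed

lemma shift_centred:
  assumes "v $ 0 \<noteq> 0"
  shows "shift (- v $ 1 / (6 * v $ 0)) v = vec7 (v $ 0) 0 (eval v (centred 2) / v $ 0) (eval v (centred 3) / v $ 0 ^ 2)
    (eval v (centred 4) / v $ 0 ^ 3) (eval v (centred 5) / v $ 0 ^ 4) (eval v (centred 6) / v $ 0 ^ 5)"
proof -
  obtain s where s: "s = - v $ 1 / (6 * v $ 0)" by blast
  then have v1: "v $ 1 = - 6 * s * v $ 0" using assms by simp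
  have C: "eval v (centred 2) = v $ 0 * (15 * s\<^sup>2 * v $ 0 + 5 * s * v $ 1 + v $ 2)"
    "eval v (centred 3) = v $ 0 ^ 2 * (20 * s ^ 3 * v $ 0 + 10 * s\<^sup>2 * v $ 1 + 4 * s * v $ 2 + v $ 3)"
    "eval v (centred 4) = v $ 0 ^ 3 * (15 * s ^ 4 * v $ 0 + 10 * s ^ 3 * v $ 1 + 6 * s\<^sup>2 * v $ 2 + 3 * s * v $ 3 + v $ 4)"
    "eval v (centred 5) = v $ 0 ^ 4 * (6 * s ^ 5 * v $ 0 + 5 * s ^ 4 * v $ 1 + 4 * s ^ 3 * v $ 2 + 3 * s\<^sup>2 * v $ 3 + 2 * s * v $ 4 + v $ 5)"
    "eval v (centred 6) = v $ 0 ^ 5 * (s ^ 6 * v $ 0 + s ^ 5 * v $ 1 + s ^ 4 * v $ 2 + s ^ 3 * v $ 3 + s\<^sup>2 * v $ 4 + s * v $ 5 + v $ 6)"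
    unfolding centred eval_simps eval_coord eval_const v1 by algebra+
  show ?thesis
    unfolding s[symmetric] C by (rule vec7_eqI) (use assms in \<open>simp_all add: shift_def v1\<close>)
qed

text \<open>The translated sextic is a0 times the torus element 1/a0 applied to the slice point (1,
  0, c2, ..., c6). Degree and weight of the invariants then give the factors a0^(6-18) and
  a0^(10-30).\<close>

lemma substitute_centred_u:
  "substitute const centred u6 = coord 0 ^ 12 * U6" "substitute const centred u10 = coord 0 ^ 20 * U10"
proof -
  have ev: "eval v (substitute const centred u6) = v $ 0 ^ 12 * eval v U6 \<and>
      eval v (substitute const centred u10) = v $ 0 ^ 20 * eval v U10" if "v $ 0 \<noteq> 0" for v
  proof -
    define w where "w = vec7 1 0 (eval v (centred 2)) (eval v (centred 3)) (eval v (centred 4)) (eval v (centred 5)) (eval v (centred 6))"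
    define w' where "w' = (\<chi> k. inverse (v $ 0) ^ index k * w $ k)"
    have "shift (- v $ 1 / (6 * v $ 0)) v = (\<chi> k. v $ 0 * w' $ k)"
      unfolding shift_centred[OF that]
      by (rule vec7_eqI) (use that in \<open>simp_all add: w'_def w_def field_simps power_numeral_reduce\<close>)
    then have "eval v U6 = v $ 0 ^ 6 * eval w' U6" "eval v U10 = v $ 0 ^ 10 * eval w' U10"
      using eval_U_shift[of "- v $ 1 / (6 * v $ 0)" v] by (simp_all only: eval_U_degree)
    moreover have "eval w' U6 = inverse (v $ 0) ^ 18 * eval w U6" "eval w' U10 = inverse (v $ 0) ^ 30 * eval w U10"
      unfolding w'_def eval_U_weight by simp_all
    moreover have "eval v (substitute const centred u6) = eval w U6" "eval v (substitute const centred u10) = eval w U10"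
      by (simp_all add: eval_substitute eval_u w_def)
    moreover have "v $ 0 ^ 12 * (v $ 0 ^ 6 * inverse (v $ 0) ^ 18) = 1" "v $ 0 ^ 20 * (v $ 0 ^ 10 * inverse (v $ 0) ^ 30) = 1"
      using that by (simp_all add: power_inverse mult.assoc[symmetric] power_add[symmetric])
    ultimately show ?thesis by (simp add: mult.assoc[symmetric])
  qed
  \<comment> \<open>Points with a0 = 0 do no harm, because a0 (f - g) vanishes everywhere.\<close>
  have cancel: "f = g" if "\<And>v. v $ 0 \<noteq> 0 \<Longrightarrow> eval v f = eval v g" for f g
  proof -
    have "coord 0 * (f - g) = 0"
      by (rule eval_zero_imp_zero) (use that in \<open>auto simp: eval_simps\<close>)
    moreover have "coord 0 \<noteq> 0"
      using eval_coord[of "\<chi> _. 1" 0] by (metis eval_0 vec_lambda_beta zero_neq_one)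
    ultimately show ?thesis by simp
  qed
  show "substitute const centred u6 = coord 0 ^ 12 * U6" "substitute const centred u10 = coord 0 ^ 20 * U10"
    by (rule cancel, use ev in \<open>simp add: eval_simps\<close>)+
qed

text \<open>Weight 0 for the indicator of k means that coordinate k does not occur, which is the
  content of the last two claims.\<close>

lemma isobaric_u:
  "isobaric index 18 u6" "isobaric index 30 u10"
  "k = 0 \<or> k = 1 \<Longrightarrow> isobaric (\<lambda>j. if j = k then 1 else 0) 0 u6"
  "k = 0 \<or> k = 1 \<Longrightarrow> isobaric (\<lambda>j. if j = k then 1 else 0) 0 u10"
proof -
  have one: "isobaric w 0 1" for w using isobaric_numeral[of w Num.One] by simp
  have "isobaric index (index k) (slice k)" for k
    using one isobaric_0 isobaric_coord[of index k] by (simp add: slice_def)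
  then show "isobaric index 18 u6" "isobaric index 30 u10"
    using isobaric_W[of index 0 1 slice] by (simp_all add: u6_def u10_def)
  have "isobaric (\<lambda>j. if j = k then 1 else 0) 0 (slice j)" if "k = 0 \<or> k = 1" for j k
    using one isobaric_0 isobaric_coord[of "\<lambda>j. if j = k then 1 else 0" j] that by (auto simp: slice_def)
  then show "k = 0 \<or> k = 1 \<Longrightarrow> isobaric (\<lambda>j. if j = k then 1 else 0) 0 u6"
    "k = 0 \<or> k = 1 \<Longrightarrow> isobaric (\<lambda>j. if j = k then 1 else 0) 0 u10"
    using isobaric_W[of "\<lambda>j. if j = k then 1 else 0" 0 0 slice] by (simp_all add: u6_def u10_def)
qed

lemma eval_u_axis:
  "eval (\<chi> j. if j = 6 then 1 else 0) u6 = - 3332 / 3" "eval (\<chi> j. if j = 5 then 1 else 0) u10 = - 14907200 / 9"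
  unfolding eval_u W_eq_eval[symmetric] W6_def W10_def J2_def J4_def J6_def J10_def cube_coeff_def l_coeff_def i_coeff_def
    Let_def nth_literal by (simp_all add: power2_eq_square power3_eq_cube)

text \<open>The ratio \<open>51/60\<close> slightly exceeds \<open>5/6\<close>: among isobaric monomials, \<open>c\<^sub>5\<^sup>6\<close> then beats \<open>c\<^sub>6\<^sup>5\<close> in weight \<open>30\<close>,
  while \<open>c\<^sub>6\<^sup>3\<close> still leads in weight \<open>18\<close>.\<close>

abbreviation (input) lead_weight :: "7 \<Rightarrow> nat" where
  "lead_weight \<equiv> \<lambda>k. if k = 5 then 51 else if k = 6 then 60 else 0"

lemma u_leads:
  "\<exists>L. Poly_Mapping.single (Poly_Mapping.single 6 3) 1 + L = const (inverse (- 3332 / 3)) * u6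
    \<and> (\<forall>m\<in>Poly_Mapping.keys L. weight lead_weight m < lead_weight 6 * 3)"
  "\<exists>L. Poly_Mapping.single (Poly_Mapping.single 5 6) 1 + L = const (inverse (- 14907200 / 9)) * u10
    \<and> (\<forall>m\<in>Poly_Mapping.keys L. weight lead_weight m < lead_weight 5 * 6)"
proof -
  have lw: "weight lead_weight m = 51 * Poly_Mapping.lookup m 5 + 60 * Poly_Mapping.lookup m 6" for m
    unfolding sum_index by simp
  show "\<exists>L. Poly_Mapping.single (Poly_Mapping.single 6 3) 1 + L = const (inverse (- 3332 / 3)) * u6
    \<and> (\<forall>m\<in>Poly_Mapping.keys L. weight lead_weight m < lead_weight 6 * 3)"
  proof (rule pure_power_leads[OF isobaric_u(1) _ _ eval_u_axis(1)])
    fix m assume m: "m \<in> Poly_Mapping.keys u6" "m \<noteq> Poly_Mapping.single 6 3"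
    have z: "Poly_Mapping.lookup m 0 = 0" "Poly_Mapping.lookup m 1 = 0"
      using bspec[OF isobaric_u(3)[of 0, unfolded isobaric_def] m(1)] bspec[OF isobaric_u(3)[of 1, unfolded isobaric_def] m(1)]
      unfolding sum_index by simp_all
    have wt: "2 * Poly_Mapping.lookup m 2 + 3 * Poly_Mapping.lookup m 3 + 4 * Poly_Mapping.lookup m 4
        + 5 * Poly_Mapping.lookup m 5 + 6 * Poly_Mapping.lookup m 6 = 18"
      using bspec[OF isobaric_u(1)[unfolded isobaric_def] m(1)] unfolding sum_index by (simp add: z)
    have alt: "0 < Poly_Mapping.lookup m 2 \<or> 0 < Poly_Mapping.lookup m 3 \<or> 0 < Poly_Mapping.lookup m 4 \<or> 0 < Poly_Mapping.lookup m 5"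
    proof (rule ccontr)
      assume neg: "\<not> ?thesis"
      then have "\<forall>j. j \<noteq> 6 \<longrightarrow> Poly_Mapping.lookup m j = 0" unfolding all_index using z by simp
      moreover have "Poly_Mapping.lookup m 6 = 3" using neg wt by simp
      ultimately have "m = Poly_Mapping.single 6 3" by (rule monomial_eq_single)
      then show False using m(2) by contradiction
    qed
    \<comment> \<open>Integrality matters: with real exponents, c5^(18/5) would exceed the leading
      weight 180.\<close>
    have "Poly_Mapping.lookup m 5 < 4" using wt by linarith
    then have "Poly_Mapping.lookup m 5 + Poly_Mapping.lookup m 6 < 4" using wt by linarith
    then have "51 * Poly_Mapping.lookup m 5 + 60 * Poly_Mapping.lookup m 6 < 180"
      using alt wt by (elim disjE) linarith+
    then show "weight lead_weight m < lead_weight 6 * 3" unfolding lw by simp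
  qed auto
  show "\<exists>L. Poly_Mapping.single (Poly_Mapping.single 5 6) 1 + L = const (inverse (- 14907200 / 9)) * u10
    \<and> (\<forall>m\<in>Poly_Mapping.keys L. weight lead_weight m < lead_weight 5 * 6)"
  proof (rule pure_power_leads[OF isobaric_u(2) _ _ eval_u_axis(2)])
    fix m assume m: "m \<in> Poly_Mapping.keys u10" "m \<noteq> Poly_Mapping.single 5 6"
    have z: "Poly_Mapping.lookup m 0 = 0" "Poly_Mapping.lookup m 1 = 0"
      using bspec[OF isobaric_u(4)[of 0, unfolded isobaric_def] m(1)] bspec[OF isobaric_u(4)[of 1, unfolded isobaric_def] m(1)]
      unfolding sum_index by simp_all
    have wt: "2 * Poly_Mapping.lookup m 2 + 3 * Poly_Mapping.lookup m 3 + 4 * Poly_Mapping.lookup m 4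
        + 5 * Poly_Mapping.lookup m 5 + 6 * Poly_Mapping.lookup m 6 = 30"
      using bspec[OF isobaric_u(2)[unfolded isobaric_def] m(1)] unfolding sum_index by (simp add: z)
    have alt: "0 < Poly_Mapping.lookup m 2 \<or> 0 < Poly_Mapping.lookup m 3 \<or> 0 < Poly_Mapping.lookup m 4 \<or> 0 < Poly_Mapping.lookup m 6"
    proof (rule ccontr)
      assume neg: "\<not> ?thesis"
      then have "\<forall>j. j \<noteq> 5 \<longrightarrow> Poly_Mapping.lookup m j = 0" unfolding all_index using z by simp
      moreover have "Poly_Mapping.lookup m 5 = 6" using neg wt by simp
      ultimately have "m = Poly_Mapping.single 5 6" by (rule monomial_eq_single)
      then show False using m(2) by contradiction
    qed
    \<comment> \<open>With exponents b of c5 and c of c6, 5 b + 6 c <= 30 yields 51 b + 60 c <= 306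
      - 6 c / 5. The bound is strict if c > 0 or if another coordinate takes part of the
      weight.\<close>
    then have "51 * Poly_Mapping.lookup m 5 + 60 * Poly_Mapping.lookup m 6 < 306"
      using wt by (elim disjE) linarith+
    then show "weight lead_weight m < lead_weight 5 * 6" unfolding lw by simp
  qed auto
qed

lemma division_by_u:
  "\<exists>A B r. F = A * u6 + B * u10 + r \<and> (\<forall>m\<in>Poly_Mapping.keys r. Poly_Mapping.lookup m 6 < 3 \<and> Poly_Mapping.lookup m 5 < 6)"
proof -
  let ?I = "{f. \<exists>A B. f = A * u6 + B * u10}"
  have "\<exists>r. F - r \<in> ?I \<and> (\<forall>m\<in>Poly_Mapping.keys r. \<forall>(k, e)\<in>{(6, 3), (5, 6)}. Poly_Mapping.lookup m k < e)"
  proof (rule multivariate_division[where w = lead_weight])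
    show "0 \<in> ?I" by (intro CollectI exI[of _ 0]) simp
  next
    fix f g assume "f \<in> ?I" "g \<in> ?I"
    then obtain A B C D where "f = A * u6 + B * u10" "g = C * u6 + D * u10" by blast
    then show "f + g \<in> ?I" by (intro CollectI exI[of _ "A + C"] exI[of _ "B + D"]) (simp add: algebra_simps)
  next
    fix f g assume "g \<in> ?I"
    then obtain A B where "g = A * u6 + B * u10" by blast
    then show "f * g \<in> ?I" by (intro CollectI exI[of _ "f * A"] exI[of _ "f * B"]) (simp add: algebra_simps)
  next
    fix k :: 7 and e :: nat assume ke: "(k, e) \<in> {(6, 3), (5, 6)}"
    have I: "c * u6 \<in> ?I" "c * u10 \<in> ?I" for c
      by (intro CollectI exI[of _ c] exI[of _ 0]; simp)+
    show "\<exists>L. Poly_Mapping.single (Poly_Mapping.single k e) 1 + L \<in> ?I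
        \<and> (\<forall>m\<in>Poly_Mapping.keys L. weight lead_weight m < lead_weight k * e)"
    proof (cases "k = 6")
      case True
      obtain L where L: "Poly_Mapping.single (Poly_Mapping.single 6 3) 1 + L = const (inverse (- 3332 / 3)) * u6"
        "\<forall>m\<in>Poly_Mapping.keys L. weight lead_weight m < lead_weight 6 * 3"
        using u_leads(1) by blast
      have "e = 3" using ke True by auto
      show ?thesis
      proof (intro exI conjI)
        show "Poly_Mapping.single (Poly_Mapping.single k e) 1 + L \<in> ?I"
          unfolding True \<open>e = 3\<close> L(1) by (rule I(1))
        show "\<forall>m\<in>Poly_Mapping.keys L. weight lead_weight m < lead_weight k * e"
          unfolding True \<open>e = 3\<close> by (rule L(2))
      qed
    next
      case False
      obtain L where L: "Poly_Mapping.single (Poly_Mapping.single 5 6) 1 + L = const (inverse (- 14907200 / 9)) * u10"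
        "\<forall>m\<in>Poly_Mapping.keys L. weight lead_weight m < lead_weight 5 * 6"
        using u_leads(2) by blast
      have "k = 5" "e = 6" using ke False by auto
      show ?thesis
      proof (intro exI conjI)
        show "Poly_Mapping.single (Poly_Mapping.single k e) 1 + L \<in> ?I"
          unfolding \<open>k = 5\<close> \<open>e = 6\<close> L(1) by (rule I(2))
        show "\<forall>m\<in>Poly_Mapping.keys L. weight lead_weight m < lead_weight k * e"
          unfolding \<open>k = 5\<close> \<open>e = 6\<close> by (rule L(2))
      qed
    qed
  qed
  then obtain r A B where "F - r = A * u6 + B * u10" "\<forall>m\<in>Poly_Mapping.keys r. Poly_Mapping.lookup m 6 < 3 \<and> Poly_Mapping.lookup m 5 < 6"
    by auto
  then show ?thesis
    by (intro exI[of _ A] exI[of _ B] exI[of _ r]) (simp add: algebra_simps)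
qed

section \<open>The ricochet family in centred coordinates\<close>

text \<open>The coefficients of the form \<open>(x\<^sup>4 + 4 p x\<^sup>3 + 6 x\<^sup>2 + 4 p x + 1) (x\<^sup>2 - s x + q)\<close>
  after translating away the fifth power. The first factor is a combination of \<open>(x - 1)\<^sup>4\<close> and \<open>(x + 1)\<^sup>4\<close>;
  the ricochet condition on the second factor is \<open>s\<^sup>2 = 6 q - q\<^sup>2 - 1\<close>.\<close>

definition d2 :: "complex \<Rightarrow> complex \<Rightarrow> complex \<Rightarrow> complex" where
  "d2 p s q = (-20/3) * p ^ 2 + (-2/3) * p * s + (-5/12) * s ^ 2 + (1) * q + (6)"

definition d3 :: "complex \<Rightarrow> complex \<Rightarrow> complex \<Rightarrow> complex" where
  "d3 p s q = (320/27) * p ^ 3 + (16/9) * p ^ 2 * s + (-4/9) * p * s ^ 2 + (4/3) * p * q + (-12) * p + (-5/27) * s ^ 3 + (2/3) * s * q + (-2) * s"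

definition d4 :: "complex \<Rightarrow> complex \<Rightarrow> complex \<Rightarrow> complex" where
  "d4 p s q = (-80/9) * p ^ 4 + (-16/9) * p ^ 3 * s + (2) * p ^ 2 * s ^ 2 + (-16/3) * p ^ 2 * q + (8) * p ^ 2 + (-1/9) * p * s ^ 3 + (2/3) * p * s * q + (2) * p * s + (-5/144) * s ^ 4 + (1/6) * s ^ 2 * q + (-2) * s ^ 2 + (6) * q + (1)"

definition d5 :: "complex \<Rightarrow> complex \<Rightarrow> complex \<Rightarrow> complex" where
  "d5 p s q = (256/81) * p ^ 5 + (64/81) * p ^ 4 * s + (-128/81) * p ^ 3 * s ^ 2 + (112/27) * p ^ 3 * q + (-16/9) * p ^ 3 + (32/81) * p ^ 2 * s ^ 3 + (-16/9) * p ^ 2 * s * q + (-1/81) * p * s ^ 4 + (1/9) * p * s ^ 2 * q + (5/3) * p * s ^ 2 + (-4) * p * q + (-4/3) * p + (-1/324) * s ^ 5 + (1/54) * s ^ 3 * q + (-7/18) * s ^ 3 + (2) * s * q + (-2/3) * s"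

definition d6 :: "complex \<Rightarrow> complex \<Rightarrow> complex \<Rightarrow> complex" where
  "d6 p s q = (-320/729) * p ^ 6 + (-32/243) * p ^ 5 * s + (92/243) * p ^ 4 * s ^ 2 + (-80/81) * p ^ 4 * q + (-116/729) * p ^ 3 * s ^ 3 + (56/81) * p ^ 3 * s * q + (-8/27) * p ^ 3 * s + (23/972) * p ^ 2 * s ^ 4 + (-4/27) * p ^ 2 * s ^ 2 * q + (-2/9) * p ^ 2 * s ^ 2 + (4/9) * p ^ 2 + (-1/1944) * p * s ^ 5 + (1/162) * p * s ^ 3 * q + (1/6) * p * s ^ 3 + (-2/3) * p * s * q + (4/9) * p * s + (-5/46656) * s ^ 6 + (1/1296) * s ^ 4 * q + (-5/216) * s ^ 4 + (1/6) * s ^ 2 * q + (-5/36) * s ^ 2 + (1) * q"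

text \<open>The product of quartic and quadric has fifth-power coefficient 4 p - s, which
  translation by (4 p - s)/6 removes; \<open>\<alpha>\<close> is a scalar and \<open>e\<close> a
  torus parameter.\<close>

lemma form_at_depressed:
  "form_at (vec7 \<alpha> 0 (\<alpha> * (e ^ 2 * d2 p s q)) (\<alpha> * (e ^ 3 * d3 p s q)) (\<alpha> * (e ^ 4 * d4 p s q)) (\<alpha> * (e ^ 5 * d5 p s q)) (\<alpha> * (e ^ 6 * d6 p s q))) x y
    = \<alpha> * (((x - e * ((4 * p - s) / 6) * y) ^ 4 + 4 * p * (x - e * ((4 * p - s) / 6) * y) ^ 3 * (e * y)
        + 6 * (x - e * ((4 * p - s) / 6) * y) ^ 2 * (e * y) ^ 2 + 4 * p * (x - e * ((4 * p - s) / 6) * y) * (e * y) ^ 3 + (e * y) ^ 4)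
      * ((x - e * ((4 * p - s) / 6) * y) ^ 2 - s * (x - e * ((4 * p - s) / 6) * y) * (e * y) + q * (e * y) ^ 2))"
proof -
  have "x ^ 6 + d2 p s q * x ^ 4 * u ^ 2 + d3 p s q * x ^ 3 * u ^ 3 + d4 p s q * x ^ 2 * u ^ 4 + d5 p s q * x * u ^ 5
      + d6 p s q * u ^ 6 = (((x - ((4 * p - s) / 6) * u) ^ 4 + 4 * p * (x - ((4 * p - s) / 6) * u) ^ 3 * u
        + 6 * (x - ((4 * p - s) / 6) * u) ^ 2 * u ^ 2 + 4 * p * (x - ((4 * p - s) / 6) * u) * u ^ 3 + u ^ 4)
      * ((x - ((4 * p - s) / 6) * u) ^ 2 - s * (x - ((4 * p - s) / 6) * u) * u + q * u ^ 2))" for u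
    unfolding d2_def d3_def d4_def d5_def d6_def by algebra
  note id = this[of "e * y"]
  have h: "e * ((4 * p - s) / 6) * y = ((4 * p - s) / 6) * (e * y)" by simp
  show ?thesis
    unfolding h id[symmetric] form_at_def vec7_nth by algebra
qed

text \<open>With L = X - Y and M = X + Y the quartic is a multiple of L^4 - \<kappa>^4 M^4, and the
  relation between s and q makes the quadric a multiple of (L - z M)(L - i z M). The coordinate i (L
  - \<kappa> M)/(L + \<kappa> M) carries the roots of the former to 0, infinity, 1, -1 and those of
  the latter to t and (t-1)/(t+1). The conditions on p, q and z exclude coincidences.\<close>

lemma ricochet_vector_family:
  assumes s: "s ^ 2 = 6 * q - q ^ 2 - 1" and q: "q \<noteq> 1" and p: "p \<noteq> 1" "p \<noteq> - 1"
    and zp: "((q + 1 - s) / ((q - 1) * (1 + \<i>))) ^ 4 * (p - 1) \<noteq> 1 + p" and "\<alpha> \<noteq> 0" "e \<noteq> 0"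
  shows "ricochet_vector (shift \<rho> (vec7 \<alpha> 0 (\<alpha> * (e ^ 2 * d2 p s q)) (\<alpha> * (e ^ 3 * d3 p s q)) (\<alpha> * (e ^ 4 * d4 p s q)) (\<alpha> * (e ^ 5 * d5 p s q)) (\<alpha> * (e ^ 6 * d6 p s q))))"
proof -
  define n r where "n = q + 1 - s" and "r = q - 1"
  define z where "z = n / (r * (1 + \<i>))"
  define \<kappa> where "\<kappa> = csqrt (csqrt ((1 + p) / (p - 1)))"
  have "(\<kappa> ^ 2) ^ 2 = (1 + p) / (p - 1)" by (simp add: \<kappa>_def)
  then have \<kappa>4: "\<kappa> ^ 4 = (1 + p) / (p - 1)" by (simp flip: power_mult)
  have "1 + p \<noteq> 0" "p - 1 \<noteq> 0" using p by (auto simp: add_eq_0_iff)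
  then have \<kappa>p: "\<kappa> ^ 4 * (p - 1) = 1 + p" and "\<kappa> \<noteq> 0" using \<kappa>4 by (simp, auto)
  have ii: "\<i> ^ 2 = - 1" by simp
  have i1: "1 + \<i> \<noteq> 0" by (simp add: complex_eq_iff)
  have r: "r \<noteq> 0" using q by (simp add: r_def)
  \<comment> \<open>On the conic (q+1)^2 - s^2 = 2 (q-1)^2, so \<open>n\<close> can vanish only
    together with \<open>r\<close>.\<close>
  have "n * (q + 1 + s) = 2 * r ^ 2" using s unfolding n_def r_def by algebra
  then have n: "n \<noteq> 0" using r by auto
  have z: "(1 + \<i>) * z * r = n" using r i1 by (simp add: z_def)
  have "z \<noteq> 0" using n z by auto
  have z4: "z ^ 4 \<noteq> \<kappa> ^ 4"
  proof
    assume "z ^ 4 = \<kappa> ^ 4"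
    then have "z ^ 4 * (p - 1) = 1 + p" using \<kappa>p by simp
    then show False using zp unfolding z_def n_def r_def by contradiction
  qed
  have ne: "z \<noteq> \<kappa>" "z \<noteq> - \<kappa>" "z \<noteq> \<i> * \<kappa>" "z \<noteq> - \<i> * \<kappa>"
    using z4 by (auto simp: power_mult_distrib)
  have zk: "z + \<kappa> \<noteq> 0" using ne(2) by (simp add: eq_neg_iff_add_eq_0)
  \<comment> \<open>The value of the new coordinate at L/M = z.\<close>
  define t where "t = \<i> * (z - \<kappa>) / (z + \<kappa>)"
  have t: "t * (z + \<kappa>) = \<i> * (z - \<kappa>)" using zk by (simp add: t_def)
  have "t \<noteq> 0" using t ne(1) by auto
  have "t \<noteq> 1"
  proof
    assume "t = 1"
    then have "z + \<kappa> = \<i> * (z - \<kappa>)" using t by simp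
    then have "(1 + \<i>) * (z + \<i> * \<kappa>) = 0" using ii by algebra
    then have "z + \<i> * \<kappa> = 0" using i1 by simp
    then show False using ne(4) by (simp add: eq_neg_iff_add_eq_0)
  qed
  have "t \<noteq> - 1"
  proof
    assume "t = - 1"
    then have "- (z + \<kappa>) = \<i> * (z - \<kappa>)" using t by simp
    then have "(1 + \<i>) * (z - \<i> * \<kappa>) = 0" using ii by algebra
    then have "z - \<i> * \<kappa> = 0" using i1 by simp
    then show False using ne(3) by simp
  qed
  have "t ^ 2 \<noteq> - 1"
  proof
    assume t1: "t ^ 2 = - 1"
    have "(t * (z + \<kappa>)) ^ 2 = (\<i> * (z - \<kappa>)) ^ 2" using t by simp
    then have "- 1 * (z + \<kappa>) ^ 2 = - 1 * (z - \<kappa>) ^ 2"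
      unfolding power_mult_distrib t1 ii .
    then have "4 * (z * \<kappa>) = 0" by algebra
    then show False using \<open>z \<noteq> 0\<close> \<open>\<kappa> \<noteq> 0\<close> by simp
  qed
  define l m where "l = \<rho> - e * ((4 * p - s) / 6) - e" and "m = \<rho> - e * ((4 * p - s) / 6) + e"
  \<comment> \<open>Read off from the comparison \<open>eq\<close> at the end of the proof.\<close>
  define \<gamma> where "\<gamma> = \<alpha> * (1 - p) * r ^ 2 * (z + \<kappa>) ^ 2 / (32 * n * (1 + \<i>) * \<kappa> ^ 2)"
  have "\<gamma> \<noteq> 0"
    using \<open>\<alpha> \<noteq> 0\<close> p r n zk i1 \<open>\<kappa> \<noteq> 0\<close> by (simp add: \<gamma>_def)
  have "(\<i> * (1 - \<kappa>)) * (l + \<kappa> * m) - (\<i> * (l - \<kappa> * m)) * (1 + \<kappa>) = 4 * \<i> * \<kappa> * e"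
    unfolding l_def m_def by algebra
  then have det: "(\<i> * (1 - \<kappa>)) * (l + \<kappa> * m) - (\<i> * (l - \<kappa> * m)) * (1 + \<kappa>) \<noteq> 0"
    using \<open>\<kappa> \<noteq> 0\<close> \<open>e \<noteq> 0\<close> by simp
  have "form_at (shift \<rho> (vec7 \<alpha> 0 (\<alpha> * (e ^ 2 * d2 p s q)) (\<alpha> * (e ^ 3 * d3 p s q)) (\<alpha> * (e ^ 4 * d4 p s q)) (\<alpha> * (e ^ 5 * d5 p s q)) (\<alpha> * (e ^ 6 * d6 p s q)))) x y = \<gamma> * ricochet_form t (\<i> * (1 - \<kappa>) * x + \<i> * (l - \<kappa> * m) * y) ((1 + \<kappa>) * x + (l + \<kappa> * m) * y)" for x y
  proof -
    define X Y where "X = x + \<rho> * y - e * ((4 * p - s) / 6) * y" and "Y = e * y"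
    define L M where "L = x + l * y" and "M = x + m * y"
    have LM: "L = X - Y" "M = X + Y" unfolding L_def M_def X_def Y_def l_def m_def by algebra+
    have form: "form_at (shift \<rho> (vec7 \<alpha> 0 (\<alpha> * (e ^ 2 * d2 p s q)) (\<alpha> * (e ^ 3 * d3 p s q)) (\<alpha> * (e ^ 4 * d4 p s q)) (\<alpha> * (e ^ 5 * d5 p s q)) (\<alpha> * (e ^ 6 * d6 p s q)))) x y
        = \<alpha> * ((X ^ 4 + 4 * p * X ^ 3 * Y + 6 * X ^ 2 * Y ^ 2 + 4 * p * X * Y ^ 3 + Y ^ 4) * (X ^ 2 - s * X * Y + q * Y ^ 2))"
      unfolding form_at_shift form_at_depressed X_def Y_def ..
    have quartic: "2 * (X ^ 4 + 4 * p * X ^ 3 * Y + 6 * X ^ 2 * Y ^ 2 + 4 * p * X * Y ^ 3 + Y ^ 4) = (1 - p) * (L ^ 4 - \<kappa> ^ 4 * M ^ 4)"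
    proof -
      have "2 * (X ^ 4 + 4 * p * X ^ 3 * Y + 6 * X ^ 2 * Y ^ 2 + 4 * p * X * Y ^ 3 + Y ^ 4) = (1 - p) * L ^ 4 + (1 + p) * M ^ 4"
        unfolding LM by algebra
      also have "\<dots> = (1 - p) * (L ^ 4 - \<kappa> ^ 4 * M ^ 4)" unfolding \<kappa>p[symmetric] by algebra
      finally show ?thesis .
    qed
    have quadric: "4 * n * (X ^ 2 - s * X * Y + q * Y ^ 2) = 2 * r ^ 2 * ((L - z * M) * (L - \<i> * z * M))"
    proof -
      have "4 * n * (X ^ 2 - s * X * Y + q * Y ^ 2) = 2 * r ^ 2 * L ^ 2 - 2 * r * n * L * M + n ^ 2 * M ^ 2"
        unfolding LM n_def r_def using s by algebra
      also have "\<dots> = 2 * r ^ 2 * ((L - z * M) * (L - \<i> * z * M))"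
        unfolding z[symmetric] using ii by algebra
      finally show ?thesis .
    qed
    define X' Y' where "X' = \<i> * (L - \<kappa> * M)" and "Y' = L + \<kappa> * M"
    have XY': "\<i> * (1 - \<kappa>) * x + \<i> * (l - \<kappa> * m) * y = X'" "(1 + \<kappa>) * x + (l + \<kappa> * m) * y = Y'"
      unfolding X'_def Y'_def L_def M_def by algebra+
    have f1: "X' * Y' * (X' ^ 2 - Y' ^ 2) = - 2 * \<i> * (L ^ 4 - \<kappa> ^ 4 * M ^ 4)"
      unfolding X'_def Y'_def using ii by algebra
    have f2: "(z + \<kappa>) * (X' - t * Y') = 2 * \<i> * \<kappa> * (L - z * M)"
    proof -
      have "(z + \<kappa>) * (X' - t * Y') = (z + \<kappa>) * X' - t * (z + \<kappa>) * Y'" by algebra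
      also have "\<dots> = 2 * \<i> * \<kappa> * (L - z * M)" unfolding t X'_def Y'_def by algebra
      finally show ?thesis .
    qed
    have f3: "(z + \<kappa>) * ((t + 1) * X' - (t - 1) * Y') = 2 * \<kappa> * (1 + \<i>) * (L - \<i> * z * M)"
    proof -
      have "(z + \<kappa>) * ((t + 1) * X' - (t - 1) * Y') = (t * (z + \<kappa>) + (z + \<kappa>)) * X' - (t * (z + \<kappa>) - (z + \<kappa>)) * Y'" by algebra
      also have "\<dots> = 2 * \<kappa> * (1 + \<i>) * (L - \<i> * z * M)" unfolding t X'_def Y'_def using ii by algebra
      finally show ?thesis .
    qed
    have "(z + \<kappa>) ^ 2 * ricochet_form t X' Y'
        = (X' * Y' * (X' ^ 2 - Y' ^ 2)) * ((z + \<kappa>) * (X' - t * Y')) * ((z + \<kappa>) * ((t + 1) * X' - (t - 1) * Y'))"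
      unfolding ricochet_form_def by algebra
    also have "\<dots> = 8 * (1 + \<i>) * \<kappa> ^ 2 * ((L ^ 4 - \<kappa> ^ 4 * M ^ 4) * ((L - z * M) * (L - \<i> * z * M)))"
      unfolding f1 f2 f3 using ii by algebra
    finally have ric: "(z + \<kappa>) ^ 2 * ricochet_form t X' Y'
        = 8 * (1 + \<i>) * \<kappa> ^ 2 * ((L ^ 4 - \<kappa> ^ 4 * M ^ 4) * ((L - z * M) * (L - \<i> * z * M)))" .
    have "8 * n * form_at (shift \<rho> (vec7 \<alpha> 0 (\<alpha> * (e ^ 2 * d2 p s q)) (\<alpha> * (e ^ 3 * d3 p s q)) (\<alpha> * (e ^ 4 * d4 p s q)) (\<alpha> * (e ^ 5 * d5 p s q)) (\<alpha> * (e ^ 6 * d6 p s q)))) x y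
        = \<alpha> * ((1 - p) * (L ^ 4 - \<kappa> ^ 4 * M ^ 4)) * (2 * r ^ 2 * ((L - z * M) * (L - \<i> * z * M)))"
      unfolding form quartic[symmetric] quadric[symmetric] by algebra
    then have "(32 * n * (1 + \<i>) * \<kappa> ^ 2) * form_at (shift \<rho> (vec7 \<alpha> 0 (\<alpha> * (e ^ 2 * d2 p s q)) (\<alpha> * (e ^ 3 * d3 p s q)) (\<alpha> * (e ^ 4 * d4 p s q)) (\<alpha> * (e ^ 5 * d5 p s q)) (\<alpha> * (e ^ 6 * d6 p s q)))) x y
        = \<alpha> * (1 - p) * r ^ 2 * (8 * (1 + \<i>) * \<kappa> ^ 2 * ((L ^ 4 - \<kappa> ^ 4 * M ^ 4) * ((L - z * M) * (L - \<i> * z * M))))"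
      by algebra
    also have "\<dots> = (\<alpha> * (1 - p) * r ^ 2 * (z + \<kappa>) ^ 2) * ricochet_form t X' Y'"
      unfolding ric[symmetric] by algebra
    finally have eq: "(32 * n * (1 + \<i>) * \<kappa> ^ 2) * form_at (shift \<rho> (vec7 \<alpha> 0 (\<alpha> * (e ^ 2 * d2 p s q)) (\<alpha> * (e ^ 3 * d3 p s q)) (\<alpha> * (e ^ 4 * d4 p s q)) (\<alpha> * (e ^ 5 * d5 p s q)) (\<alpha> * (e ^ 6 * d6 p s q)))) x y
        = (\<alpha> * (1 - p) * r ^ 2 * (z + \<kappa>) ^ 2) * ricochet_form t X' Y'" .
    have div: "F = N / c * R" if "c * F = N * R" "c \<noteq> 0" for c F N R :: complex
      using that by (simp add: field_simps)
    have "32 * n * (1 + \<i>) * \<kappa> ^ 2 \<noteq> 0" using n i1 \<open>\<kappa> \<noteq> 0\<close> by simp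
    then show ?thesis
      unfolding XY' \<gamma>_def by (rule div[OF eq])
  qed
  then show ?thesis
    unfolding ricochet_vector_def
    using \<open>\<gamma> \<noteq> 0\<close> det \<open>t \<noteq> 0\<close> \<open>t \<noteq> 1\<close> \<open>t \<noteq> - 1\<close> \<open>t ^ 2 \<noteq> - 1\<close> by blast
qed

lemma zero_off_finite:
  fixes F :: "complex \<Rightarrow> complex"
  assumes "isCont F a" "finite A" "\<And>x. x \<notin> A \<Longrightarrow> F x = 0"
  shows "F a = 0"
proof -
  have "\<forall>\<^sub>F x in at a. x \<notin> A"
    using \<open>finite A\<close> by (metis islimpt_finite islimpt_iff_eventually)
  then have "\<forall>\<^sub>F x in at a. F x = 0"
    by (rule eventually_mono) (rule assms(3))
  then have "(F \<longlongrightarrow> 0) (at a)" by (rule tendsto_eventually)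
  moreover have "(F \<longlongrightarrow> F a) (at a)" using assms(1) unfolding isCont_def .
  ultimately show ?thesis by (intro tendsto_unique[of "at a"]) simp_all
qed

lemma isCont_eval:
  assumes "\<And>k. isCont (\<lambda>x. V x $ k) a"
  shows "isCont (\<lambda>x. eval (V x) f) (a :: complex)"
proof -
  have "isCont (\<lambda>x. (V x $ k) ^ n) a" for k n
    by (intro continuous_power assms)
  then show ?thesis
    unfolding eval_def by (intro continuous_sum continuous_mult continuous_const continuous_prod)
qed

text \<open>For fixed s and q only finitely many p give degenerate configurations, and continuity in
  p fills these in.\<close>

lemma vanishes_on_family:
  assumes van: "\<And>v. ricochet_vector v \<Longrightarrow> eval v f = 0"
    and s: "s ^ 2 = 6 * q - q ^ 2 - 1" and q: "q \<noteq> 1" and "\<alpha> \<noteq> 0" "e \<noteq> 0"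
  shows "eval (shift \<rho> (vec7 \<alpha> 0 (\<alpha> * (e ^ 2 * d2 p s q)) (\<alpha> * (e ^ 3 * d3 p s q)) (\<alpha> * (e ^ 4 * d4 p s q)) (\<alpha> * (e ^ 5 * d5 p s q)) (\<alpha> * (e ^ 6 * d6 p s q)))) f = 0"
proof -
  define w where "w = ((q + 1 - s) / ((q - 1) * (1 + \<i>))) ^ 4"
  let ?A = "{1, - 1, (1 + w) / (w - 1)}"
  let ?V = "\<lambda>p. shift \<rho> (vec7 \<alpha> 0 (\<alpha> * (e ^ 2 * d2 p s q)) (\<alpha> * (e ^ 3 * d3 p s q)) (\<alpha> * (e ^ 4 * d4 p s q)) (\<alpha> * (e ^ 5 * d5 p s q)) (\<alpha> * (e ^ 6 * d6 p s q)))"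
  show ?thesis
  proof (rule zero_off_finite[where F = "\<lambda>p. eval (?V p) f" and a = p and A = ?A])
    have "\<forall>k. isCont (\<lambda>p. ?V p $ k) p"
      unfolding all_index shift_def vec7_nth d2_def d3_def d4_def d5_def d6_def
      by (intro conjI continuous_intros)
    then show "isCont (\<lambda>p. eval (?V p) f) p" by (intro isCont_eval) blast
  next
    fix p assume p: "p \<notin> ?A"
    have "w * (p - 1) \<noteq> 1 + p"
    proof
      assume eq: "w * (p - 1) = 1 + p"
      then have wp: "p * (w - 1) = 1 + w" by (simp add: algebra_simps)
      have "w \<noteq> 1" using wp by auto
      then have "p = (1 + w) / (w - 1)" using wp by (simp add: eq_divide_eq)
      then show False using p by blast
    qed
    then show "eval (?V p) f = 0"
      using p \<open>\<alpha> \<noteq> 0\<close> \<open>e \<noteq> 0\<close> unfolding w_def by (intro van ricochet_vector_family[OF s q]) auto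
  qed simp
qed

text \<open>Translation affects centred coordinate 1 alone, which records it as 6 \<rho>
  \<alpha>.\<close>

lemma eval_centred_shift:
  "(\<chi> k. eval (shift \<rho> (vec7 \<alpha> 0 c2 c3 c4 c5 c6)) (centred k))
    = vec7 \<alpha> (6 * \<rho> * \<alpha>) (\<alpha> * c2) (\<alpha> ^ 2 * c3) (\<alpha> ^ 3 * c4) (\<alpha> ^ 4 * c5) (\<alpha> ^ 5 * c6)"
  by (rule vec7_eqI;
    (simp only: vec_lambda_beta centred eval_simps eval_coord eval_const shift_def vec7_nth, algebra?))

text \<open>The torus parameter e/\<alpha> cancels the powers of \<alpha>, as \<alpha>^(k-1) *
  \<alpha> * (e/\<alpha>)^k = e^k, and \<rho> = \<beta>/(6 \<alpha>) makes coordinate 1 arbitrary.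
  So \<alpha>, \<beta> and e vary independently.\<close>

lemma vanishes_in_centred_coordinates:
  assumes van: "\<And>v. ricochet_vector v \<Longrightarrow> eval v (substitute const centred r) = 0"
    and s: "s ^ 2 = 6 * q - q ^ 2 - 1" and q: "q \<noteq> 1" and "\<alpha> \<noteq> 0" "e \<noteq> 0"
  shows "eval (vec7 \<alpha> \<beta> (e ^ 2 * d2 p s q) (e ^ 3 * d3 p s q) (e ^ 4 * d4 p s q) (e ^ 5 * d5 p s q) (e ^ 6 * d6 p s q)) r = 0"
proof -
  have "e / \<alpha> \<noteq> 0" using \<open>\<alpha> \<noteq> 0\<close> \<open>e \<noteq> 0\<close> by simp
  from vanishes_on_family[OF van s q \<open>\<alpha> \<noteq> 0\<close> this, of "\<beta> / (6 * \<alpha>)" p]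
  have "eval (vec7 \<alpha> (6 * (\<beta> / (6 * \<alpha>)) * \<alpha>) (\<alpha> * (\<alpha> * ((e / \<alpha>) ^ 2 * d2 p s q))) (\<alpha> ^ 2 * (\<alpha> * ((e / \<alpha>) ^ 3 * d3 p s q)))
      (\<alpha> ^ 3 * (\<alpha> * ((e / \<alpha>) ^ 4 * d4 p s q))) (\<alpha> ^ 4 * (\<alpha> * ((e / \<alpha>) ^ 5 * d5 p s q))) (\<alpha> ^ 5 * (\<alpha> * ((e / \<alpha>) ^ 6 * d6 p s q)))) r = 0"
    unfolding eval_substitute eval_centred_shift .
  moreover have "vec7 \<alpha> (6 * (\<beta> / (6 * \<alpha>)) * \<alpha>) (\<alpha> * (\<alpha> * ((e / \<alpha>) ^ 2 * d2 p s q))) (\<alpha> ^ 2 * (\<alpha> * ((e / \<alpha>) ^ 3 * d3 p s q)))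
      (\<alpha> ^ 3 * (\<alpha> * ((e / \<alpha>) ^ 4 * d4 p s q))) (\<alpha> ^ 4 * (\<alpha> * ((e / \<alpha>) ^ 5 * d5 p s q))) (\<alpha> ^ 5 * (\<alpha> * ((e / \<alpha>) ^ 6 * d6 p s q)))
      = vec7 \<alpha> \<beta> (e ^ 2 * d2 p s q) (e ^ 3 * d3 p s q) (e ^ 4 * d4 p s q) (e ^ 5 * d5 p s q) (e ^ 6 * d6 p s q)"
    using \<open>\<alpha> \<noteq> 0\<close> by (intro vec7_eqI) (simp_all add: power_divide eval_nat_numeral)
  ultimately show ?thesis by (simp only:)
qed

text \<open>Comparing coefficients of e, \<beta> and \<alpha> in turn isolates the terms with a
  given weight and given exponents of coordinates 1 and 0.\<close>

lemma separate_weights: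
  assumes van: "\<And>v. ricochet_vector v \<Longrightarrow> eval v (substitute const centred r) = 0"
    and s: "s ^ 2 = 6 * q - q ^ 2 - 1" and q: "q \<noteq> 1"
  shows "(\<Sum>m\<in>{m \<in> Poly_Mapping.keys r. Poly_Mapping.lookup m 0 = a \<and> Poly_Mapping.lookup m 1 = b
      \<and> 2 * Poly_Mapping.lookup m 2 + 3 * Poly_Mapping.lookup m 3 + 4 * Poly_Mapping.lookup m 4
        + 5 * Poly_Mapping.lookup m 5 + 6 * Poly_Mapping.lookup m 6 = c}.
    Poly_Mapping.lookup r m * d3 p s q ^ Poly_Mapping.lookup m 3 * d5 p s q ^ Poly_Mapping.lookup m 5
      * d6 p s q ^ Poly_Mapping.lookup m 6 * d4 p s q ^ Poly_Mapping.lookup m 4 * d2 p s q ^ Poly_Mapping.lookup m 2) = 0"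
proof -
  define W where "W m = 2 * Poly_Mapping.lookup m 2 + 3 * Poly_Mapping.lookup m 3 + 4 * Poly_Mapping.lookup m 4
        + 5 * Poly_Mapping.lookup m 5 + 6 * Poly_Mapping.lookup m 6" for m :: "7 \<Rightarrow>\<^sub>0 nat"
  define T where "T m = Poly_Mapping.lookup r m * d3 p s q ^ Poly_Mapping.lookup m 3 * d5 p s q ^ Poly_Mapping.lookup m 5
      * d6 p s q ^ Poly_Mapping.lookup m 6 * d4 p s q ^ Poly_Mapping.lookup m 4 * d2 p s q ^ Poly_Mapping.lookup m 2" for m
  let ?K = "Poly_Mapping.keys r"
  have inf: "infinite (UNIV - {0 :: complex})" by (simp add: infinite_UNIV_char_0)
  have "(\<Sum>m\<in>?K. (T m * \<alpha> ^ Poly_Mapping.lookup m 0 * \<beta> ^ Poly_Mapping.lookup m 1) * e ^ W m) = 0"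
    if "\<alpha> \<noteq> 0" "e \<noteq> 0" for \<alpha> \<beta> e
  proof -
    have "Poly_Mapping.lookup r m * monom_at (($) (vec7 \<alpha> \<beta> (e ^ 2 * d2 p s q) (e ^ 3 * d3 p s q) (e ^ 4 * d4 p s q)
        (e ^ 5 * d5 p s q) (e ^ 6 * d6 p s q))) m
      = (T m * \<alpha> ^ Poly_Mapping.lookup m 0 * \<beta> ^ Poly_Mapping.lookup m 1) * e ^ W m" for m
      unfolding monom_at_def prod_index vec7_nth T_def W_def power_add power_mult power_mult_distrib by (simp only: mult_ac)
    then show ?thesis
      using vanishes_in_centred_coordinates[OF van s q that, of \<beta> p] unfolding eval_as_sum by simp
  qed
  note step1 = this
  have step2: "(\<Sum>m\<in>{m \<in> ?K. W m = c}. T m * \<alpha> ^ Poly_Mapping.lookup m 0 * \<beta> ^ Poly_Mapping.lookup m 1) = 0"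
    if "\<alpha> \<noteq> 0" for \<alpha> \<beta>
    by (rule power_sum_coeffs_vanish[OF finite_keys inf, where d = W
      and g = "\<lambda>m. T m * \<alpha> ^ Poly_Mapping.lookup m 0 * \<beta> ^ Poly_Mapping.lookup m 1"])
      (use step1 that in simp)
  have step3: "(\<Sum>m\<in>{m \<in> {m \<in> ?K. W m = c}. Poly_Mapping.lookup m 1 = b}. T m * \<alpha> ^ Poly_Mapping.lookup m 0) = 0"
    if "\<alpha> \<noteq> 0" for \<alpha>
    by (rule power_sum_coeffs_vanish[OF _ inf, where d = "\<lambda>m. Poly_Mapping.lookup m 1" and M = "{m \<in> ?K. W m = c}"
      and g = "\<lambda>m. T m * \<alpha> ^ Poly_Mapping.lookup m 0"]) (use step2 that in simp_all)
  have "(\<Sum>m\<in>{m \<in> {m \<in> {m \<in> ?K. W m = c}. Poly_Mapping.lookup m 1 = b}. Poly_Mapping.lookup m 0 = a}. T m) = 0"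
    by (rule power_sum_coeffs_vanish[OF _ inf, where d = "\<lambda>m. Poly_Mapping.lookup m 0"
      and M = "{m \<in> {m \<in> ?K. W m = c}. Poly_Mapping.lookup m 1 = b}" and g = T]) (use step3 in simp_all)
  moreover have "{m \<in> {m \<in> {m \<in> ?K. W m = c}. Poly_Mapping.lookup m 1 = b}. Poly_Mapping.lookup m 0 = a}
      = {m \<in> ?K. Poly_Mapping.lookup m 0 = a \<and> Poly_Mapping.lookup m 1 = b \<and> W m = c}" by auto
  ultimately show ?thesis unfolding T_def W_def by (simp only:)
qed

section \<open>Degenerations of a remainder\<close>

text \<open>The distances of the two roots from x0 have product |x0^2 + b x0 + c|, so the nearer
  root satisfies the bound. This stands in for a continuous choice of roots: picking the nearer root
  for each parameter already gives convergence at the one point of interest.\<close>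

lemma root_near:
  fixes b c x0 :: complex
  shows "\<exists>x. x ^ 2 + b * x + c = 0 \<and> cmod (x - x0) ^ 2 \<le> cmod (x0 ^ 2 + b * x0 + c)"
proof -
  obtain r where "r ^ 2 = b ^ 2 - 4 * c" using power2_csqrt by blast
  then have c: "c = 1 / 4 * (b ^ 2 - r ^ 2)" by simp
  obtain x y where x: "x = 1 / 2 * (r - b)" and y: "y = - 1 / 2 * (r + b)" by blast
  have roots: "x ^ 2 + b * x + c = 0" "y ^ 2 + b * y + c = 0"
    unfolding x y c by algebra+
  have "x0 ^ 2 + b * x0 + c = (x - x0) * (y - x0)"
    unfolding x y c by algebra
  then have n: "cmod (x0 ^ 2 + b * x0 + c) = cmod (x - x0) * cmod (y - x0)" by (simp add: norm_mult)
  show ?thesis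
  proof (cases "cmod (x - x0) \<le> cmod (y - x0)")
    case True
    then have "cmod (x - x0) ^ 2 \<le> cmod (x - x0) * cmod (y - x0)"
      unfolding power2_eq_square by (intro mult_left_mono) auto
    then show ?thesis using roots(1) n by auto
  next
    case False
    then have "cmod (y - x0) ^ 2 \<le> cmod (x - x0) * cmod (y - x0)"
      unfolding power2_eq_square by (intro mult_right_mono) auto
    then show ?thesis using roots(2) n by auto
  qed
qed

lemma tendsto_of_square_bound:
  fixes f h :: "complex \<Rightarrow> complex"
  assumes "\<And>q. cmod (f q - l) ^ 2 \<le> cmod (h q)" "(h \<longlongrightarrow> 0) F"
  shows "(f \<longlongrightarrow> l) F"
proof -
  have "((\<lambda>q. cmod (h q)) \<longlongrightarrow> 0) F" using tendsto_norm_zero[OF assms(2)] .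
  then have "((\<lambda>q. cmod (f q - l) ^ 2) \<longlongrightarrow> 0) F"
    by (rule Lim_null_comparison[rotated]) (simp add: assms(1))
  then have "((\<lambda>q. sqrt (cmod (f q - l) ^ 2)) \<longlongrightarrow> sqrt 0) F" by (rule tendsto_real_sqrt)
  then have "((\<lambda>q. cmod (f q - l)) \<longlongrightarrow> 0) F" by (simp only: real_sqrt_abs abs_norm_cancel real_sqrt_zero)
  then have "((\<lambda>q. f q - l) \<longlongrightarrow> 0) F" by (rule tendsto_norm_zero_cancel)
  then show ?thesis by (rule LIM_zero_cancel)
qed

text \<open>Together with \<open>sum_at_zero_power\<close> this extracts lowest terms: x^\<mu> is
  divided out where x is nonzero, and x is then sent to 0.\<close>

lemma divide_out_power:
  fixes x :: complex
  assumes "\<And>m. m \<in> K \<Longrightarrow> \<mu> \<le> d m" "x \<noteq> 0" "(\<Sum>m\<in>K. g m * x ^ d m) = 0"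
  shows "(\<Sum>m\<in>K. g m * x ^ (d m - \<mu>)) = 0"
proof -
  have "x ^ \<mu> * (\<Sum>m\<in>K. g m * x ^ (d m - \<mu>)) = (\<Sum>m\<in>K. g m * x ^ d m)"
    unfolding sum_distrib_left
  proof (rule sum.cong)
    fix m assume "m \<in> K"
    then have "x ^ d m = x ^ \<mu> * x ^ (d m - \<mu>)" using assms(1) by (simp flip: power_add)
    then show "x ^ \<mu> * (g m * x ^ (d m - \<mu>)) = g m * x ^ d m" by simp
  qed simp
  then show ?thesis using assms(2,3) by simp
qed

lemma sum_at_zero_power:
  assumes "finite K" "\<And>m. m \<in> K \<Longrightarrow> \<mu> \<le> d m"
  shows "(\<Sum>m\<in>K. g m * (0 :: complex) ^ (d m - \<mu>)) = (\<Sum>m\<in>{m \<in> K. d m = \<mu>}. g m)"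
proof -
  have "(\<Sum>m\<in>K. g m * (0 :: complex) ^ (d m - \<mu>)) = (\<Sum>m\<in>K. if d m = \<mu> then g m else 0)"
  proof (rule sum.cong)
    fix m assume "m \<in> K"
    then have "\<mu> \<le> d m" by (rule assms(2))
    then show "g m * (0 :: complex) ^ (d m - \<mu>) = (if d m = \<mu> then g m else 0)"
      by (cases "d m = \<mu>") (simp_all add: power_0_left)
  qed simp
  then show ?thesis using assms(1) by (simp add: sum.inter_filter)
qed

text \<open>Under (p, s) -> (-p, -s) d4 and d6 are even, d3 and d5 odd, so d4, d6, d3 s and d5 s are
  polynomials in p^2, y = p s, s^2 and q. On d2 = 0 both squares are eliminated and y obeys a
  quadratic equation over C[q], which leaves u(q) + v(q) y. The last summand in each computation is
  the multiple of that equation removed by the reduction.\<close>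

lemma d_on_surface:
  assumes s: "s ^ 2 = 6 * q - q ^ 2 - 1" and d2: "d2 p s q = 0"
  shows "80 * p ^ 2 = 72 + 12 * q - 5 * (6 * q - q ^ 2 - 1) - 8 * (p * s)"
    "d4 p s q = ((21/50) + (37/10) * q + (-31/10) * q ^ 2 + (71/50) * q ^ 3 + (-1/5) * q ^ 4) + ((38/25) + (-18/25) * q + (8/25) * q ^ 2) * (p * s)"
    "d3 p s q * s = ((56/45) + (-62/9) * q + (-22/9) * q ^ 2 + (86/45) * q ^ 3 + (-2/9) * q ^ 4) + ((-4/45) + (-196/45) * q + (56/45) * q ^ 2) * (p * s)"
    "d5 p s q * s = ((938/1875) + (-7153/1875) * q + (10858/1875) * q ^ 2 + (-6542/1875) * q ^ 3 + (1074/625) * q ^ 4 + (-817/1875) * q ^ 5 + (14/375) * q ^ 6) + ((-472/1875) + (-856/1875) * q + (2144/1875) * q ^ 2 + (-616/1875) * q ^ 3 + (88/1875) * q ^ 4) * (p * s)"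
    "d6 p s q = ((278/16875) + (1631/3750) * q + (-379/5625) * q ^ 2 + (1448/16875) * q ^ 3 + (1/625) * q ^ 4 + (-133/11250) * q ^ 5 + (4/3375) * q ^ 6) + ((856/5625) + (-122/5625) * q + (92/625) * q ^ 2 + (-322/5625) * q ^ 3 + (56/5625) * q ^ 4) * (p * s)"
proof -
  have "80 * p ^ 2 = 72 + 12 * q - 5 * s ^ 2 - 8 * (p * s) - 12 * d2 p s q" unfolding d2_def by algebra
  then show p2: "80 * p ^ 2 = 72 + 12 * q - 5 * (6 * q - q ^ 2 - 1) - 8 * (p * s)"
    unfolding s d2 by simp
  define P where "P = p ^ 2"
  define y where "y = p * s"
  define S where "S = 6 * q - q ^ 2 - 1"
  have p2': "72 + 12 * q - 5 * S - 8 * y = 80 * P" using p2 unfolding P_def y_def S_def by (rule sym)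
  have P: "P = (72 + 12 * q - 5 * S - 8 * y) / 80" unfolding p2' by simp
  have yy: "y * y = P * S" unfolding y_def P_def S_def s[symmetric] by algebra
  have sS: "s ^ 2 = S" using s S_def by simp
  have y2: "80 * y ^ 2 = S * (72 + 12 * q - 5 * S - 8 * y)" unfolding p2' power2_eq_square yy by simp
  then have y0: "80 * y ^ 2 - S * (72 + 12 * q - 5 * S - 8 * y) = 0" by simp
  show "d4 p s q = ((21/50) + (37/10) * q + (-31/10) * q ^ 2 + (71/50) * q ^ 3 + (-1/5) * q ^ 4) + ((38/25) + (-18/25) * q + (8/25) * q ^ 2) * (p * s)"
  proof -
    have "d4 p s q = (-80/9) * P ^ 2 + (-16/9) * P * y + (2) * y ^ 2 + (-16/3) * P * q + (8) * P + (-1/9) * y * S + (2/3) * y * q + (2) * y + (-5/144) * S ^ 2 + (1/6) * S * q + (-2) * S + (6) * q + (1)" unfolding d4_def P_def y_def sS[symmetric] by algebra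
    also have "\<dots> = ((21/50) + (37/10) * q + (-31/10) * q ^ 2 + (71/50) * q ^ 3 + (-1/5) * q ^ 4) + ((38/25) + (-18/25) * q + (8/25) * q ^ 2) * y + (((47/1800))) * (80 * y ^ 2 - S * (72 + 12 * q - 5 * S - 8 * y))"
      unfolding P S_def by algebra
    finally show ?thesis unfolding y0 unfolding y_def by simp
  qed
  show "d3 p s q * s = ((56/45) + (-62/9) * q + (-22/9) * q ^ 2 + (86/45) * q ^ 3 + (-2/9) * q ^ 4) + ((-4/45) + (-196/45) * q + (56/45) * q ^ 2) * (p * s)"
  proof -
    have "d3 p s q * s = (320/27) * P * y + (16/9) * y ^ 2 + (-4/9) * y * S + (4/3) * y * q + (-12) * y + (-5/27) * S ^ 2 + (2/3) * S * q + (-2) * S" unfolding d3_def P_def y_def sS[symmetric] by algebra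
    also have "\<dots> = ((56/45) + (-62/9) * q + (-22/9) * q ^ 2 + (86/45) * q ^ 3 + (-2/9) * q ^ 4) + ((-4/45) + (-196/45) * q + (56/45) * q ^ 2) * y + (((1/135))) * (80 * y ^ 2 - S * (72 + 12 * q - 5 * S - 8 * y))"
      unfolding P S_def by algebra
    finally show ?thesis unfolding y0 unfolding y_def by simp
  qed
  show "d5 p s q * s = ((938/1875) + (-7153/1875) * q + (10858/1875) * q ^ 2 + (-6542/1875) * q ^ 3 + (1074/625) * q ^ 4 + (-817/1875) * q ^ 5 + (14/375) * q ^ 6) + ((-472/1875) + (-856/1875) * q + (2144/1875) * q ^ 2 + (-616/1875) * q ^ 3 + (88/1875) * q ^ 4) * (p * s)"
  proof -
    have "d5 p s q * s = (256/81) * P ^ 2 * y + (64/81) * P * y ^ 2 + (-128/81) * y ^ 3 + (112/27) * P * y * q + (-16/9) * P * y + (32/81) * y ^ 2 * S + (-16/9) * y ^ 2 * q + (-1/81) * y * S ^ 2 + (1/9) * y * S * q + (5/3) * y * S + (-4) * y * q + (-4/3) * y + (-1/324) * S ^ 3 + (1/54) * S ^ 2 * q + (-7/18) * S ^ 2 + (2) * S * q + (-2/3) * S" unfolding d5_def P_def y_def sS[symmetric] by algebra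
    also have "\<dots> = ((938/1875) + (-7153/1875) * q + (10858/1875) * q ^ 2 + (-6542/1875) * q ^ 3 + (1074/625) * q ^ 4 + (-817/1875) * q ^ 5 + (14/375) * q ^ 6) + ((-472/1875) + (-856/1875) * q + (2144/1875) * q ^ 2 + (-616/1875) * q ^ 3 + (88/1875) * q ^ 4) * y + (((-577/202500) + (236/16875) * q + (-1387/202500) * q ^ 2) + ((-206/10125)) * y ^ 1) * (80 * y ^ 2 - S * (72 + 12 * q - 5 * S - 8 * y))"
      unfolding P S_def by algebra
    finally show ?thesis unfolding y0 unfolding y_def by simp
  qed
  show "d6 p s q = ((278/16875) + (1631/3750) * q + (-379/5625) * q ^ 2 + (1448/16875) * q ^ 3 + (1/625) * q ^ 4 + (-133/11250) * q ^ 5 + (4/3375) * q ^ 6) + ((856/5625) + (-122/5625) * q + (92/625) * q ^ 2 + (-322/5625) * q ^ 3 + (56/5625) * q ^ 4) * (p * s)"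
  proof -
    have "d6 p s q = (-320/729) * P ^ 3 + (-32/243) * P ^ 2 * y + (92/243) * P * y ^ 2 + (-80/81) * P ^ 2 * q + (-116/729) * y ^ 3 + (56/81) * P * y * q + (-8/27) * P * y + (23/972) * y ^ 2 * S + (-4/27) * y ^ 2 * q + (-2/9) * y ^ 2 + (4/9) * P + (-1/1944) * y * S ^ 2 + (1/162) * y * S * q + (1/6) * y * S + (-2/3) * y * q + (4/9) * y + (-5/46656) * S ^ 3 + (1/1296) * S ^ 2 * q + (-5/216) * S ^ 2 + (1/6) * S * q + (-5/36) * S + (1) * q" unfolding d6_def P_def y_def sS[symmetric] by algebra
    also have "\<dots> = ((278/16875) + (1631/3750) * q + (-379/5625) * q ^ 2 + (1448/16875) * q ^ 3 + (1/625) * q ^ 4 + (-133/11250) * q ^ 5 + (4/3375) * q ^ 6) + ((856/5625) + (-122/5625) * q + (92/625) * q ^ 2 + (-322/5625) * q ^ 3 + (56/5625) * q ^ 4) * y + (((119/67500) + (-553/810000) * q + (-4/16875) * q ^ 2) + ((-601/243000)) * y ^ 1) * (80 * y ^ 2 - S * (72 + 12 * q - 5 * S - 8 * y))"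
      unfolding P S_def by algebra
    finally show ?thesis unfolding y0 unfolding y_def by simp
  qed
qed

text \<open>Eliminating y = p s between d4 = u + v y and its quadratic equation leaves the nonzero
  polynomial \<open>?R\<close> in q.\<close>

lemma finite_d2_d4_zero:
  "finite {q. \<exists>p s. s ^ 2 = 6 * q - q ^ 2 - 1 \<and> d2 p s q = 0 \<and> d4 p s q = 0}"
proof (rule finite_subset)
  let ?R = "[:4928/25, -25424/25, 54576/25, -64576/25, 47024/25, -22032/25, 6544/25, -224/5, 16/5:] :: complex poly"
  show "finite {q. poly ?R q = 0}" by (intro poly_roots_finite) simp
  show "{q. \<exists>p s. s ^ 2 = 6 * q - q ^ 2 - 1 \<and> d2 p s q = 0 \<and> d4 p s q = 0} \<subseteq> {q. poly ?R q = 0}"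
  proof (clarify)
    fix q p s :: complex
    assume s: "s ^ 2 = 6 * q - q ^ 2 - 1" and d2: "d2 p s q = 0" and d4: "d4 p s q = 0"
    define y where "y = p * s"
    define S where "S = 6 * q - q ^ 2 - 1"
    define u v where "u = (21/50) + (37/10) * q + (-31/10) * q ^ 2 + (71/50) * q ^ 3 + (-1/5) * q ^ 4" and "v = (38/25) + (-18/25) * q + (8/25) * q ^ 2"
    have "80 * y ^ 2 = (80 * p ^ 2) * s ^ 2" unfolding y_def by algebra
    also have "\<dots> = (72 + 12 * q - 5 * S - 8 * y) * S"
      unfolding d_on_surface(1)[OF s d2] s y_def S_def ..
    finally have y2: "80 * y ^ 2 = (72 + 12 * q - 5 * S - 8 * y) * S" .
    have "u = - v * y"
      using d4 d_on_surface(2)[OF s d2] unfolding u_def v_def y_def by algebra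
    then have "80 * u ^ 2 - S * v ^ 2 * (72 + 12 * q - 5 * S) - 8 * S * u * v
        = v ^ 2 * (80 * y ^ 2 - (72 + 12 * q - 5 * S - 8 * y) * S)" by algebra
    also have "\<dots> = 0" using y2 by simp
    finally have "80 * u ^ 2 - S * v ^ 2 * (72 + 12 * q - 5 * S) - 8 * S * u * v = 0" .
    then have "(4928/25) + (-25424/25) * q + (54576/25) * q ^ 2 + (-64576/25) * q ^ 3 + (47024/25) * q ^ 4 + (-22032/25) * q ^ 5 + (6544/25) * q ^ 6 + (-224/5) * q ^ 7 + (16/5) * q ^ 8 = 0"
      unfolding u_def v_def S_def by algebra
    then show "poly ?R q = 0" by (simp add: algebra_simps power_numeral_reduce)
  qed
qed

text \<open>The eliminant \<open>?R\<close> of the preceding lemma is 16/25 (q-1)^2 times this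
  polynomial; q = 1 is excluded from the family.\<close>

definition sextic_resolvent :: "complex poly" where
  "sextic_resolvent = [:308, -973, 1157, -749, 284, -60, 5:]"

lemma poly_sextic_resolvent: "poly sextic_resolvent q = (308) + (-973) * q + (1157) * q ^ 2 + (-749) * q ^ 3 + (284) * q ^ 4 + (-60) * q ^ 5 + (5) * q ^ 6"
  by (simp add: sextic_resolvent_def algebra_simps power_numeral_reduce)

lemma card_roots_sextic_resolvent: "card {q. poly sextic_resolvent q = 0} = 6"
proof -
  have der: "poly (pderiv sextic_resolvent) q = (-973) + (2314) * q + (-2247) * q ^ 2 + (1136) * q ^ 3 + (-300) * q ^ 4 + (30) * q ^ 5" for q
    by (simp add: sextic_resolvent_def pderiv_pCons algebra_simps power_numeral_reduce)
  have "rsquarefree sextic_resolvent"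
    unfolding rsquarefree_roots
  proof (intro allI notI)
    fix q assume "poly sextic_resolvent q = 0 \<and> poly (pderiv sextic_resolvent) q = 0"
    then have g: "(308) + (-973) * q + (1157) * q ^ 2 + (-749) * q ^ 3 + (284) * q ^ 4 + (-60) * q ^ 5 + (5) * q ^ 6 = 0" and g': "(-973) + (2314) * q + (-2247) * q ^ 2 + (1136) * q ^ 3 + (-300) * q ^ 4 + (30) * q ^ 5 = 0"
      unfolding poly_sextic_resolvent der by auto
    \<comment> \<open>A Bezout certificate for the resolvent and its derivative.\<close>
    have "((-318152929686481/3302583722989376) + (55775487742633/471797674712768) * q + (-358082843965153/4953875584484064) * q ^ 2 + (630651147865/35133869393504) * q ^ 3 + (-2452986447305/1651291861494688) * q ^ 4) * ((308) + (-973) * q + (1157) * q ^ 2 + (-749) * q ^ 3 + (284) * q ^ 4 + (-60) * q ^ 5 + (5) * q ^ 6) + ((-3718018134871/117949418678192) + (194159220106373/3302583722989376) * q + (-30460035161537/707696512069152) * q ^ 2 + (176025637010569/9907751168968128) * q ^ 3 + (-11515525614755/3302583722989376) * q ^ 4 + (2452986447305/9907751168968128) * q ^ 5) * ((-973) + (2314) * q + (-2247) * q ^ 2 + (1136) * q ^ 3 + (-300) * q ^ 4 + (30) * q ^ 5) = 1" by algebra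
    then show False unfolding g g' by simp
  qed
  then have "smult (lead_coeff sextic_resolvent) (\<Prod>z|poly sextic_resolvent z = 0. [:- z, 1:]) = sextic_resolvent"
    by (rule complex_poly_decompose_rsquarefree)
  moreover have "sextic_resolvent \<noteq> 0" "degree sextic_resolvent = 6" by (simp_all add: sextic_resolvent_def)
  ultimately have "degree (\<Prod>z|poly sextic_resolvent z = 0. [:- z, 1:]) = 6"
    by (metis degree_smult_eq leading_coeff_0_iff)
  then show ?thesis by (simp add: degree_prod_sum_eq)
qed

text \<open>The points of the family with \<open>d2 = d4 = 0\<close>; there \<open>p s\<close> and the remaining invariants are polynomials in \<open>q\<close>.\<close>

lemma special_point:
  assumes root: "poly sextic_resolvent q = 0"
  shows "\<exists>p s. s ^ 2 = 6 * q - q ^ 2 - 1 \<and> q \<noteq> 1 \<and> d2 p s q = 0 \<and> d4 p s q = 0 \<and> d3 p s q \<noteq> 0 \<and> d5 p s q \<noteq> 0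
    \<and> d3 p s q ^ 2 = (42049/423) + (-1937768/6345) * q + (416930/1269) * q ^ 2 + (-1049684/6345) * q ^ 3 + (49451/1269) * q ^ 4 + (-1372/423) * q ^ 5 \<and> d6 p s q = (2612/2115) + (-107977/31725) * q + (19273/6345) * q ^ 2 + (-37606/31725) * q ^ 3 + (1219/6345) * q ^ 4 + (-23/2115) * q ^ 5"
proof -
  have g: "(308) + (-973) * q + (1157) * q ^ 2 + (-749) * q ^ 3 + (284) * q ^ 4 + (-60) * q ^ 5 + (5) * q ^ 6 = 0" using root unfolding poly_sextic_resolvent .
  define S where "S = 6 * q - q ^ 2 - 1"
  \<comment> \<open>A Bezout certificate: S = s^2 is a unit modulo the resolvent, so division by s
    is possible.\<close>
  have "((106/125) + (-529/500) * q + (719/1000) * q ^ 2 + (-279/1000) * q ^ 3 + (3/50) * q ^ 4 + (-1/200) * q ^ 5) * S + ((3/500) + (-1/1000) * q) * ((308) + (-973) * q + (1157) * q ^ 2 + (-749) * q ^ 3 + (284) * q ^ 4 + (-60) * q ^ 5 + (5) * q ^ 6) = 1" unfolding S_def by algebra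
  then have S: "S \<noteq> 0" unfolding g by (metis add_0_right mult_zero_right zero_neq_one)
  define s where "s = csqrt S"
  have s: "s ^ 2 = S" by (simp add: s_def)
  have s': "s ^ 2 = 6 * q - q ^ 2 - 1" using s S_def by simp
  have "s \<noteq> 0" using S s by auto
  \<comment> \<open>The solution of u + v y = 0 modulo the resolvent, where u + v y is the reduced
    form of d4; it is the intended value of p s.\<close>
  define y where "y = (483/188) + (-2243/188) * q + (2253/188) * q ^ 2 + (-1155/188) * q ^ 3 + (285/188) * q ^ 4 + (-25/188) * q ^ 5"
  define p where "p = y / s"
  have ps: "p * s = y" using \<open>s \<noteq> 0\<close> by (simp add: p_def)
  \<comment> \<open>The quadratic equation for p s holds modulo the resolvent; the second factor on
    the right is the quotient. The identities that follow reduce modulo the resolvent in the same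
    way.\<close>
  have "80 * y ^ 2 - S * (72 + 12 * q - 5 * S - 8 * y) = ((308) + (-973) * q + (1157) * q ^ 2 + (-749) * q ^ 3 + (284) * q ^ 4 + (-60) * q ^ 5 + (5) * q ^ 6) * ((4192/2209) + (-23805/2209) * q + (22475/2209) * q ^ 2 + (-6750/2209) * q ^ 3 + (625/2209) * q ^ 4)"
    unfolding y_def S_def by algebra
  then have y2: "80 * y ^ 2 = S * (72 + 12 * q - 5 * S - 8 * y)" unfolding g by simp
  have "S * (80 * p ^ 2) = 80 * (p * s) ^ 2" unfolding s[symmetric] by algebra
  also have "\<dots> = S * (72 + 12 * q - 5 * S - 8 * y)" unfolding ps y2 ..
  finally have "S * (80 * p ^ 2) = S * (72 + 12 * q - 5 * S - 8 * y)" .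
  then have p2: "80 * p ^ 2 = 72 + 12 * q - 5 * S - 8 * y" using S by simp
  have d2: "d2 p s q = 0"
  proof -
    have "12 * d2 p s q = - (80 * p ^ 2) - 8 * (p * s) - 5 * s ^ 2 + 12 * q + 72" unfolding d2_def by algebra
    also have "\<dots> = 0" unfolding p2 ps s by simp
    finally show ?thesis by simp
  qed
  note dd = d_on_surface[OF s' d2, unfolded ps]
  have "((21/50) + (37/10) * q + (-31/10) * q ^ 2 + (71/50) * q ^ 3 + (-1/5) * q ^ 4) + ((38/25) + (-18/25) * q + (8/25) * q ^ 2) * y = ((308) + (-973) * q + (1157) * q ^ 2 + (-749) * q ^ 3 + (284) * q ^ 4 + (-60) * q ^ 5 + (5) * q ^ 6) * ((33/2350) + (-2/235) * q)" unfolding y_def by algebra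
  then have d4: "d4 p s q = 0" unfolding dd(2) g by simp
  have "((56/45) + (-62/9) * q + (-22/9) * q ^ 2 + (86/45) * q ^ 3 + (-2/9) * q ^ 4) + ((-4/45) + (-196/45) * q + (56/45) * q ^ 2) * y = ((-4025/141) + (36617/423) * q + (-38747/423) * q ^ 2 + (2143/47) * q ^ 3 + (-4540/423) * q ^ 4 + (130/141) * q ^ 5) + ((308) + (-973) * q + (1157) * q ^ 2 + (-749) * q ^ 3 + (284) * q ^ 4 + (-60) * q ^ 5 + (5) * q ^ 6) * ((203/2115) + (-14/423) * q)" unfolding y_def by algebra
  then have d3: "d3 p s q * s = (-4025/141) + (36617/423) * q + (-38747/423) * q ^ 2 + (2143/47) * q ^ 3 + (-4540/423) * q ^ 4 + (130/141) * q ^ 5" unfolding dd(3) g by simp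
  have "((938/1875) + (-7153/1875) * q + (10858/1875) * q ^ 2 + (-6542/1875) * q ^ 3 + (1074/625) * q ^ 4 + (-817/1875) * q ^ 5 + (14/375) * q ^ 6) + ((-472/1875) + (-856/1875) * q + (2144/1875) * q ^ 2 + (-616/1875) * q ^ 3 + (88/1875) * q ^ 4) * y = ((644/235) + (-219/47) * q + (-192/235) * q ^ 2 + (162/47) * q ^ 3 + (-372/235) * q ^ 4 + (9/47) * q ^ 5) + ((308) + (-973) * q + (1157) * q ^ 2 + (-749) * q ^ 3 + (284) * q ^ 4 + (-60) * q ^ 5 + (5) * q ^ 6) * ((-826/88125) + (-1844/88125) * q + (704/88125) * q ^ 2 + (-22/17625) * q ^ 3)" unfolding y_def by algebra
  then have d5: "d5 p s q * s = (644/235) + (-219/47) * q + (-192/235) * q ^ 2 + (162/47) * q ^ 3 + (-372/235) * q ^ 4 + (9/47) * q ^ 5" unfolding dd(4) g by simp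
  have "((278/16875) + (1631/3750) * q + (-379/5625) * q ^ 2 + (1448/16875) * q ^ 3 + (1/625) * q ^ 4 + (-133/11250) * q ^ 5 + (4/3375) * q ^ 6) + ((856/5625) + (-122/5625) * q + (92/625) * q ^ 2 + (-322/5625) * q ^ 3 + (56/5625) * q ^ 4) * y = ((2612/2115) + (-107977/31725) * q + (19273/6345) * q ^ 2 + (-37606/31725) * q ^ 3 + (1219/6345) * q ^ 4 + (-23/2115) * q ^ 5) + ((308) + (-973) * q + (1157) * q ^ 2 + (-749) * q ^ 3 + (284) * q ^ 4 + (-60) * q ^ 5 + (5) * q ^ 6) * ((-2131/793125) + (-1111/528750) * q + (721/528750) * q ^ 2 + (-14/52875) * q ^ 3)" unfolding y_def by algebra
  then have d6: "d6 p s q = (2612/2115) + (-107977/31725) * q + (19273/6345) * q ^ 2 + (-37606/31725) * q ^ 3 + (1219/6345) * q ^ 4 + (-23/2115) * q ^ 5" unfolding dd(5) g by simp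
  \<comment> \<open>Bezout certificates show that d3 s and, next, d5 s are units modulo the
    resolvent.\<close>
  have "((-115400511/447440) + (1673159637/3937472) * q + (-3157416021/9843680) * q ^ 2 + (75330045/562496) * q ^ 3 + (-119817123/3937472) * q ^ 4 + (10454715/3937472) * q ^ 5) * ((-4025/141) + (36617/423) * q + (-38747/423) * q ^ 2 + (2143/47) * q ^ 3 + (-4540/423) * q ^ 4 + (130/141) * q ^ 5) + ((-4423085407/185061184) + (75112993/2065415) * q + (-11765852557/555183552) * q ^ 2 + (29584979/5442976) * q ^ 3 + (-45303765/92530592) * q ^ 4) * ((308) + (-973) * q + (1157) * q ^ 2 + (-749) * q ^ 3 + (284) * q ^ 4 + (-60) * q ^ 5 + (5) * q ^ 6) = 1" by algebra
  then have "d3 p s q \<noteq> 0" unfolding g d3[symmetric] by (metis add_0_right mult_zero_left mult_zero_right zero_neq_one)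
  have "((-11908789/1504) + (554802819/42112) * q + (-30236691/3008) * q ^ 2 + (178314417/42112) * q ^ 3 + (-41064045/42112) * q ^ 4 + (3625065/42112) * q ^ 5) * ((644/235) + (-219/47) * q + (-192/235) * q ^ 2 + (162/47) * q ^ 3 + (-372/235) * q ^ 4 + (9/47) * q ^ 5) + ((174309399/2474080) + (-142871121/9896320) * q + (-420831351/9896320) * q ^ 2 + (247774221/9896320) * q ^ 3 + (-6525117/1979264) * q ^ 4) * ((308) + (-973) * q + (1157) * q ^ 2 + (-749) * q ^ 3 + (284) * q ^ 4 + (-60) * q ^ 5 + (5) * q ^ 6) = 1" by algebra
  then have "d5 p s q \<noteq> 0" unfolding g d5[symmetric] by (metis add_0_right mult_zero_left mult_zero_right zero_neq_one)
  \<comment> \<open>Squaring removes the choice of the root s: after reduction S cancels and d3^2 is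
    a polynomial in q.\<close>
  have "((-4025/141) + (36617/423) * q + (-38747/423) * q ^ 2 + (2143/47) * q ^ 3 + (-4540/423) * q ^ 4 + (130/141) * q ^ 5) ^ 2 = ((42049/423) + (-1937768/6345) * q + (416930/1269) * q ^ 2 + (-1049684/6345) * q ^ 3 + (49451/1269) * q ^ 4 + (-1372/423) * q ^ 5) * S + ((308) + (-973) * q + (1157) * q ^ 2 + (-749) * q ^ 3 + (284) * q ^ 4 + (-60) * q ^ 5 + (5) * q ^ 6) * ((19672/6627) + (-2861812/298215) * q + (1284836/178929) * q ^ 2 + (-114400/59643) * q ^ 3 + (3380/19881) * q ^ 4)" unfolding S_def by algebra
  then have "(d3 p s q * s) ^ 2 = ((42049/423) + (-1937768/6345) * q + (416930/1269) * q ^ 2 + (-1049684/6345) * q ^ 3 + (49451/1269) * q ^ 4 + (-1372/423) * q ^ 5) * S" unfolding d3 g by simp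
  then have "d3 p s q ^ 2 * S = ((42049/423) + (-1937768/6345) * q + (416930/1269) * q ^ 2 + (-1049684/6345) * q ^ 3 + (49451/1269) * q ^ 4 + (-1372/423) * q ^ 5) * S" unfolding power_mult_distrib s .
  then have a: "d3 p s q ^ 2 = (42049/423) + (-1937768/6345) * q + (416930/1269) * q ^ 2 + (-1049684/6345) * q ^ 3 + (49451/1269) * q ^ 4 + (-1372/423) * q ^ 5" using S by simp
  have "q \<noteq> 1"
  proof
    assume "q = 1"
    then show False using g by simp
  qed
  with s' d2 d4 \<open>d3 p s q \<noteq> 0\<close> \<open>d5 p s q \<noteq> 0\<close> a d6 show ?thesis
    by (intro exI[of _ p] exI[of _ s] conjI)
qed

text \<open>A relation q A(k) + B(k) = 0 with deg A <= 2 and deg B <= 3 has seven unknown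
  coefficients against six linear conditions in C[q]/(resolvent), so one must exist. It is verified
  after multiplication by a^3, as a cubic form in a and b.\<close>

lemma kappa_relation:
  assumes root: "poly sextic_resolvent q = 0" and a: "a = (42049/423) + (-1937768/6345) * q + (416930/1269) * q ^ 2 + (-1049684/6345) * q ^ 3 + (49451/1269) * q ^ 4 + (-1372/423) * q ^ 5" and b: "b = (2612/2115) + (-107977/31725) * q + (19273/6345) * q ^ 2 + (-37606/31725) * q ^ 3 + (1219/6345) * q ^ 4 + (-23/2115) * q ^ 5" and "a \<noteq> 0" and k: "k = b / a"
  shows "q * ((-316143) + (-108799605) * k + (5029820550) * k ^ 2) + ((-1304996) + (302790642) * k + (-2130005130) * k ^ 2 + (1604441300) * k ^ 3) = 0"
proof -
  have g: "(308) + (-973) * q + (1157) * q ^ 2 + (-749) * q ^ 3 + (284) * q ^ 4 + (-60) * q ^ 5 + (5) * q ^ 6 = 0" using root unfolding poly_sextic_resolvent .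
  \<comment> \<open>The quadratic products are first reduced to degree 5, which keeps the final
    quotient small.\<close>
  have "a * a = ((13394825423/856575) + (-38374713944/856575) * q + (36990945244/856575) * q ^ 2 + (-16372738837/856575) * q ^ 3 + (648692579/171315) * q ^ 4 + (-14446631/57105) * q ^ 5) + ((308) + (-973) * q + (1157) * q ^ 2 + (-749) * q ^ 3 + (284) * q ^ 4 + (-60) * q ^ 5 + (5) * q ^ 6) * ((-752370632/40259025) + (-4457406716/40259025) * q + (3829642589/40259025) * q ^ 2 + (-13585544/536787) * q ^ 3 + (1882384/894645) * q ^ 4)" unfolding a by algebra
  then have a2: "a * a = (13394825423/856575) + (-38374713944/856575) * q + (36990945244/856575) * q ^ 2 + (-16372738837/856575) * q ^ 3 + (648692579/171315) * q ^ 4 + (-14446631/57105) * q ^ 5" unfolding g by (simp only: mult_zero_left add_0_right)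
  have "a * b = ((596736532/4282875) + (-1448329771/4282875) * q + (974810771/4282875) * q ^ 2 + (-200884283/4282875) * q ^ 3 + (-5043539/856575) * q ^ 4 + (436946/285525) * q ^ 5) + ((308) + (-973) * q + (1157) * q ^ 2 + (-749) * q ^ 3 + (284) * q ^ 4 + (-60) * q ^ 5 + (5) * q ^ 6) * ((-10826038/201295125) + (-280807984/201295125) * q + (146672701/201295125) * q ^ 2 + (-66953/536787) * q ^ 3 + (31556/4473225) * q ^ 4)" unfolding a b by algebra
  then have ab: "a * b = (596736532/4282875) + (-1448329771/4282875) * q + (974810771/4282875) * q ^ 2 + (-200884283/4282875) * q ^ 3 + (-5043539/856575) * q ^ 4 + (436946/285525) * q ^ 5" unfolding g by (simp only: mult_zero_left add_0_right)
  have "b * b = ((-12277612/21414375) + (57903211/21414375) * q + (-93390011/21414375) * q ^ 2 + (63194903/21414375) * q ^ 3 + (-3840901/4282875) * q ^ 4 + (130114/1427625) * q ^ 5) + ((308) + (-973) * q + (1157) * q ^ 2 + (-749) * q ^ 3 + (284) * q ^ 4 + (-60) * q ^ 5 + (5) * q ^ 6) * ((6857533/1006475625) + (-14643341/1006475625) * q + (4601909/1006475625) * q ^ 2 + (-7406/13419675) * q ^ 3 + (529/22366125) * q ^ 4)" unfolding b by algebra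
  then have b2: "b * b = (-12277612/21414375) + (57903211/21414375) * q + (-93390011/21414375) * q ^ 2 + (63194903/21414375) * q ^ 3 + (-3840901/4282875) * q ^ 4 + (130114/1427625) * q ^ 5" unfolding g by (simp only: mult_zero_left add_0_right)
  have "q * ((-316143) * ((a * a) * a) + (-108799605) * ((a * a) * b) + (5029820550) * ((a * b) * b))
      + (-1304996) * ((a * a) * a) + (302790642) * ((a * a) * b) + (-2130005130) * ((a * b) * b) + (1604441300) * ((b * b) * b) = ((308) + (-973) * q + (1157) * q ^ 2 + (-749) * q ^ 3 + (284) * q ^ 4 + (-60) * q ^ 5 + (5) * q ^ 6) * ((1353385987562499913/120777075) + (-3819395466890927066/120777075) * q + (1185281327011464364/40259025) * q ^ 2 + (-293619702002267113/24155415) * q ^ 3 + (17158697474685701/8051805) * q ^ 4 + (-851487678481/6627) * q ^ 5)"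
    unfolding a2 ab b2 unfolding a b by algebra
  then have rel: "q * ((-316143) * ((a * a) * a) + (-108799605) * ((a * a) * b) + (5029820550) * ((a * b) * b))
      + (-1304996) * ((a * a) * a) + (302790642) * ((a * a) * b) + (-2130005130) * ((a * b) * b) + (1604441300) * ((b * b) * b) = 0"
    unfolding g by (simp only: mult_zero_left)
  have ka: "b = k * a" unfolding k using \<open>a \<noteq> 0\<close> by simp
  have "(a * a * a) * (q * ((-316143) + (-108799605) * k + (5029820550) * k ^ 2) + ((-1304996) + (302790642) * k + (-2130005130) * k ^ 2 + (1604441300) * k ^ 3))
      = q * ((-316143) * ((a * a) * a) + (-108799605) * ((a * a) * (k * a)) + (5029820550) * ((a * (k * a)) * (k * a)))
        + (-1304996) * ((a * a) * a) + (302790642) * ((a * a) * (k * a)) + (-2130005130) * ((a * (k * a)) * (k * a)) + (1604441300) * (((k * a) * (k * a)) * (k * a))"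
    by algebra
  also have "\<dots> = 0" using rel unfolding ka .
  finally show ?thesis using \<open>a \<noteq> 0\<close> by (simp only: mult_eq_0_iff simp_thms)
qed

text \<open>The relation is linear in q, and its two coefficients are coprime as polynomials in k;
  hence the coefficient of q cannot vanish and k determines q.\<close>

lemma kappa_inject:
  fixes q q' k :: complex
  assumes "q * ((-316143) + (-108799605) * k + (5029820550) * k ^ 2) + ((-1304996) + (302790642) * k + (-2130005130) * k ^ 2 + (1604441300) * k ^ 3) = 0" "q' * ((-316143) + (-108799605) * k + (5029820550) * k ^ 2) + ((-1304996) + (302790642) * k + (-2130005130) * k ^ 2 + (1604441300) * k ^ 3) = 0"
  shows "q = q'"
proof -
  define A B where "A = (-316143) + (-108799605) * k + (5029820550) * k ^ 2" and "B = (-1304996) + (302790642) * k + (-2130005130) * k ^ 2 + (1604441300) * k ^ 3"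
  have "(q - q') * A = 0" using assms unfolding A_def[symmetric] B_def[symmetric] by algebra
  moreover have "A \<noteq> 0"
  proof
    assume "A = 0"
    then have "B = 0" using assms(1) unfolding A_def[symmetric] B_def[symmetric] by simp
    have "((-531161815728509707535084/360120359166880264801730053425) + (7737692182481188186983401/720240718333760529603460106850) * k + (-585306313854796770949027/72024071833376052960346010685) * k ^ 2) * A + ((-26667630885471168417149/65206978614579142597844124900) + (4051766578241953317893/159041411255071079506936890) * k) * B = 1" unfolding A_def B_def by algebra
    then show False using \<open>A = 0\<close> \<open>B = 0\<close> by simp
  qed
  ultimately show ?thesis by simp
qed

text \<open>For c2 = c4 = 0 the only monomials of weight 18 are c3 c5^3, c6^3, c3^2 c6^2, c3^4 c6
  and c3^6, so U6 = 0 expresses d3 d5^3 through d3 and d6.\<close>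

lemma chi_relation:
  assumes s: "s ^ 2 = 6 * q - q ^ 2 - 1" and q: "q \<noteq> 1" and d: "d2 p s q = 0" "d4 p s q = 0"
  shows "15125 * d3 p s q * d5 p s q ^ 3 = 16660 * d6 p s q ^ 3 + 57408 * d3 p s q ^ 2 * d6 p s q ^ 2
    - 663 * d3 p s q ^ 4 * d6 p s q + 8 * d3 p s q ^ 6"
proof -
  have "eval v U6 = 0" if "ricochet_vector v" for v
    using that eval_U_ricochet unfolding ricochet_vector_def by blast
  from vanishes_on_family[OF this s q, of 1 1 0 p]
  have "eval (shift 0 (vec7 1 0 0 (d3 p s q) 0 (d5 p s q) (d6 p s q))) U6 = 0" by (simp add: d)
  then have "W6 (\<lambda>c. c) (($) (vec7 1 0 0 (d3 p s q) 0 (d5 p s q) (d6 p s q))) = 0"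
    unfolding eval_U_shift W_eq_eval .
  moreover have "W6 (\<lambda>c. c) (($) (vec7 1 0 0 a 0 b c))
      = 1 / 15 * (15125 * a * b ^ 3 - (16660 * c ^ 3 + 57408 * a ^ 2 * c ^ 2 - 663 * a ^ 4 * c + 8 * a ^ 6))" for a b c
  proof -
    let ?v = "($) (vec7 1 0 0 a 0 b c)"
    have i: "i_coeff (\<lambda>c. c) ?v 0 = 0" "i_coeff (\<lambda>c. c) ?v 1 = 2 / 3 * b" "i_coeff (\<lambda>c. c) ?v 2 = 2 * c + 1 / 25 * a ^ 2"
      "i_coeff (\<lambda>c. c) ?v 3 = 0" "i_coeff (\<lambda>c. c) ?v 4 = - 1 / 15 * a * b"
      unfolding i_coeff_def nth_literal by simp_all
    have l: "l_coeff (\<lambda>c. c) ?v 0 = - 1 / 10 * a * b" "l_coeff (\<lambda>c. c) ?v 1 = 1 / 10 * a * (2 * c + 1 / 25 * a ^ 2)"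
      "l_coeff (\<lambda>c. c) ?v 2 = - 1 / 9 * b ^ 2"
      unfolding l_coeff_def Let_def nth_literal i by (simp_all add: power2_eq_square)
    have J2: "J2 (\<lambda>c. c) ?v = 2 * c - 1 / 20 * a ^ 2"
      unfolding J2_def by simp
    have J4: "J4 (\<lambda>c. c) ?v = 1 / 6 * (2 * c + 1 / 25 * a ^ 2) ^ 2"
      unfolding J4_def Let_def i by simp
    show ?thesis
      unfolding W6_def J6_def Let_def l J2 J4 by algebra
  qed
  ultimately show ?thesis by simp
qed

section \<open>Exponents surviving the degenerations, and the final count\<close>

lemma weight_mod_3:
  fixes a b c a' b' c' :: nat
  assumes "3 * a + 5 * b + 6 * c = 3 * a' + 5 * b' + 6 * c'"
  shows "b mod 3 = b' mod 3"
proof -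
  have "b + 3 * (a' + 2 * b' + 2 * c') = b' + 3 * (a + 2 * b + 2 * c)" using assms by simp
  then have "(b + 3 * (a' + 2 * b' + 2 * c')) mod 3 = (b' + 3 * (a + 2 * b + 2 * c)) mod 3" by (rule arg_cong)
  then show ?thesis unfolding mod_mult_self2 .
qed

lemma digits_base_3:
  fixes x x' y y' :: nat
  assumes "3 * x + y = 3 * x' + y'" "y < 3" "y' < 3"
  shows "y = y'" "x = x'"
  using assms by presburger+

lemma no_remainder:
  assumes van: "\<And>v. ricochet_vector v \<Longrightarrow> eval v (substitute const centred r) = 0"
    and small: "\<And>m. m \<in> Poly_Mapping.keys r \<Longrightarrow> Poly_Mapping.lookup m 6 < 3 \<and> Poly_Mapping.lookup m 5 < 6"
  shows "r = 0"
proof (rule ccontr)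
  assume "r \<noteq> 0"
  then obtain m0 where m0: "m0 \<in> Poly_Mapping.keys r" by (metis keys_eq_empty ex_in_conv)
  let ?e = "\<lambda>k m. Poly_Mapping.lookup m k :: nat"
  define W where "W m = 2 * ?e 2 m + 3 * ?e 3 m + 4 * ?e 4 m + 5 * ?e 5 m + 6 * ?e 6 m" for m :: "7 \<Rightarrow>\<^sub>0 nat"
  \<comment> \<open>A nonzero remainder has a nonzero component with fixed weight and fixed
    exponents of coordinates 0 and 1, and this component vanishes on the family by itself.\<close>
  define K where "K = {m \<in> Poly_Mapping.keys r. ?e 0 m = ?e 0 m0 \<and> ?e 1 m = ?e 1 m0 \<and> W m = W m0}"
  define g where "g p s q m = Poly_Mapping.lookup r m * d3 p s q ^ ?e 3 m * d5 p s q ^ ?e 5 m * d6 p s q ^ ?e 6 m"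
    for p s q m
  have K: "finite K" "m0 \<in> K" using m0 by (simp_all add: K_def)
  have g_cont: "isCont (\<lambda>p. g p s q m * d4 p s q ^ i * d2 p s q ^ j) p" for p s q m i j
    unfolding g_def d2_def d3_def d4_def d5_def d6_def by (intro continuous_intros)
  have sep: "(\<Sum>m\<in>K. (g p s q m * d4 p s q ^ ?e 4 m) * d2 p s q ^ ?e 2 m) = 0"
    if "s ^ 2 = 6 * q - q ^ 2 - 1" "q \<noteq> 1" for p s q
    using separate_weights[OF van that, where a = "?e 0 m0" and b = "?e 1 m0" and c = "W m0" and p = p]
    unfolding K_def W_def g_def by (simp only: mult.assoc)

  \<comment> \<open>The lowest power of c2 in the component: once it is divided out, setting d2 = 0
    keeps exactly the terms of \<open>K2\<close>.\<close>
  define \<mu> where "\<mu> = Min (?e 2 ` K)"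
  have \<mu>: "\<mu> \<le> ?e 2 m" if "m \<in> K" for m unfolding \<mu>_def using K that by (intro Min_le) auto
  have "\<mu> \<in> ?e 2 ` K" unfolding \<mu>_def using K by (intro Min_in) auto
  define K2 where "K2 = {m \<in> K. ?e 2 m = \<mu>}"
  have K2: "finite K2" "K2 \<noteq> {}" using K \<open>\<mu> \<in> ?e 2 ` K\<close> by (auto simp: K2_def)
  have sep2: "(\<Sum>m\<in>K2. g p s q m * d4 p s q ^ ?e 4 m) = 0"
    if s: "s ^ 2 = 6 * q - q ^ 2 - 1" and q: "q \<noteq> 1" and d2: "d2 p s q = 0" for p s q
  proof -
    \<comment> \<open>For fixed s and q, d2 is a quadratic polynomial in p; division is legitimate
      off its finitely many zeros, and continuity reaches them.\<close>
    have "(\<Sum>m\<in>K. (g p s q m * d4 p s q ^ ?e 4 m) * d2 p s q ^ (?e 2 m - \<mu>)) = 0"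
    proof (rule zero_off_finite[where A = "{p. d2 p s q = 0}" and a = p
          and F = "\<lambda>p. \<Sum>m\<in>K. (g p s q m * d4 p s q ^ ?e 4 m) * d2 p s q ^ (?e 2 m - \<mu>)"])
      show "isCont (\<lambda>p. \<Sum>m\<in>K. (g p s q m * d4 p s q ^ ?e 4 m) * d2 p s q ^ (?e 2 m - \<mu>)) p"
        by (intro continuous_sum g_cont)
      let ?P = "[:- 5 / 12 * s ^ 2 + q + 6, - 2 / 3 * s, - 20 / 3:]"
      have "poly ?P p = d2 p s q" for p unfolding d2_def by (simp add: algebra_simps power2_eq_square)
      moreover have "finite {p. poly ?P p = 0}" by (intro poly_roots_finite) simp
      ultimately show "finite {p. d2 p s q = 0}" by simp
    next
      fix p assume "p \<notin> {p. d2 p s q = 0}"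
      then have "d2 p s q \<noteq> 0" by simp
      from divide_out_power[where K = K and d = "?e 2" and \<mu> = \<mu>, OF \<mu> this sep[OF s q]]
      show "(\<Sum>m\<in>K. (g p s q m * d4 p s q ^ ?e 4 m) * d2 p s q ^ (?e 2 m - \<mu>)) = 0" .
    qed
    then show ?thesis
      using sum_at_zero_power[where d = "?e 2", OF K(1) \<mu>, where g = "\<lambda>m. g p s q m * d4 p s q ^ ?e 4 m"] unfolding d2 K2_def by simp
  qed

  define \<nu> where "\<nu> = Min (?e 4 ` K2)"
  have \<nu>: "\<nu> \<le> ?e 4 m" if "m \<in> K2" for m unfolding \<nu>_def using K2 that by (intro Min_le) auto
  have "\<nu> \<in> ?e 4 ` K2" unfolding \<nu>_def using K2 by (intro Min_in) auto
  define K3 where "K3 = {m \<in> K2. ?e 4 m = \<nu>}"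
  have K3: "finite K3" "K3 \<noteq> {}" using K2 \<open>\<nu> \<in> ?e 4 ` K2\<close> by (auto simp: K3_def)
  have sep3: "(\<Sum>m\<in>K3. g p0 s0 q0 m) = 0"
    if s0: "s0 ^ 2 = 6 * q0 - q0 ^ 2 - 1" and q0: "q0 \<noteq> 1" and d2: "d2 p0 s0 q0 = 0" and d4: "d4 p0 s0 q0 = 0" for p0 s0 q0
  proof -
    \<comment> \<open>Here d2 = 0 must persist while d4 becomes nonzero, so s and p have to move
      with q: \<open>sf\<close> and \<open>pf\<close> are roots of the conic and of d2 chosen close
      to s0 and p0.\<close>
    let ?hs = "\<lambda>q. s0 ^ 2 + 0 * s0 + - (6 * q - q ^ 2 - 1)"
    obtain sf where sf: "sf q ^ 2 + 0 * sf q + - (6 * q - q ^ 2 - 1) = 0" "cmod (sf q - s0) ^ 2 \<le> cmod (?hs q)" for q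
      using root_near[of 0 "- (6 * q - q ^ 2 - 1)" s0 for q] by metis
    have sf_lim: "sf \<midarrow>q0\<rightarrow> s0"
    proof (rule tendsto_of_square_bound[OF sf(2)])
      have "?hs \<midarrow>q0\<rightarrow> ?hs q0" by (intro tendsto_intros)
      then show "?hs \<midarrow>q0\<rightarrow> 0" using s0 by simp
    qed
    \<comment> \<open>This is -3/20 times d2, normalised to be monic in p.\<close>
    let ?hp = "\<lambda>q. p0 ^ 2 + 1 / 10 * sf q * p0 + (1 / 16 * sf q ^ 2 - 3 / 20 * q - 9 / 10)"
    obtain pf where pf: "pf q ^ 2 + 1 / 10 * sf q * pf q + (1 / 16 * sf q ^ 2 - 3 / 20 * q - 9 / 10) = 0"
      "cmod (pf q - p0) ^ 2 \<le> cmod (?hp q)" for q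
      using root_near[of "1 / 10 * sf q" "1 / 16 * sf q ^ 2 - 3 / 20 * q - 9 / 10" p0 for q] by metis
    have pf_lim: "pf \<midarrow>q0\<rightarrow> p0"
    proof (rule tendsto_of_square_bound[OF pf(2)])
      have "?hp \<midarrow>q0\<rightarrow> p0 ^ 2 + 1 / 10 * s0 * p0 + (1 / 16 * s0 ^ 2 - 3 / 20 * q0 - 9 / 10)"
        by (intro tendsto_intros sf_lim)
      moreover have "p0 ^ 2 + 1 / 10 * s0 * p0 + (1 / 16 * s0 ^ 2 - 3 / 20 * q0 - 9 / 10) = - 3 / 20 * d2 p0 s0 q0"
        unfolding d2_def by algebra
      ultimately show "?hp \<midarrow>q0\<rightarrow> 0" using d2 by simp
    qed
    have sfq: "sf q ^ 2 = 6 * q - q ^ 2 - 1" for q using sf(1)[of q] by (simp add: algebra_simps)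
    have d2f: "d2 (pf q) (sf q) q = 0" for q
    proof -
      have "d2 (pf q) (sf q) q
          = - 20 / 3 * (pf q ^ 2 + 1 / 10 * sf q * pf q + (1 / 16 * sf q ^ 2 - 3 / 20 * q - 9 / 10))"
        unfolding d2_def by algebra
      then show ?thesis unfolding pf(1) by simp
    qed
    let ?G = "\<lambda>p s q. \<Sum>m\<in>K2. g p s q m * d4 p s q ^ (?e 4 m - \<nu>)"
    \<comment> \<open>On this surface d4 vanishes over finitely many q only, so a punctured
      neighbourhood of q0 avoids them.\<close>
    let ?bad = "insert 1 {q. \<exists>p s. s ^ 2 = 6 * q - q ^ 2 - 1 \<and> d2 p s q = 0 \<and> d4 p s q = 0}"
    have "finite ?bad" using finite_d2_d4_zero by simp
    then have "\<not> q0 islimpt ?bad" by (rule islimpt_finite)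
    then have "\<forall>\<^sub>F q in at q0. q \<notin> ?bad" unfolding islimpt_iff_eventually by (rule notnotD)
    then have "\<forall>\<^sub>F q in at q0. ?G (pf q) (sf q) q = 0"
    proof (rule eventually_mono)
      fix q assume q: "q \<notin> ?bad"
      then have "d4 (pf q) (sf q) q \<noteq> 0" using sfq d2f by blast
      then show "?G (pf q) (sf q) q = 0"
      proof (rule divide_out_power[where K = K2 and d = "?e 4" and \<mu> = \<nu> and g = "g (pf q) (sf q) q", rotated])
        show "(\<Sum>m\<in>K2. g (pf q) (sf q) q m * d4 (pf q) (sf q) q ^ ?e 4 m) = 0"
          using q by (intro sep2 sfq d2f) auto
      qed (rule \<nu>)
    qed
    then have "((\<lambda>q. ?G (pf q) (sf q) q) \<longlongrightarrow> 0) (at q0)" by (rule tendsto_eventually)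
    moreover have "((\<lambda>q. ?G (pf q) (sf q) q) \<longlongrightarrow> ?G p0 s0 q0) (at q0)"
      unfolding g_def d3_def d4_def d5_def d6_def by (intro tendsto_intros pf_lim sf_lim)
    ultimately have "?G p0 s0 q0 = 0" by (intro tendsto_unique[of "at q0"]) simp_all
    then show ?thesis
      using sum_at_zero_power[where d = "?e 4", OF K2(1) \<nu>, where g = "g p0 s0 q0"] unfolding d4 K3_def by simp
  qed

  text \<open>On \<open>K3\<close> all exponents but those of the last three coordinates are constant, and the weight determines the
    exponent of \<open>d3\<close>. Writing \<open>d6 = \<kappa> d3\<^sup>2\<close> and \<open>d5\<^sup>3 = \<chi>(\<kappa>) d3\<^sup>5\<close>, the sum becomes a polynomial of degree at most five
    in \<open>\<kappa>\<close> whose terms have different degrees.\<close>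
  have in_K3: "?e 0 m = ?e 0 m0" "?e 1 m = ?e 1 m0" "?e 2 m = \<mu>" "?e 4 m = \<nu>" "W m = W m0"
    "Poly_Mapping.lookup r m \<noteq> 0" "?e 6 m < 3" "?e 5 m < 6" if "m \<in> K3" for m
    using that small[of m] by (auto simp: K3_def K2_def K_def in_keys_iff)
  obtain m1 where m1: "m1 \<in> K3" using K3(2) by blast
  \<comment> \<open>The powers of d5 and d3 common to all terms of \<open>K3\<close> once d6 and
    d5^3 are expressed through d3 and \<kappa>.\<close>
  define j n where "j = ?e 5 m1 mod 3" and "n = ?e 3 m1 + 5 * (?e 5 m1 div 3) + 2 * ?e 6 m1"
  have exps: "?e 5 m = 3 * (?e 5 m div 3) + j" "?e 3 m + 5 * (?e 5 m div 3) + 2 * ?e 6 m = n" if "m \<in> K3" for m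
  proof -
    have W: "3 * ?e 3 m + 5 * ?e 5 m + 6 * ?e 6 m = 3 * ?e 3 m1 + 5 * ?e 5 m1 + 6 * ?e 6 m1"
      using in_K3(3-5)[OF that] in_K3(3-5)[OF m1] unfolding W_def by linarith
    have e5: "?e 5 m = 3 * (?e 5 m div 3) + j"
      unfolding j_def weight_mod_3[OF W, symmetric] by (rule mult_div_mod_eq[symmetric])
    then show "?e 5 m = 3 * (?e 5 m div 3) + j" .
    have e5': "?e 5 m1 = 3 * (?e 5 m1 div 3) + j" unfolding j_def by (rule mult_div_mod_eq[symmetric])
    have "a + 5 * k + 2 * c = a' + 5 * k' + 2 * c'"
      if "3 * a + 5 * b + 6 * c = 3 * a' + 5 * b' + 6 * c'" "b = 3 * k + j" "b' = 3 * k' + j" for a b c k a' b' c' k' :: nat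
      using that by simp
    from this[OF W e5 e5'] show "?e 3 m + 5 * (?e 5 m div 3) + 2 * ?e 6 m = n" unfolding n_def .
  qed
  define X where "X = [:8 / 15125, - 663 / 15125, 57408 / 15125, 16660 / 15125 :: complex:]"
  define P where "P = (\<Sum>m\<in>K3. smult (Poly_Mapping.lookup r m) (X ^ (?e 5 m div 3) * monom 1 (?e 6 m)))"
  \<comment> \<open>The degree of a term in \<kappa>. The exponent of c6 is a digit in base 3 and
    the other digit is 0 or 1, so distinct monomials have distinct degrees and none exceeds
    5.\<close>
  define D where "D m = 3 * (?e 5 m div 3) + ?e 6 m" for m :: "7 \<Rightarrow>\<^sub>0 nat"
  have X: "degree X = 3" "X \<noteq> 0" by (simp_all add: X_def)
  have degX: "degree (X ^ i * monom 1 k) = 3 * i + k" "X ^ i * monom 1 k \<noteq> 0" for i k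
    using X by (simp_all add: degree_mult_eq degree_power_eq degree_monom_eq monom_eq_0_iff)
  have P_deg: "degree P \<le> 5"
    unfolding P_def
  proof (rule degree_sum_le[OF K3(1)])
    fix m assume "m \<in> K3"
    moreover have "3 * (b div 3) + c \<le> 5" if "c < 3" "b < 6" for b c :: nat using that by presburger
    ultimately have "3 * (?e 5 m div 3) + ?e 6 m \<le> 5" using in_K3(7,8)[of m] by blast
    then show "degree (smult (Poly_Mapping.lookup r m) (X ^ (?e 5 m div 3) * monom 1 (?e 6 m))) \<le> 5"
      using degree_smult_le[of "Poly_Mapping.lookup r m" "X ^ (?e 5 m div 3) * monom 1 (?e 6 m)"] degX by simp
  qed
  have D_inj: "m = m'" if m: "m \<in> K3" "m' \<in> K3" and D: "D m = D m'" for m m'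
  proof (rule poly_mapping_eqI)
    have "?e 6 m = ?e 6 m'" "?e 5 m div 3 = ?e 5 m' div 3"
      using digits_base_3[OF D[unfolded D_def] in_K3(7)[OF m(1)] in_K3(7)[OF m(2)]] by blast+
    then have "\<forall>k. ?e k m = ?e k m'"
      unfolding all_index using exps[OF m(1)] exps[OF m(2)] in_K3[OF m(1)] in_K3[OF m(2)] by simp
    then show "?e k m = ?e k m'" for k by blast
  qed
  \<comment> \<open>The term of largest degree has nothing to cancel against, so P is
    nonzero.\<close>
  have "Max (D ` K3) \<in> D ` K3" using K3 by (intro Max_in) auto
  then obtain m2 where m2: "m2 \<in> K3" "D m2 = Max (D ` K3)" by (metis imageE)
  have "coeff P (D m2) = (\<Sum>m\<in>K3. if m = m2 then Poly_Mapping.lookup r m2 * lead_coeff (X ^ (?e 5 m2 div 3) * monom 1 (?e 6 m2)) else 0)"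
    unfolding P_def coeff_sum
  proof (rule sum.cong)
    fix m assume m: "m \<in> K3"
    show "coeff (smult (Poly_Mapping.lookup r m) (X ^ (?e 5 m div 3) * monom 1 (?e 6 m))) (D m2)
      = (if m = m2 then Poly_Mapping.lookup r m2 * lead_coeff (X ^ (?e 5 m2 div 3) * monom 1 (?e 6 m2)) else 0)"
    proof (cases "m = m2")
      case True
      then show ?thesis unfolding degX(1) D_def by simp
    next
      case False
      have "D m \<le> D m2" using m K3(1) unfolding m2(2) by (intro Max_ge) auto
      then have "D m < D m2" using False D_inj[OF m m2(1)] by linarith
      then have "coeff (X ^ (?e 5 m div 3) * monom 1 (?e 6 m)) (D m2) = 0"
        unfolding D_def by (intro coeff_eq_0) (simp add: degX)
      then show ?thesis using False by simp
    qed
  qed simp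
  also have "\<dots> = Poly_Mapping.lookup r m2 * lead_coeff (X ^ (?e 5 m2 div 3) * monom 1 (?e 6 m2))"
    using K3(1) m2(1) by simp
  also have "\<dots> \<noteq> 0" using in_K3(6)[OF m2(1)] degX(2) by simp
  finally have "P \<noteq> 0" by auto

  define Z where "Z = {q. poly sextic_resolvent q = 0}"
  have "card Z = 6" unfolding Z_def by (rule card_roots_sextic_resolvent)
  have "\<exists>k. poly P k = 0 \<and> (q * ((-316143) + (-108799605) * k + (5029820550) * k ^ 2)
      + ((-1304996) + (302790642) * k + (-2130005130) * k ^ 2 + (1604441300) * k ^ 3) = 0)" if "q \<in> Z" for q
  proof -
    have root: "poly sextic_resolvent q = 0" using that by (simp add: Z_def)
    obtain p s where s: "s ^ 2 = 6 * q - q ^ 2 - 1" and q: "q \<noteq> 1" and d: "d2 p s q = 0" "d4 p s q = 0"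
      and d3: "d3 p s q \<noteq> 0" and d5: "d5 p s q \<noteq> 0"
      and a: "d3 p s q ^ 2 = (42049/423) + (-1937768/6345) * q + (416930/1269) * q ^ 2 + (-1049684/6345) * q ^ 3 + (49451/1269) * q ^ 4 + (-1372/423) * q ^ 5"
      and b: "d6 p s q = (2612/2115) + (-107977/31725) * q + (19273/6345) * q ^ 2 + (-37606/31725) * q ^ 3 + (1219/6345) * q ^ 4 + (-23/2115) * q ^ 5"
      using special_point[OF root] by blast
    define k where "k = d6 p s q / d3 p s q ^ 2"
    have d6: "d6 p s q = k * d3 p s q ^ 2" using d3 by (simp add: k_def)
    have Xk: "poly X k = (8 - 663 * k + 57408 * k ^ 2 + 16660 * k ^ 3) / 15125"
      by (simp add: X_def field_simps power_numeral_reduce)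
    have "d3 p s q * (15125 * d5 p s q ^ 3) = d3 p s q * (d3 p s q ^ 5 * (8 - 663 * k + 57408 * k ^ 2 + 16660 * k ^ 3))"
      using chi_relation[OF s q d] unfolding d6 by algebra
    then have "15125 * d5 p s q ^ 3 = d3 p s q ^ 5 * (8 - 663 * k + 57408 * k ^ 2 + 16660 * k ^ 3)" using d3 by simp
    then have chi: "d5 p s q ^ 3 = d3 p s q ^ 5 * poly X k" unfolding Xk by (simp add: field_simps)
    have "g p s q m = (d5 p s q ^ j * d3 p s q ^ n) * (Poly_Mapping.lookup r m * (poly X k ^ (?e 5 m div 3) * k ^ ?e 6 m))"
      if m: "m \<in> K3" for m
    proof -
      have "d5 p s q ^ ?e 5 m = (d5 p s q ^ 3) ^ (?e 5 m div 3) * d5 p s q ^ j"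
        by (subst exps(1)[OF m]) (simp add: power_add power_mult)
      then have "g p s q m = Poly_Mapping.lookup r m * d3 p s q ^ ?e 3 m
          * ((d3 p s q ^ 5 * poly X k) ^ (?e 5 m div 3) * d5 p s q ^ j) * (k * d3 p s q ^ 2) ^ ?e 6 m"
        unfolding g_def chi d6 by simp
      also have "\<dots> = (d5 p s q ^ j * d3 p s q ^ (?e 3 m + 5 * (?e 5 m div 3) + 2 * ?e 6 m))
          * (Poly_Mapping.lookup r m * (poly X k ^ (?e 5 m div 3) * k ^ ?e 6 m))"
        unfolding power_add power_mult power_mult_distrib by (simp only: mult_ac)
      finally show ?thesis unfolding exps(2)[OF m] .
    qed
    then have "(\<Sum>m\<in>K3. g p s q m) = (d5 p s q ^ j * d3 p s q ^ n) * poly P k"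
      unfolding P_def poly_sum sum_distrib_left by (intro sum.cong) (simp_all add: poly_monom)
    then have "poly P k = 0" using sep3[OF s q d] d3 d5 by simp
    moreover have "d3 p s q ^ 2 \<noteq> 0" using d3 by simp
    ultimately show ?thesis using kappa_relation[OF root a b _ k_def] by blast
  qed
  then obtain \<kappa> where \<kappa>: "poly P (\<kappa> q) = 0"
      "q * ((-316143) + (-108799605) * \<kappa> q + (5029820550) * \<kappa> q ^ 2)
        + ((-1304996) + (302790642) * \<kappa> q + (-2130005130) * \<kappa> q ^ 2 + (1604441300) * \<kappa> q ^ 3) = 0" if "q \<in> Z" for q
    by metis
  \<comment> \<open>Each \<kappa> gives back its q, so the six roots q produce six roots of P, one
    more than its degree allows.\<close>
  have "inj_on \<kappa> Z"
  proof (rule inj_onI)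
    fix q q' assume q: "q \<in> Z" "q' \<in> Z" and eq: "\<kappa> q = \<kappa> q'"
    show "q = q'" using kappa_inject[OF \<kappa>(2)[OF q(1)] \<kappa>(2)[OF q(2), folded eq]] .
  qed
  then have "card (\<kappa> ` Z) = 6" using \<open>card Z = 6\<close> by (simp add: card_image)
  moreover have "card (\<kappa> ` Z) \<le> card {k. poly P k = 0}"
    using \<kappa>(1) poly_roots_finite[OF \<open>P \<noteq> 0\<close>] by (intro card_mono) auto
  moreover have "card {k. poly P k = 0} \<le> degree P" by (rule card_poly_roots_bound[OF \<open>P \<noteq> 0\<close>])
  ultimately show False using P_deg by linarith
qed

section \<open>From vanishing to membership in the ideal\<close>

interpretation coord_ring_module: module "(*) :: coord_ring \<Rightarrow> coord_ring \<Rightarrow> coord_ring"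
  by unfold_locales (simp_all add: algebra_simps)

lemma mem_ideal_generated_pair: "f \<in> ideal_generated {g, h} \<longleftrightarrow> (\<exists>A B. f = A * g + B * h)"
proof
  assume "f \<in> ideal_generated {g, h}"
  then obtain A B where "f - A * g - B * h = 0"
    unfolding ideal_generated_def coord_ring_module.span_insert[of g] coord_ring_module.span_insert[of h]
      coord_ring_module.span_empty by auto
  then have "f = A * g + B * h" by (simp add: algebra_simps)
  then show "\<exists>A B. f = A * g + B * h" by blast
next
  assume "\<exists>A B. f = A * g + B * h"
  then obtain A B where "f = A * g + B * h" by blast
  moreover have "A * g + B * h \<in> coord_ring_module.span {g, h}"
    by (rule coord_ring_module.span_add; rule coord_ring_module.span_scale; rule coord_ring_module.span_base; simp)
  ultimately show "f \<in> ideal_generated {g, h}" unfolding ideal_generated_def by simp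
qed

text \<open>Written in the original coordinates, the remainder is a difference of polynomials that
  vanish on ricochet vectors, as \<open>no_remainder\<close> demands; the factors a0^12 and a0^20 go
  into the cofactors.\<close>

lemma vanishing_form_in_ideal:
  assumes van: "\<And>v. ricochet_vector v \<Longrightarrow> eval v f = 0"
  shows "\<exists>A B. f = A * U6 + B * U10"
proof -
  obtain N F where F: "coord 0 ^ N * f = substitute const centred F" using clear_denominator by blast
  obtain A B r where r: "F = A * u6 + B * u10 + r"
    and small: "\<And>m. m \<in> Poly_Mapping.keys r \<Longrightarrow> Poly_Mapping.lookup m 6 < 3 \<and> Poly_Mapping.lookup m 5 < 6"
    using division_by_u[of F] by blast
  let ?A = "substitute const centred A * coord 0 ^ 12" and ?B = "substitute const centred B * coord 0 ^ 20"
  have eq: "coord 0 ^ N * f = ?A * U6 + ?B * U10 + substitute const centred r"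
    unfolding F r const_hom.substitute_simps substitute_centred_u by (simp only: mult.assoc)
  have "r = 0"
  proof (rule no_remainder[OF _ small])
    fix v assume v: "ricochet_vector v"
    then have "eval v U6 = 0" "eval v U10 = 0"
      using eval_U_ricochet unfolding ricochet_vector_def by blast+
    moreover have "eval v (coord 0 ^ N * f) = 0" using van[OF v] by (simp add: eval_simps)
    ultimately show "eval v (substitute const centred r) = 0" unfolding eq by (simp add: eval_simps)
  qed
  then have "coord 0 ^ N * f = ?A * U6 + ?B * U10" using eq by simp
  then show ?thesis by (rule coord_0_power_cancel)
qed

theorem mainTheorem5:
  shows "homogeneous_ideal ricochet_locus = ideal_generated {U6, U10}"
proof (rule antisym)
  let ?H = "{f. homogeneous f \<and> (\<forall>p\<in>ricochet_locus. vanishes_at f p)}"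
  have "?H \<subseteq> ideal_generated {U6, U10}"
  proof
    fix f assume "f \<in> ?H"
    then have "eval v f = 0" if "ricochet_vector v" for v
      using that by (intro eval_zero_on_ricochet_vectors) auto
    then show "f \<in> ideal_generated {U6, U10}"
      unfolding mem_ideal_generated_pair by (rule vanishing_form_in_ideal)
  qed
  then show "homogeneous_ideal ricochet_locus \<subseteq> ideal_generated {U6, U10}"
    unfolding homogeneous_ideal_def ideal_generated_def
    by (intro coord_ring_module.span_minimal coord_ring_module.subspace_span)
  have "{U6, U10} \<subseteq> ?H"
    using homogeneous_U U_vanishes_on_locus by blast
  then show "ideal_generated {U6, U10} \<subseteq> homogeneous_ideal ricochet_locus"
    unfolding homogeneous_ideal_def ideal_generated_def by (rule coord_ring_module.span_mono)
qed

end
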